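(* Let $\mathcal{M}$ be a monoidal bicategory and $R\dashv R^\circ$ a biduality in $\mathcal{M}$. For every opmonoidal monad $B:R^\circ R\to R^\circ R$ on the enveloping monoidale $R^\circ R$, the category $\mathsf{rComod}_B((R,e1),(R,e1))$ of right $B$-comodules has a monoidal structure such that the forgetful functor $$\mathsf{rComod}_B((R,e1),(R,e1))\to\mathcal{M}(R,R)$$ is strong monoidal.
   Context: Conventions. $\mathcal{M}$ is a monoidal bicategory with unit object $I$; its 0-, 1-, 2-cells are called objects, arrows, cells. Tensor product is written by juxtaposition, composition by $\circ$, and $1$ denotes an identity arrow; $ff'$ for arrows $f:X\to Y$, $f':X'\to Y'$ means $(f1)\circ(1f')$. By coherence everything is written as if $\mathcal{M}$ were a Gray monoid; interchange isomorphisms are suppressed in equations. Equations between cells are in element notation: variables stand for identity arrows on tensor factors of the source, arrows are written as operations on them, and composites of named cells denote pastings of the corresponding whiskered cells. $\mathcal{M}(R,R)$ is monoidal under composition. Monoidale $(M,m,u,\alpha,\lambda,\rho)$: a pseudomonoid, i.e. arrows $m:MM\to M$ (written $xy$), $u:I\to M$ and invertible cells $\alpha:x(yz)\to(xy)z$, $\lambda:x\to ux$, $\rho:xu\to x$ satisfying the pentagon and triangle axioms. Opmonoidal arrow $C:M\to N$: an arrow with cells $C^2:C(xy)\to Cx\,Cy$ and $C^0:Cu\to u$ such that $\alpha\,(Cx\,C^2_{y,z})\,C^2_{x,yz}=(C^2_{x,y}\,Cz)\,C^2_{xy,z}\,C\alpha$; $\rho_{Cx}\,(Cx\,C^0)\,C^2_{x,u}=C\rho_x$;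 $(C^0\,Cx)\,C^2_{u,x}\,C\lambda_x=\lambda_{Cx}$. Opmonoidal cell $\xi:C\Rightarrow C'$: a cell with $C'^2\,\xi_{xy}=(\xi_x\xi_y)\,C^2$ and $C'^0\,\xi_u=C^0$. An opmonoidal monad on $M$ is a monad $(B,\mu,\eta)$ with $B:M\to M$ opmonoidal and $\mu,\eta$ opmonoidal cells. Biduality $R\dashv R^\circ$: arrows $n:I\to R^\circ R$, $e:RR^\circ\to I$ and invertible cells $\varsigma_l:1e\circ n1\cong 1_{R^\circ}$, $\varsigma_r:e1\circ1n\cong1_R$ satisfying the two swallowtail equations (the automorphisms of $e$ and of $n$ pasted from $\varsigma_l,\varsigma_r$ and interchange are identities). The enveloping monoidale $R^\circ R$ has product $1e1:R^\circ RR^\circ R\to R^\circ R$, unit $n$, associator an interchange isomorphism, unitors given by $\varsigma_l1$ and $1\varsigma_r$. It acts on $R$ by $a=e1:RR^\circ R\to R$ (written $x\cdot p$), with constraints $a^2:x\cdot(pq)\to(x\cdot p)\cdot q$ an interchange isomorphism and $a^0=\varsigma_r:x\cdot u\to x$. A right $B$-comodule from $e1$ to $e1$ is an arrow $Y:R\to R$ with a cell $y:Y\circ e1\Rightarrow e1\circ(YB)$, $y:Y(x\cdot p)\to Yx\cdot Bp$, such that $(y_{x,p}\cdot Bq)\,y_{x\cdot p,q}\,Ya^2=a^2\,(Yx\cdot B^2)\,y_{x,pq}$ and $Ya^0=a^0\,(Yx\cdot B^0)\,y_{x,u}$. A morphism is a cell $\gamma:Y\Rightarrow Y'$ with $y'\,\gamma_{x\cdot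 p}=(\gamma_x\cdot Bp)\,y$. These form $\mathsf{rComod}_B((R,e1),(R,e1))$; the forgetful functor sends $(Y,y)$ to $Y$. *)

theory Defs
  imports Main
begin

section \<open>Categories, monoidal categories, strong monoidal functors\<close>

record ('x, 'f) cat =
  Obj :: "'x set"
  Arr :: "'f set"
  Dom :: "'f \<Rightarrow> 'x"
  Cod :: "'f \<Rightarrow> 'x"
  Id :: "'x \<Rightarrow> 'f"
  Cmp :: "'f \<Rightarrow> 'f \<Rightarrow> 'f"  \<comment> \<open>\<open>Cmp C g f\<close> is \<open>g\<close> after \<open>f\<close>\<close>

definition in_hom :: "('x, 'f) cat \<Rightarrow> 'f \<Rightarrow> 'x \<Rightarrow> 'x \<Rightarrow> bool" where
  "in_hom C f X Y \<longleftrightarrow> f \<in> Arr C \<and> Dom C f = X \<and> Cod C f = Y"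

locale category =
  fixes C :: "('x, 'f) cat"
  assumes Dom_in: "f \<in> Arr C \<Longrightarrow> Dom C f \<in> Obj C"
    and Cod_in: "f \<in> Arr C \<Longrightarrow> Cod C f \<in> Obj C"
    and Id_hom: "X \<in> Obj C \<Longrightarrow> in_hom C (Id C X) X X"
    and Cmp_hom: "in_hom C f X Y \<Longrightarrow> in_hom C g Y Z \<Longrightarrow> in_hom C (Cmp C g f) X Z"
    and Cmp_Id_right: "in_hom C f X Y \<Longrightarrow> Cmp C f (Id C X) = f"
    and Cmp_Id_left: "in_hom C f X Y \<Longrightarrow> Cmp C (Id C Y) f = f"
    and Cmp_assoc: "in_hom C f W X \<Longrightarrow> in_hom C g X Y \<Longrightarrow> in_hom C h Y Z \<Longrightarrow>
      Cmp C (Cmp C h g) f = Cmp C h (Cmp C g f)"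

definition iso_in :: "('x, 'f) cat \<Rightarrow> 'f \<Rightarrow> 'x \<Rightarrow> 'x \<Rightarrow> bool" where
  "iso_in C f X Y \<longleftrightarrow> in_hom C f X Y \<and>
    (\<exists>g. in_hom C g Y X \<and> Cmp C g f = Id C X \<and> Cmp C f g = Id C Y)"

record ('x, 'f) monoidal_structure =
  TO :: "'x \<Rightarrow> 'x \<Rightarrow> 'x"
  TA :: "'f \<Rightarrow> 'f \<Rightarrow> 'f"
  TU :: "'x"
  TAss :: "'x \<Rightarrow> 'x \<Rightarrow> 'x \<Rightarrow> 'f"
  TLun :: "'x \<Rightarrow> 'f"
  TRun :: "'x \<Rightarrow> 'f"

locale monoidal_category = category C
  for C :: "('x, 'f) cat" +
  fixes T :: "('x, 'f) monoidal_structure"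
  assumes TU_in: "TU T \<in> Obj C"
    and TO_in: "X \<in> Obj C \<Longrightarrow> Y \<in> Obj C \<Longrightarrow> TO T X Y \<in> Obj C"
    and TA_hom: "in_hom C f X X' \<Longrightarrow> in_hom C g Y Y' \<Longrightarrow>
      in_hom C (TA T f g) (TO T X Y) (TO T X' Y')"
    and TA_Id: "X \<in> Obj C \<Longrightarrow> Y \<in> Obj C \<Longrightarrow> TA T (Id C X) (Id C Y) = Id C (TO T X Y)"
    and TA_Cmp: "in_hom C f X X' \<Longrightarrow> in_hom C f' X' X'' \<Longrightarrow>
      in_hom C g Y Y' \<Longrightarrow> in_hom C g' Y' Y'' \<Longrightarrow>
      TA T (Cmp C f' f) (Cmp C g' g) = Cmp C (TA T f' g') (TA T f g)"
    and TAss_iso: "X \<in> Obj C \<Longrightarrow> Y \<in> Obj C \<Longrightarrow> Z \<in> Obj C \<Longrightarrow>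
      iso_in C (TAss T X Y Z) (TO T (TO T X Y) Z) (TO T X (TO T Y Z))"
    and TAss_natural: "in_hom C f X X' \<Longrightarrow> in_hom C g Y Y' \<Longrightarrow> in_hom C h Z Z' \<Longrightarrow>
      Cmp C (TAss T X' Y' Z') (TA T (TA T f g) h) = Cmp C (TA T f (TA T g h)) (TAss T X Y Z)"
    and TLun_iso: "X \<in> Obj C \<Longrightarrow> iso_in C (TLun T X) (TO T (TU T) X) X"
    and TLun_natural: "in_hom C f X X' \<Longrightarrow>
      Cmp C (TLun T X') (TA T (Id C (TU T)) f) = Cmp C f (TLun T X)"
    and TRun_iso: "X \<in> Obj C \<Longrightarrow> iso_in C (TRun T X) (TO T X (TU T)) X"
    and TRun_natural: "in_hom C f X X' \<Longrightarrow>
      Cmp C (TRun T X') (TA T f (Id C (TU T))) = Cmp C f (TRun T X)"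
    and T_pentagon: "W \<in> Obj C \<Longrightarrow> X \<in> Obj C \<Longrightarrow> Y \<in> Obj C \<Longrightarrow> Z \<in> Obj C \<Longrightarrow>
      Cmp C (TA T (Id C W) (TAss T X Y Z))
        (Cmp C (TAss T W (TO T X Y) Z) (TA T (TAss T W X Y) (Id C Z))) =
      Cmp C (TAss T W X (TO T Y Z)) (TAss T (TO T W X) Y Z)"
    and T_triangle: "X \<in> Obj C \<Longrightarrow> Y \<in> Obj C \<Longrightarrow>
      Cmp C (TA T (Id C X) (TLun T Y)) (TAss T X (TU T) Y) = TA T (TRun T X) (Id C Y)"

locale strong_monoidal_functor =
  source: monoidal_category C T + target: monoidal_category D S
  for C :: "('x, 'f) cat" and T :: "('x, 'f) monoidal_structure"
    and D :: "('y, 'g) cat" and S :: "('y, 'g) monoidal_structure" +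
  fixes FO :: "'x \<Rightarrow> 'y" and FA :: "'f \<Rightarrow> 'g"
    and \<phi> :: "'x \<Rightarrow> 'x \<Rightarrow> 'g" and \<phi>\<^sub>0 :: "'g"
  assumes FO_in: "X \<in> Obj C \<Longrightarrow> FO X \<in> Obj D"
    and FA_hom: "in_hom C f X Y \<Longrightarrow> in_hom D (FA f) (FO X) (FO Y)"
    and FA_Id: "X \<in> Obj C \<Longrightarrow> FA (Id C X) = Id D (FO X)"
    and FA_Cmp: "in_hom C f X Y \<Longrightarrow> in_hom C g Y Z \<Longrightarrow> FA (Cmp C g f) = Cmp D (FA g) (FA f)"
    and phi_iso: "X \<in> Obj C \<Longrightarrow> Y \<in> Obj C \<Longrightarrow>
      iso_in D (\<phi> X Y) (TO S (FO X) (FO Y)) (FO (TO T X Y))"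
    and phi_natural: "in_hom C f X X' \<Longrightarrow> in_hom C g Y Y' \<Longrightarrow>
      Cmp D (\<phi> X' Y') (TA S (FA f) (FA g)) = Cmp D (FA (TA T f g)) (\<phi> X Y)"
    and phi0_iso: "iso_in D \<phi>\<^sub>0 (TU S) (FO (TU T))"
    and phi_assoc: "X \<in> Obj C \<Longrightarrow> Y \<in> Obj C \<Longrightarrow> Z \<in> Obj C \<Longrightarrow>
      Cmp D (FA (TAss T X Y Z)) (Cmp D (\<phi> (TO T X Y) Z) (TA S (\<phi> X Y) (Id D (FO Z)))) =
      Cmp D (\<phi> X (TO T Y Z))
        (Cmp D (TA S (Id D (FO X)) (\<phi> Y Z)) (TAss S (FO X) (FO Y) (FO Z)))"
    and phi_left_unit: "X \<in> Obj C \<Longrightarrow>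
      Cmp D (FA (TLun T X)) (Cmp D (\<phi> (TU T) X) (TA S \<phi>\<^sub>0 (Id D (FO X)))) = TLun S (FO X)"
    and phi_right_unit: "X \<in> Obj C \<Longrightarrow>
      Cmp D (FA (TRun T X)) (Cmp D (\<phi> X (TU T)) (TA S (Id D (FO X)) \<phi>\<^sub>0)) = TRun S (FO X)"


section \<open>Bicategories\<close>

record ('o, 'a, 'c) bicat =
  Ob :: "'o set"
  Ar :: "'a set"
  Ce :: "'c set"
  src :: "'a \<Rightarrow> 'o"
  trg :: "'a \<Rightarrow> 'o"
  cdom :: "'c \<Rightarrow> 'a"
  ccod :: "'c \<Rightarrow> 'a"
  ident :: "'o \<Rightarrow> 'a"
  cident :: "'a \<Rightarrow> 'c"
  acomp :: "'a \<Rightarrow> 'a \<Rightarrow> 'a"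
  vcomp :: "'c \<Rightarrow> 'c \<Rightarrow> 'c"
  hcomp :: "'c \<Rightarrow> 'c \<Rightarrow> 'c"
  bass :: "'a \<Rightarrow> 'a \<Rightarrow> 'a \<Rightarrow> 'c"
  blun :: "'a \<Rightarrow> 'c"
  brun :: "'a \<Rightarrow> 'c"

text \<open>All compositions are written in applicative order: in \<open>f \<odot> g\<close>, \<open>\<theta> \<bullet> \<phi>\<close> and \<open>\<theta> \<star> \<phi>\<close> the
  second argument comes first.\<close>

locale bicat_data =
  fixes M :: "('o, 'a, 'c, 'z) bicat_scheme"
begin

abbreviation arr :: "'a \<Rightarrow> 'o \<Rightarrow> 'o \<Rightarrow> bool" ("\<guillemotleft>_ : _ \<rightarrow> _\<guillemotright>") where
  "\<guillemotleft>f : X \<rightarrow> Y\<guillemotright> \<equiv> f \<in> Ar M \<and> src M f = X \<and> trg M f = Y"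

abbreviation cell :: "'c \<Rightarrow> 'a \<Rightarrow> 'a \<Rightarrow> bool" ("\<guillemotleft>_ : _ \<Rightarrow> _\<guillemotright>") where
  "\<guillemotleft>\<theta> : f \<Rightarrow> g\<guillemotright> \<equiv> \<theta> \<in> Ce M \<and> cdom M \<theta> = f \<and> ccod M \<theta> = g"

abbreviation one :: "'o \<Rightarrow> 'a" where "one \<equiv> ident M"

abbreviation cid :: "'a \<Rightarrow> 'c" where "cid \<equiv> cident M"

abbreviation arrow_comp :: "'a \<Rightarrow> 'a \<Rightarrow> 'a" (infixr "\<odot>" 60) where "f \<odot> g \<equiv> acomp M f g"

abbreviation vert_comp :: "'c \<Rightarrow> 'c \<Rightarrow> 'c" (infixr "\<bullet>" 55) where "\<theta> \<bullet> \<phi> \<equiv> vcomp M \<theta> \<phi>"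

abbreviation hor_comp :: "'c \<Rightarrow> 'c \<Rightarrow> 'c" (infixr "\<star>" 60) where "\<theta> \<star> \<phi> \<equiv> hcomp M \<theta> \<phi>"

definition inverse_cells :: "'c \<Rightarrow> 'c \<Rightarrow> bool" where
  "inverse_cells \<theta> \<phi> \<longleftrightarrow> \<theta> \<in> Ce M \<and> \<guillemotleft>\<phi> : ccod M \<theta> \<Rightarrow> cdom M \<theta>\<guillemotright> \<and>
    \<phi> \<bullet> \<theta> = cid (cdom M \<theta>) \<and> \<theta> \<bullet> \<phi> = cid (ccod M \<theta>)"

definition icell :: "'c \<Rightarrow> 'a \<Rightarrow> 'a \<Rightarrow> bool" ("\<guillemotleft>_ : _ \<cong> _\<guillemotright>") where
  "\<guillemotleft>\<theta> : f \<cong> g\<guillemotright> \<longleftrightarrow> \<guillemotleft>\<theta> : f \<Rightarrow> g\<guillemotright> \<and> (\<exists>\<phi>. inverse_cells \<theta> \<phi>)"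

definition cinv :: "'c \<Rightarrow> 'c" where
  "cinv \<theta> = (THE \<phi>. inverse_cells \<theta> \<phi>)"

definition adjoint_equivalence :: "'o \<Rightarrow> 'o \<Rightarrow> 'a \<Rightarrow> 'a \<Rightarrow> 'c \<Rightarrow> 'c \<Rightarrow> bool" where
  "adjoint_equivalence X Y f f' \<eta> \<epsilon> \<longleftrightarrow>
    \<guillemotleft>f : X \<rightarrow> Y\<guillemotright> \<and> \<guillemotleft>f' : Y \<rightarrow> X\<guillemotright> \<and>
    \<guillemotleft>\<eta> : one X \<cong> f' \<odot> f\<guillemotright> \<and> \<guillemotleft>\<epsilon> : f \<odot> f' \<cong> one Y\<guillemotright> \<and>
    blun M f \<bullet> (\<epsilon> \<star> cid f) \<bullet> cinv (bass M f f' f) \<bullet> (cid f \<star> \<eta>) \<bullet> cinv (brun M f) = cid f \<and>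
    brun M f' \<bullet> (cid f' \<star> \<epsilon>) \<bullet> bass M f' f f' \<bullet> (\<eta> \<star> cid f') \<bullet> cinv (blun M f') = cid f'"

text \<open>The category \<open>M(X, Y)\<close>, and the monoidal structure of \<open>M(X, X)\<close> given by composition.\<close>

definition homcat :: "'o \<Rightarrow> 'o \<Rightarrow> ('a, 'c) cat" where
  "homcat X Y =
    \<lparr> Obj = {f. \<guillemotleft>f : X \<rightarrow> Y\<guillemotright>},
      Arr = {\<theta> \<in> Ce M. src M (cdom M \<theta>) = X \<and> trg M (cdom M \<theta>) = Y},
      Dom = cdom M, Cod = ccod M, Id = cid, Cmp = (\<bullet>) \<rparr>"

definition comp_monoidal :: "'o \<Rightarrow> ('a, 'c) monoidal_structure" where
  "comp_monoidal X =
    \<lparr> TO = (\<odot>), TA = (\<star>), TU = one X, TAss = bass M, TLun = blun M, TRun = brun M \<rparr>"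

end

locale bicategory = bicat_data M
  for M :: "('o, 'a, 'c, 'z) bicat_scheme" +
  assumes src_in: "f \<in> Ar M \<Longrightarrow> src M f \<in> Ob M"
    and trg_in: "f \<in> Ar M \<Longrightarrow> trg M f \<in> Ob M"
    and cdom_in: "\<theta> \<in> Ce M \<Longrightarrow> cdom M \<theta> \<in> Ar M"
    and ccod_in: "\<theta> \<in> Ce M \<Longrightarrow> ccod M \<theta> \<in> Ar M"
    and src_parallel: "\<theta> \<in> Ce M \<Longrightarrow> src M (cdom M \<theta>) = src M (ccod M \<theta>)"
    and trg_parallel: "\<theta> \<in> Ce M \<Longrightarrow> trg M (cdom M \<theta>) = trg M (ccod M \<theta>)"
    and one_arr: "X \<in> Ob M \<Longrightarrow> \<guillemotleft>one X : X \<rightarrow> X\<guillemotright>"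
    and acomp_arr: "\<guillemotleft>g : X \<rightarrow> Y\<guillemotright> \<Longrightarrow> \<guillemotleft>f : Y \<rightarrow> Z\<guillemotright> \<Longrightarrow> \<guillemotleft>f \<odot> g : X \<rightarrow> Z\<guillemotright>"
    and cid_cell: "f \<in> Ar M \<Longrightarrow> \<guillemotleft>cid f : f \<Rightarrow> f\<guillemotright>"
    and vcomp_cell: "\<guillemotleft>\<phi> : f \<Rightarrow> g\<guillemotright> \<Longrightarrow> \<guillemotleft>\<theta> : g \<Rightarrow> h\<guillemotright> \<Longrightarrow> \<guillemotleft>\<theta> \<bullet> \<phi> : f \<Rightarrow> h\<guillemotright>"
    and vcomp_cid_left: "\<guillemotleft>\<theta> : f \<Rightarrow> g\<guillemotright> \<Longrightarrow> cid g \<bullet> \<theta> = \<theta>"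
    and vcomp_cid_right: "\<guillemotleft>\<theta> : f \<Rightarrow> g\<guillemotright> \<Longrightarrow> \<theta> \<bullet> cid f = \<theta>"
    and vcomp_assoc: "\<guillemotleft>\<psi> : f \<Rightarrow> g\<guillemotright> \<Longrightarrow> \<guillemotleft>\<phi> : g \<Rightarrow> h\<guillemotright> \<Longrightarrow> \<guillemotleft>\<theta> : h \<Rightarrow> k\<guillemotright> \<Longrightarrow>
      (\<theta> \<bullet> \<phi>) \<bullet> \<psi> = \<theta> \<bullet> (\<phi> \<bullet> \<psi>)"
    and hcomp_cell: "\<guillemotleft>\<theta> : f \<Rightarrow> f'\<guillemotright> \<Longrightarrow> \<guillemotleft>\<phi> : g \<Rightarrow> g'\<guillemotright> \<Longrightarrow> src M f = trg M g \<Longrightarrow>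
      \<guillemotleft>\<theta> \<star> \<phi> : f \<odot> g \<Rightarrow> f' \<odot> g'\<guillemotright>"
    and hcomp_cid: "f \<in> Ar M \<Longrightarrow> g \<in> Ar M \<Longrightarrow> src M f = trg M g \<Longrightarrow>
      cid f \<star> cid g = cid (f \<odot> g)"
    and hcomp_vcomp: "\<guillemotleft>\<theta> : f \<Rightarrow> f'\<guillemotright> \<Longrightarrow> \<guillemotleft>\<theta>' : f' \<Rightarrow> f''\<guillemotright> \<Longrightarrow>
      \<guillemotleft>\<phi> : g \<Rightarrow> g'\<guillemotright> \<Longrightarrow> \<guillemotleft>\<phi>' : g' \<Rightarrow> g''\<guillemotright> \<Longrightarrow> src M f = trg M g \<Longrightarrow>
      (\<theta>' \<bullet> \<theta>) \<star> (\<phi>' \<bullet> \<phi>) = (\<theta>' \<star> \<phi>') \<bullet> (\<theta> \<star> \<phi>)"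
    and bass_icell: "\<guillemotleft>h : W \<rightarrow> X\<guillemotright> \<Longrightarrow> \<guillemotleft>g : X \<rightarrow> Y\<guillemotright> \<Longrightarrow> \<guillemotleft>f : Y \<rightarrow> Z\<guillemotright> \<Longrightarrow>
      \<guillemotleft>bass M f g h : (f \<odot> g) \<odot> h \<cong> f \<odot> (g \<odot> h)\<guillemotright>"
    and bass_natural: "\<guillemotleft>\<theta> : f \<Rightarrow> f'\<guillemotright> \<Longrightarrow> \<guillemotleft>\<phi> : g \<Rightarrow> g'\<guillemotright> \<Longrightarrow> \<guillemotleft>\<psi> : h \<Rightarrow> h'\<guillemotright> \<Longrightarrow>
      src M f = trg M g \<Longrightarrow> src M g = trg M h \<Longrightarrow>
      bass M f' g' h' \<bullet> ((\<theta> \<star> \<phi>) \<star> \<psi>) = (\<theta> \<star> (\<phi> \<star> \<psi>)) \<bullet> bass M f g h"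
    and blun_icell: "\<guillemotleft>f : X \<rightarrow> Y\<guillemotright> \<Longrightarrow> \<guillemotleft>blun M f : one Y \<odot> f \<cong> f\<guillemotright>"
    and blun_natural: "\<guillemotleft>\<theta> : f \<Rightarrow> g\<guillemotright> \<Longrightarrow>
      blun M g \<bullet> (cid (one (trg M f)) \<star> \<theta>) = \<theta> \<bullet> blun M f"
    and brun_icell: "\<guillemotleft>f : X \<rightarrow> Y\<guillemotright> \<Longrightarrow> \<guillemotleft>brun M f : f \<odot> one X \<cong> f\<guillemotright>"
    and brun_natural: "\<guillemotleft>\<theta> : f \<Rightarrow> g\<guillemotright> \<Longrightarrow>
      brun M g \<bullet> (\<theta> \<star> cid (one (src M f))) = \<theta> \<bullet> brun M f"
    and bicat_pentagon: "\<guillemotleft>k : V \<rightarrow> W\<guillemotright> \<Longrightarrow> \<guillemotleft>h : W \<rightarrow> X\<guillemotright> \<Longrightarrow> \<guillemotleft>g : X \<rightarrow> Y\<guillemotright> \<Longrightarrow> \<guillemotleft>f : Y \<rightarrow> Z\<guillemotright> \<Longrightarrow>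
      (cid f \<star> bass M g h k) \<bullet> bass M f (g \<odot> h) k \<bullet> (bass M f g h \<star> cid k) =
      bass M f g (h \<odot> k) \<bullet> bass M (f \<odot> g) h k"
    and bicat_triangle: "\<guillemotleft>g : X \<rightarrow> Y\<guillemotright> \<Longrightarrow> \<guillemotleft>f : Y \<rightarrow> Z\<guillemotright> \<Longrightarrow>
      (cid f \<star> blun M g) \<bullet> bass M f (one Y) g = brun M f \<star> cid g"


section \<open>Pasting in a bicategory\<close>

text \<open>
  A \<^emph>\<open>pasting cell\<close> \<open>(ps, \<theta>, qs)\<close> consists of two nonempty paths of arrows with the same
  endpoints and a cell between their composites.  Paths are written in applicative order and
  composed with brackets to the right, so that \<open>pth [f, g, h] = f \<odot> (g \<odot> h)\<close>.  The operations
  below supply all associativity constraints, so that a pasting diagram in a bicategory can be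
  written as the sequence of rewritings \<open>us \<lhd> P \<rhd> vs\<close> of a path: the pasting cell \<open>P\<close> replaces a
  segment of a path, to the left of which stands \<open>us\<close> and to the right of which stands \<open>vs\<close> (both
  possibly empty).  An identity arrow is an ordinary entry of a path; it is introduced or
  removed by the unit constraints \<open>run\<close> and \<open>lun\<close>.
\<close>

type_synonym ('a, 'c) pcell = "'a list \<times> 'c \<times> 'a list"

context bicat_data
begin

fun pth :: "'a list \<Rightarrow> 'a" where
  "pth [] = undefined"
| "pth [f] = f"
| "pth (f # g # fs) = f \<odot> pth (g # fs)"

text \<open>The canonical cell \<open>pth ps \<odot> pth vs \<Rightarrow> pth (ps @ vs)\<close>, for nonempty \<open>ps\<close> and \<open>vs\<close>.\<close>

fun join :: "'a list \<Rightarrow> 'a list \<Rightarrow> 'c" where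
  "join [] vs = undefined"
| "join [f] vs = cid (f \<odot> pth vs)"
| "join (f # g # fs) vs = (cid f \<star> join (g # fs) vs) \<bullet> bass M f (pth (g # fs)) (pth vs)"

fun whisk_right :: "('a, 'c) pcell \<Rightarrow> 'a list \<Rightarrow> ('a, 'c) pcell" where
  "whisk_right P [] = P"
| "whisk_right (ps, \<theta>, qs) (v # vs) =
    (ps @ v # vs,
     join qs (v # vs) \<bullet> (\<theta> \<star> cid (pth (v # vs))) \<bullet> cinv (join ps (v # vs)),
     qs @ v # vs)"

fun whisk_left :: "'a \<Rightarrow> ('a, 'c) pcell \<Rightarrow> ('a, 'c) pcell" where
  "whisk_left f (ps, \<theta>, qs) = (f # ps, cid f \<star> \<theta>, f # qs)"

definition whisk :: "'a list \<Rightarrow> ('a, 'c) pcell \<Rightarrow> 'a list \<Rightarrow> ('a, 'c) pcell"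
    ("_ \<lhd> _ \<rhd> _" [56, 56, 56] 55) where
  "us \<lhd> P \<rhd> vs = foldr whisk_left us (whisk_right P vs)"

text \<open>Vertical composition is in diagrammatic order; it is used only when the target path of the
  first pasting cell is the source path of the second.\<close>

fun pvcomp :: "('a, 'c) pcell \<Rightarrow> ('a, 'c) pcell \<Rightarrow> ('a, 'c) pcell" (infixl "\<Zsemi>" 53) where
  "(ps, \<theta>, qs) \<Zsemi> (qs', \<phi>, rs) = (ps, \<phi> \<bullet> \<theta>, rs)"

fun pinv :: "('a, 'c) pcell \<Rightarrow> ('a, 'c) pcell" where
  "pinv (ps, \<theta>, qs) = (qs, cinv \<theta>, ps)"

definition pcell_cell :: "('a, 'c) pcell \<Rightarrow> 'c" where
  "pcell_cell P = fst (snd P)"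

definition expand :: "'a list \<Rightarrow> ('a, 'c) pcell" where
  "expand ps = ([pth ps], cid (pth ps), ps)"

definition run :: "'a \<Rightarrow> ('a, 'c) pcell" where
  "run f = ([f, one (src M f)], brun M f, [f])"

definition lun :: "'a \<Rightarrow> ('a, 'c) pcell" where
  "lun f = ([one (trg M f), f], blun M f, [f])"

text \<open>\<open>[f, 1] \<Rightarrow> [1, f]\<close>\<close>

definition swap :: "'a \<Rightarrow> ('a, 'c) pcell" where
  "swap f = run f \<Zsemi> pinv (lun f)"

text \<open>For \<open>P : [1] \<Rightarrow> qs\<close>, insertion of \<open>qs\<close> to the right of \<open>f\<close>; for \<open>P : ps \<Rightarrow> [1]\<close>, removal of
  \<open>ps\<close> to the left of \<open>f\<close>, respectively to the right of \<open>f\<close>.\<close>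

definition insert_after :: "'a \<Rightarrow> ('a, 'c) pcell \<Rightarrow> ('a, 'c) pcell" where
  "insert_after f P = pinv (run f) \<Zsemi> [f] \<lhd> P \<rhd> []"

definition cancel_before :: "('a, 'c) pcell \<Rightarrow> 'a \<Rightarrow> ('a, 'c) pcell" where
  "cancel_before P f = [] \<lhd> P \<rhd> [f] \<Zsemi> lun f"

definition cancel_after :: "'a \<Rightarrow> ('a, 'c) pcell \<Rightarrow> ('a, 'c) pcell" where
  "cancel_after f P = [f] \<lhd> P \<rhd> [] \<Zsemi> run f"

end


section \<open>Monoidal bicategories\<close>

text \<open>
  Tricategories with one object, in the form with adjoint equivalences
  \<open>\<a> : (XY)Z \<rightarrow> X(YZ)\<close>, \<open>\<l> : IX \<rightarrow> X\<close>, \<open>\<r> : XI \<rightarrow> X\<close> and invertible modifications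
    pentagonator  \<open>(1\<a>) \<a> (\<a>1) \<Rightarrow> \<a> \<a>\<close>,
    middle unitor \<open>(1\<l>) \<a> \<Rightarrow> \<r>1\<close>,
    left unitor   \<open>\<l> \<a> \<Rightarrow> \<l>1\<close>,
    right unitor  \<open>(1\<r>) \<a> \<Rightarrow> \<r>\<close>.
  For the adjoint equivalences, the reverse arrows, units and counits are given objectwise;
  there is exactly one pseudonatural structure on the reverse arrows that makes the units and
  counits modifications, namely the mate of the given one (\<open>assN'\<close> below, for \<open>\<a>\<close>).
\<close>

record ('o, 'a, 'c) tensor_bicat = "('o, 'a, 'c) bicat" +
  unit_ob :: "'o"
  tens_ob :: "'o \<Rightarrow> 'o \<Rightarrow> 'o"
  tens_ar :: "'a \<Rightarrow> 'a \<Rightarrow> 'a"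
  tens_ce :: "'c \<Rightarrow> 'c \<Rightarrow> 'c"
  tens_comp :: "'a \<Rightarrow> 'a \<Rightarrow> 'a \<Rightarrow> 'a \<Rightarrow> 'c"
  tens_one :: "'o \<Rightarrow> 'o \<Rightarrow> 'c"
  ass :: "'o \<Rightarrow> 'o \<Rightarrow> 'o \<Rightarrow> 'a"
  ass_rev :: "'o \<Rightarrow> 'o \<Rightarrow> 'o \<Rightarrow> 'a"
  ass_eta :: "'o \<Rightarrow> 'o \<Rightarrow> 'o \<Rightarrow> 'c"
  ass_eps :: "'o \<Rightarrow> 'o \<Rightarrow> 'o \<Rightarrow> 'c"
  ass_nat :: "'a \<Rightarrow> 'a \<Rightarrow> 'a \<Rightarrow> 'c"
  lft :: "'o \<Rightarrow> 'a"
  lft_rev :: "'o \<Rightarrow> 'a"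
  lft_eta :: "'o \<Rightarrow> 'c"
  lft_eps :: "'o \<Rightarrow> 'c"
  lft_nat :: "'a \<Rightarrow> 'c"
  rgt :: "'o \<Rightarrow> 'a"
  rgt_rev :: "'o \<Rightarrow> 'a"
  rgt_eta :: "'o \<Rightarrow> 'c"
  rgt_eps :: "'o \<Rightarrow> 'c"
  rgt_nat :: "'a \<Rightarrow> 'c"
  pent :: "'o \<Rightarrow> 'o \<Rightarrow> 'o \<Rightarrow> 'o \<Rightarrow> 'c"
  mid :: "'o \<Rightarrow> 'o \<Rightarrow> 'c"
  lft_tens :: "'o \<Rightarrow> 'o \<Rightarrow> 'c"
  rgt_tens :: "'o \<Rightarrow> 'o \<Rightarrow> 'c"

locale tensor_data = bicat_data M
  for M :: "('o, 'a, 'c) tensor_bicat"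
begin

abbreviation I :: "'o" where "I \<equiv> unit_ob M"

abbreviation tensor_ob :: "'o \<Rightarrow> 'o \<Rightarrow> 'o" (infixr "\<cdot>" 75) where "X \<cdot> Y \<equiv> tens_ob M X Y"

abbreviation tensor_ar :: "'a \<Rightarrow> 'a \<Rightarrow> 'a" (infixr "\<otimes>" 70) where "f \<otimes> g \<equiv> tens_ar M f g"

abbreviation tensor_ce :: "'c \<Rightarrow> 'c \<Rightarrow> 'c" (infixr "\<otimes>\<^sub>c" 70) where "\<theta> \<otimes>\<^sub>c \<phi> \<equiv> tens_ce M \<theta> \<phi>"

abbreviation assoc ("\<a>") where "\<a> \<equiv> ass M"
abbreviation assoc_rev ("\<a>\<^sup>*") where "\<a>\<^sup>* \<equiv> ass_rev M"
abbreviation left ("\<l>") where "\<l> \<equiv> lft M"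
abbreviation left_rev ("\<l>\<^sup>*") where "\<l>\<^sup>* \<equiv> lft_rev M"
abbreviation right ("\<r>") where "\<r> \<equiv> rgt M"
abbreviation right_rev ("\<r>\<^sup>*") where "\<r>\<^sup>* \<equiv> rgt_rev M"

subsection \<open>Tensoring pasting cells\<close>

text \<open>For \<open>P : ps \<Rightarrow> qs\<close>, \<open>ltens X P\<close> goes between the paths obtained by tensoring each entry with
  \<open>1\<^sub>X\<close> on the left; \<open>ltens_join X ps\<close> is the canonical cell
  \<open>pth (map (\<lambda>f. one X \<otimes> f) ps) \<Rightarrow> one X \<otimes> pth ps\<close>.  Similarly for \<open>rtens\<close>.\<close>

fun ltens_join :: "'o \<Rightarrow> 'a list \<Rightarrow> 'c" where
  "ltens_join X [] = undefined"
| "ltens_join X [f] = cid (one X \<otimes> f)"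
| "ltens_join X (f # g # fs) =
    (blun M (one X) \<otimes>\<^sub>c cid (f \<odot> pth (g # fs))) \<bullet>
    tens_comp M (one X) f (one X) (pth (g # fs)) \<bullet>
    (cid (one X \<otimes> f) \<star> ltens_join X (g # fs))"

fun rtens_join :: "'a list \<Rightarrow> 'o \<Rightarrow> 'c" where
  "rtens_join [] X = undefined"
| "rtens_join [f] X = cid (f \<otimes> one X)"
| "rtens_join (f # g # fs) X =
    (cid (f \<odot> pth (g # fs)) \<otimes>\<^sub>c blun M (one X)) \<bullet>
    tens_comp M f (one X) (pth (g # fs)) (one X) \<bullet>
    (cid (f \<otimes> one X) \<star> rtens_join (g # fs) X)"

fun ltens :: "'o \<Rightarrow> ('a, 'c) pcell \<Rightarrow> ('a, 'c) pcell" where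
  "ltens X (ps, \<theta>, qs) =
    (map (\<lambda>f. one X \<otimes> f) ps,
     cinv (ltens_join X qs) \<bullet> (cid (one X) \<otimes>\<^sub>c \<theta>) \<bullet> ltens_join X ps,
     map (\<lambda>f. one X \<otimes> f) qs)"

fun rtens :: "('a, 'c) pcell \<Rightarrow> 'o \<Rightarrow> ('a, 'c) pcell" where
  "rtens (ps, \<theta>, qs) X =
    (map (\<lambda>f. f \<otimes> one X) ps,
     cinv (rtens_join qs X) \<bullet> (\<theta> \<otimes>\<^sub>c cid (one X)) \<bullet> rtens_join ps X,
     map (\<lambda>f. f \<otimes> one X) qs)"

text \<open>Tensor product of two squares \<open>[f, g] \<Rightarrow> [h, k]\<close> and \<open>[f', g'] \<Rightarrow> [h', k']\<close>.\<close>

fun sqtens :: "('a, 'c) pcell \<Rightarrow> ('a, 'c) pcell \<Rightarrow> ('a, 'c) pcell" where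
  "sqtens ([f, g], \<theta>, [h, k]) ([f', g'], \<theta>', [h', k']) =
    ([f \<otimes> f', g \<otimes> g'],
     cinv (tens_comp M h h' k k') \<bullet> (\<theta> \<otimes>\<^sub>c \<theta>') \<bullet> tens_comp M f f' g g',
     [h \<otimes> h', k \<otimes> k'])"
| "sqtens _ _ = undefined"

text \<open>\<open>[f \<otimes> 1, 1 \<otimes> g] \<Rightarrow> [1 \<otimes> g, f \<otimes> 1]\<close>\<close>

definition interchange :: "'a \<Rightarrow> 'a \<Rightarrow> ('a, 'c) pcell" where
  "interchange f g = sqtens (swap f) (pinv (swap g))"

text \<open>\<open>[1\<^bsub>XY\<^esub> \<otimes> f] \<Rightarrow> [(1\<^sub>X \<otimes> 1\<^sub>Y) \<otimes> f]\<close> and \<open>[f \<otimes> 1\<^bsub>XY\<^esub>] \<Rightarrow> [f \<otimes> (1\<^sub>X \<otimes> 1\<^sub>Y)]\<close>\<close>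

definition split_one_left :: "'o \<Rightarrow> 'o \<Rightarrow> 'a \<Rightarrow> ('a, 'c) pcell" where
  "split_one_left X Y f =
    ([one (X \<cdot> Y) \<otimes> f], tens_one M X Y \<otimes>\<^sub>c cid f, [(one X \<otimes> one Y) \<otimes> f])"

definition split_one_right :: "'a \<Rightarrow> 'o \<Rightarrow> 'o \<Rightarrow> ('a, 'c) pcell" where
  "split_one_right f X Y =
    ([f \<otimes> one (X \<cdot> Y)], cid f \<otimes>\<^sub>c tens_one M X Y, [f \<otimes> (one X \<otimes> one Y)])"

subsection \<open>The constraints as pasting cells\<close>

definition oneP :: "'o \<Rightarrow> 'o \<Rightarrow> ('a, 'c) pcell" where
  "oneP X Y = ([one (X \<cdot> Y)], tens_one M X Y, [one X \<otimes> one Y])"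

definition assEta :: "'o \<Rightarrow> 'o \<Rightarrow> 'o \<Rightarrow> ('a, 'c) pcell" where
  "assEta X Y Z = ([one ((X \<cdot> Y) \<cdot> Z)], ass_eta M X Y Z, [\<a>\<^sup>* X Y Z, \<a> X Y Z])"

definition assEps :: "'o \<Rightarrow> 'o \<Rightarrow> 'o \<Rightarrow> ('a, 'c) pcell" where
  "assEps X Y Z = ([\<a> X Y Z, \<a>\<^sup>* X Y Z], ass_eps M X Y Z, [one (X \<cdot> (Y \<cdot> Z))])"

definition lftEta :: "'o \<Rightarrow> ('a, 'c) pcell" where
  "lftEta X = ([one (I \<cdot> X)], lft_eta M X, [\<l>\<^sup>* X, \<l> X])"

definition rgtEps :: "'o \<Rightarrow> ('a, 'c) pcell" where
  "rgtEps X = ([\<r> X, \<r>\<^sup>* X], rgt_eps M X, [one X])"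

definition assN :: "'a \<Rightarrow> 'a \<Rightarrow> 'a \<Rightarrow> ('a, 'c) pcell" where
  "assN f g h =
    ([\<a> (trg M f) (trg M g) (trg M h), (f \<otimes> g) \<otimes> h],
     ass_nat M f g h,
     [f \<otimes> (g \<otimes> h), \<a> (src M f) (src M g) (src M h)])"

definition lftN :: "'a \<Rightarrow> ('a, 'c) pcell" where
  "lftN f = ([\<l> (trg M f), one I \<otimes> f], lft_nat M f, [f, \<l> (src M f)])"

definition rgtN :: "'a \<Rightarrow> ('a, 'c) pcell" where
  "rgtN f = ([\<r> (trg M f), f \<otimes> one I], rgt_nat M f, [f, \<r> (src M f)])"

definition pentP :: "'o \<Rightarrow> 'o \<Rightarrow> 'o \<Rightarrow> 'o \<Rightarrow> ('a, 'c) pcell" where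
  "pentP W X Y Z =
    ([one W \<otimes> \<a> X Y Z, \<a> W (X \<cdot> Y) Z, \<a> W X Y \<otimes> one Z],
     pent M W X Y Z,
     [\<a> W X (Y \<cdot> Z), \<a> (W \<cdot> X) Y Z])"

definition midP :: "'o \<Rightarrow> 'o \<Rightarrow> ('a, 'c) pcell" where
  "midP X Y = ([one X \<otimes> \<l> Y, \<a> X I Y], mid M X Y, [\<r> X \<otimes> one Y])"

definition lftP :: "'o \<Rightarrow> 'o \<Rightarrow> ('a, 'c) pcell" where
  "lftP X Y = ([\<l> (X \<cdot> Y), \<a> I X Y], lft_tens M X Y, [\<l> X \<otimes> one Y])"

definition rgtP :: "'o \<Rightarrow> 'o \<Rightarrow> ('a, 'c) pcell" where
  "rgtP X Y = ([one X \<otimes> \<r> Y, \<a> X Y I], rgt_tens M X Y, [\<r> (X \<cdot> Y)])"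

end

locale monoidal_bicategory = tensor_data M + bicategory M
  for M :: "('o, 'a, 'c) tensor_bicat" +
  assumes unit_ob_in: "I \<in> Ob M"
    \<comment> \<open>the tensor product is a pseudofunctor\<close>
    and tens_ob_in: "X \<in> Ob M \<Longrightarrow> Y \<in> Ob M \<Longrightarrow> X \<cdot> Y \<in> Ob M"
    and tens_arr: "\<guillemotleft>f : X \<rightarrow> X'\<guillemotright> \<Longrightarrow> \<guillemotleft>g : Y \<rightarrow> Y'\<guillemotright> \<Longrightarrow> \<guillemotleft>f \<otimes> g : X \<cdot> Y \<rightarrow> X' \<cdot> Y'\<guillemotright>"
    and tens_cell: "\<guillemotleft>\<theta> : f \<Rightarrow> f'\<guillemotright> \<Longrightarrow> \<guillemotleft>\<phi> : g \<Rightarrow> g'\<guillemotright> \<Longrightarrow> \<guillemotleft>\<theta> \<otimes>\<^sub>c \<phi> : f \<otimes> g \<Rightarrow> f' \<otimes> g'\<guillemotright>"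
    and tens_cid: "f \<in> Ar M \<Longrightarrow> g \<in> Ar M \<Longrightarrow> cid f \<otimes>\<^sub>c cid g = cid (f \<otimes> g)"
    and tens_vcomp: "\<guillemotleft>\<theta> : f \<Rightarrow> f'\<guillemotright> \<Longrightarrow> \<guillemotleft>\<theta>' : f' \<Rightarrow> f''\<guillemotright> \<Longrightarrow>
      \<guillemotleft>\<phi> : g \<Rightarrow> g'\<guillemotright> \<Longrightarrow> \<guillemotleft>\<phi>' : g' \<Rightarrow> g''\<guillemotright> \<Longrightarrow>
      (\<theta>' \<bullet> \<theta>) \<otimes>\<^sub>c (\<phi>' \<bullet> \<phi>) = (\<theta>' \<otimes>\<^sub>c \<phi>') \<bullet> (\<theta> \<otimes>\<^sub>c \<phi>)"
    and tens_comp_icell: "\<guillemotleft>g : X \<rightarrow> Y\<guillemotright> \<Longrightarrow> \<guillemotleft>f : Y \<rightarrow> Z\<guillemotright> \<Longrightarrow> \<guillemotleft>g' : X' \<rightarrow> Y'\<guillemotright> \<Longrightarrow> \<guillemotleft>f' : Y' \<rightarrow> Z'\<guillemotright> \<Longrightarrow>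
      \<guillemotleft>tens_comp M f f' g g' : (f \<otimes> f') \<odot> (g \<otimes> g') \<cong> (f \<odot> g) \<otimes> (f' \<odot> g')\<guillemotright>"
    and tens_comp_natural: "\<guillemotleft>\<theta> : f \<Rightarrow> h\<guillemotright> \<Longrightarrow> \<guillemotleft>\<theta>' : f' \<Rightarrow> h'\<guillemotright> \<Longrightarrow>
      \<guillemotleft>\<phi> : g \<Rightarrow> k\<guillemotright> \<Longrightarrow> \<guillemotleft>\<phi>' : g' \<Rightarrow> k'\<guillemotright> \<Longrightarrow>
      src M f = trg M g \<Longrightarrow> src M f' = trg M g' \<Longrightarrow>
      tens_comp M h h' k k' \<bullet> ((\<theta> \<otimes>\<^sub>c \<theta>') \<star> (\<phi> \<otimes>\<^sub>c \<phi>')) =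
      ((\<theta> \<star> \<phi>) \<otimes>\<^sub>c (\<theta>' \<star> \<phi>')) \<bullet> tens_comp M f f' g g'"
    and tens_one_icell: "X \<in> Ob M \<Longrightarrow> Y \<in> Ob M \<Longrightarrow>
      \<guillemotleft>tens_one M X Y : one (X \<cdot> Y) \<cong> one X \<otimes> one Y\<guillemotright>"
    and tens_assoc: "\<guillemotleft>h : W \<rightarrow> X\<guillemotright> \<Longrightarrow> \<guillemotleft>g : X \<rightarrow> Y\<guillemotright> \<Longrightarrow> \<guillemotleft>f : Y \<rightarrow> Z\<guillemotright> \<Longrightarrow>
      \<guillemotleft>h' : W' \<rightarrow> X'\<guillemotright> \<Longrightarrow> \<guillemotleft>g' : X' \<rightarrow> Y'\<guillemotright> \<Longrightarrow> \<guillemotleft>f' : Y' \<rightarrow> Z'\<guillemotright> \<Longrightarrow>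
      (bass M f g h \<otimes>\<^sub>c bass M f' g' h') \<bullet> tens_comp M (f \<odot> g) (f' \<odot> g') h h' \<bullet>
        (tens_comp M f f' g g' \<star> cid (h \<otimes> h')) =
      tens_comp M f f' (g \<odot> h) (g' \<odot> h') \<bullet> (cid (f \<otimes> f') \<star> tens_comp M g g' h h') \<bullet>
        bass M (f \<otimes> f') (g \<otimes> g') (h \<otimes> h')"
    and tens_left_unit: "\<guillemotleft>f : X \<rightarrow> Y\<guillemotright> \<Longrightarrow> \<guillemotleft>f' : X' \<rightarrow> Y'\<guillemotright> \<Longrightarrow>
      (blun M f \<otimes>\<^sub>c blun M f') \<bullet> tens_comp M (one Y) (one Y') f f' \<bullet>
        (tens_one M Y Y' \<star> cid (f \<otimes> f')) = blun M (f \<otimes> f')"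
    and tens_right_unit: "\<guillemotleft>f : X \<rightarrow> Y\<guillemotright> \<Longrightarrow> \<guillemotleft>f' : X' \<rightarrow> Y'\<guillemotright> \<Longrightarrow>
      (brun M f \<otimes>\<^sub>c brun M f') \<bullet> tens_comp M f f' (one X) (one X') \<bullet>
        (cid (f \<otimes> f') \<star> tens_one M X X') = brun M (f \<otimes> f')"
    \<comment> \<open>the associator is a pseudonatural adjoint equivalence\<close>
    and ass_equivalence: "X \<in> Ob M \<Longrightarrow> Y \<in> Ob M \<Longrightarrow> Z \<in> Ob M \<Longrightarrow>
      adjoint_equivalence ((X \<cdot> Y) \<cdot> Z) (X \<cdot> (Y \<cdot> Z)) (\<a> X Y Z) (\<a>\<^sup>* X Y Z)
        (ass_eta M X Y Z) (ass_eps M X Y Z)"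
    and ass_nat_icell: "\<guillemotleft>f : X \<rightarrow> X'\<guillemotright> \<Longrightarrow> \<guillemotleft>g : Y \<rightarrow> Y'\<guillemotright> \<Longrightarrow> \<guillemotleft>h : Z \<rightarrow> Z'\<guillemotright> \<Longrightarrow>
      \<guillemotleft>ass_nat M f g h : \<a> X' Y' Z' \<odot> ((f \<otimes> g) \<otimes> h) \<cong> (f \<otimes> (g \<otimes> h)) \<odot> \<a> X Y Z\<guillemotright>"
    and ass_nat_natural: "\<guillemotleft>\<theta> : f \<Rightarrow> f'\<guillemotright> \<Longrightarrow> \<guillemotleft>\<phi> : g \<Rightarrow> g'\<guillemotright> \<Longrightarrow> \<guillemotleft>\<psi> : h \<Rightarrow> h'\<guillemotright> \<Longrightarrow>
      ass_nat M f' g' h' \<bullet> (cid (\<a> (trg M f) (trg M g) (trg M h)) \<star> ((\<theta> \<otimes>\<^sub>c \<phi>) \<otimes>\<^sub>c \<psi>)) =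
      ((\<theta> \<otimes>\<^sub>c (\<phi> \<otimes>\<^sub>c \<psi>)) \<star> cid (\<a> (src M f) (src M g) (src M h))) \<bullet> ass_nat M f g h"
    and ass_nat_comp: "\<guillemotleft>f : X \<rightarrow> X'\<guillemotright> \<Longrightarrow> \<guillemotleft>f' : X' \<rightarrow> X''\<guillemotright> \<Longrightarrow> \<guillemotleft>g : Y \<rightarrow> Y'\<guillemotright> \<Longrightarrow> \<guillemotleft>g' : Y' \<rightarrow> Y''\<guillemotright> \<Longrightarrow>
      \<guillemotleft>h : Z \<rightarrow> Z'\<guillemotright> \<Longrightarrow> \<guillemotleft>h' : Z' \<rightarrow> Z''\<guillemotright> \<Longrightarrow>
      [] \<lhd> assN f' g' h' \<rhd> [(f \<otimes> g) \<otimes> h] \<Zsemi>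
      [f' \<otimes> (g' \<otimes> h')] \<lhd> assN f g h \<rhd> [] \<Zsemi>
      [] \<lhd> ([f' \<otimes> (g' \<otimes> h'), f \<otimes> (g \<otimes> h)],
            (cid (f' \<odot> f) \<otimes>\<^sub>c tens_comp M g' h' g h) \<bullet> tens_comp M f' (g' \<otimes> h') f (g \<otimes> h),
            [(f' \<odot> f) \<otimes> ((g' \<odot> g) \<otimes> (h' \<odot> h))]) \<rhd> [\<a> X Y Z] =
      [\<a> X'' Y'' Z''] \<lhd>
        ([(f' \<otimes> g') \<otimes> h', (f \<otimes> g) \<otimes> h],
         (tens_comp M f' g' f g \<otimes>\<^sub>c cid (h' \<odot> h)) \<bullet> tens_comp M (f' \<otimes> g') h' (f \<otimes> g) h,
         [((f' \<odot> f) \<otimes> (g' \<odot> g)) \<otimes> (h' \<odot> h)]) \<rhd> [] \<Zsemi>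
      assN (f' \<odot> f) (g' \<odot> g) (h' \<odot> h)"
    and ass_nat_one: "X \<in> Ob M \<Longrightarrow> Y \<in> Ob M \<Longrightarrow> Z \<in> Ob M \<Longrightarrow>
      [\<a> X Y Z] \<lhd> (oneP (X \<cdot> Y) Z \<Zsemi> split_one_left X Y (one Z)) \<rhd> [] \<Zsemi>
      assN (one X) (one Y) (one Z) =
      swap (\<a> X Y Z) \<Zsemi>
      [] \<lhd> (oneP X (Y \<cdot> Z) \<Zsemi> split_one_right (one X) Y Z) \<rhd> [\<a> X Y Z]"
    \<comment> \<open>so is the left unit\<close>
    and lft_equivalence: "X \<in> Ob M \<Longrightarrow>
      adjoint_equivalence (I \<cdot> X) X (\<l> X) (\<l>\<^sup>* X) (lft_eta M X) (lft_eps M X)"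
    and lft_nat_icell: "\<guillemotleft>f : X \<rightarrow> Y\<guillemotright> \<Longrightarrow> \<guillemotleft>lft_nat M f : \<l> Y \<odot> (one I \<otimes> f) \<cong> f \<odot> \<l> X\<guillemotright>"
    and lft_nat_natural: "\<guillemotleft>\<theta> : f \<Rightarrow> g\<guillemotright> \<Longrightarrow>
      lft_nat M g \<bullet> (cid (\<l> (trg M f)) \<star> (cid (one I) \<otimes>\<^sub>c \<theta>)) =
      (\<theta> \<star> cid (\<l> (src M f))) \<bullet> lft_nat M f"
    and lft_nat_comp: "\<guillemotleft>g : X \<rightarrow> Y\<guillemotright> \<Longrightarrow> \<guillemotleft>f : Y \<rightarrow> Z\<guillemotright> \<Longrightarrow>
      [] \<lhd> lftN f \<rhd> [one I \<otimes> g] \<Zsemi> [f] \<lhd> lftN g \<rhd> [] \<Zsemi> [] \<lhd> pinv (expand [f, g]) \<rhd> [\<l> X] =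
      [\<l> Z] \<lhd> ltens I (pinv (expand [f, g])) \<rhd> [] \<Zsemi> lftN (f \<odot> g)"
    and lft_nat_one: "X \<in> Ob M \<Longrightarrow> [\<l> X] \<lhd> oneP I X \<rhd> [] \<Zsemi> lftN (one X) = swap (\<l> X)"
    \<comment> \<open>and the right unit\<close>
    and rgt_equivalence: "X \<in> Ob M \<Longrightarrow>
      adjoint_equivalence (X \<cdot> I) X (\<r> X) (\<r>\<^sup>* X) (rgt_eta M X) (rgt_eps M X)"
    and rgt_nat_icell: "\<guillemotleft>f : X \<rightarrow> Y\<guillemotright> \<Longrightarrow> \<guillemotleft>rgt_nat M f : \<r> Y \<odot> (f \<otimes> one I) \<cong> f \<odot> \<r> X\<guillemotright>"
    and rgt_nat_natural: "\<guillemotleft>\<theta> : f \<Rightarrow> g\<guillemotright> \<Longrightarrow>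
      rgt_nat M g \<bullet> (cid (\<r> (trg M f)) \<star> (\<theta> \<otimes>\<^sub>c cid (one I))) =
      (\<theta> \<star> cid (\<r> (src M f))) \<bullet> rgt_nat M f"
    and rgt_nat_comp: "\<guillemotleft>g : X \<rightarrow> Y\<guillemotright> \<Longrightarrow> \<guillemotleft>f : Y \<rightarrow> Z\<guillemotright> \<Longrightarrow>
      [] \<lhd> rgtN f \<rhd> [g \<otimes> one I] \<Zsemi> [f] \<lhd> rgtN g \<rhd> [] \<Zsemi> [] \<lhd> pinv (expand [f, g]) \<rhd> [\<r> X] =
      [\<r> Z] \<lhd> rtens (pinv (expand [f, g])) I \<rhd> [] \<Zsemi> rgtN (f \<odot> g)"
    and rgt_nat_one: "X \<in> Ob M \<Longrightarrow> [\<r> X] \<lhd> oneP X I \<rhd> [] \<Zsemi> rgtN (one X) = swap (\<r> X)"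
    \<comment> \<open>the invertible modifications\<close>
    and pent_icell: "W \<in> Ob M \<Longrightarrow> X \<in> Ob M \<Longrightarrow> Y \<in> Ob M \<Longrightarrow> Z \<in> Ob M \<Longrightarrow>
      \<guillemotleft>pent M W X Y Z :
        (one W \<otimes> \<a> X Y Z) \<odot> (\<a> W (X \<cdot> Y) Z \<odot> (\<a> W X Y \<otimes> one Z)) \<cong>
        \<a> W X (Y \<cdot> Z) \<odot> \<a> (W \<cdot> X) Y Z\<guillemotright>"
    and pent_modification: "\<guillemotleft>f : W \<rightarrow> W'\<guillemotright> \<Longrightarrow> \<guillemotleft>g : X \<rightarrow> X'\<guillemotright> \<Longrightarrow> \<guillemotleft>h : Y \<rightarrow> Y'\<guillemotright> \<Longrightarrow> \<guillemotleft>k : Z \<rightarrow> Z'\<guillemotright> \<Longrightarrow>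
      [] \<lhd> pentP W' X' Y' Z' \<rhd> [((f \<otimes> g) \<otimes> h) \<otimes> k] \<Zsemi>
      [\<a> W' X' (Y' \<cdot> Z')] \<lhd> assN (f \<otimes> g) h k \<rhd> [] \<Zsemi>
      [] \<lhd> assN f g (h \<otimes> k) \<rhd> [\<a> (W \<cdot> X) Y Z] =
      [one W' \<otimes> \<a> X' Y' Z', \<a> W' (X' \<cdot> Y') Z'] \<lhd>
        sqtens (assN f g h) (pinv (swap k)) \<rhd> [] \<Zsemi>
      [one W' \<otimes> \<a> X' Y' Z'] \<lhd> assN f (g \<otimes> h) k \<rhd> [\<a> W X Y \<otimes> one Z] \<Zsemi>
      [] \<lhd> sqtens (pinv (swap f)) (assN g h k) \<rhd> [\<a> W (X \<cdot> Y) Z, \<a> W X Y \<otimes> one Z] \<Zsemi>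
      [f \<otimes> (g \<otimes> (h \<otimes> k))] \<lhd> pentP W X Y Z \<rhd> []"
    and mid_icell: "X \<in> Ob M \<Longrightarrow> Y \<in> Ob M \<Longrightarrow>
      \<guillemotleft>mid M X Y : (one X \<otimes> \<l> Y) \<odot> \<a> X I Y \<cong> \<r> X \<otimes> one Y\<guillemotright>"
    and mid_modification: "\<guillemotleft>f : X \<rightarrow> X'\<guillemotright> \<Longrightarrow> \<guillemotleft>g : Y \<rightarrow> Y'\<guillemotright> \<Longrightarrow>
      [] \<lhd> midP X' Y' \<rhd> [(f \<otimes> one I) \<otimes> g] \<Zsemi> sqtens (rgtN f) (pinv (swap g)) =
      [one X' \<otimes> \<l> Y'] \<lhd> assN f (one I) g \<rhd> [] \<Zsemi>
      [] \<lhd> sqtens (pinv (swap f)) (lftN g) \<rhd> [\<a> X I Y] \<Zsemi>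
      [f \<otimes> g] \<lhd> midP X Y \<rhd> []"
    and lft_tens_icell: "X \<in> Ob M \<Longrightarrow> Y \<in> Ob M \<Longrightarrow>
      \<guillemotleft>lft_tens M X Y : \<l> (X \<cdot> Y) \<odot> \<a> I X Y \<cong> \<l> X \<otimes> one Y\<guillemotright>"
    and lft_tens_modification: "\<guillemotleft>f : X \<rightarrow> X'\<guillemotright> \<Longrightarrow> \<guillemotleft>g : Y \<rightarrow> Y'\<guillemotright> \<Longrightarrow>
      [] \<lhd> lftP X' Y' \<rhd> [(one I \<otimes> f) \<otimes> g] \<Zsemi> sqtens (lftN f) (pinv (swap g)) =
      [\<l> (X' \<cdot> Y')] \<lhd> assN (one I) f g \<rhd> [] \<Zsemi>
      [] \<lhd> lftN (f \<otimes> g) \<rhd> [\<a> I X Y] \<Zsemi>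
      [f \<otimes> g] \<lhd> lftP X Y \<rhd> []"
    and rgt_tens_icell: "X \<in> Ob M \<Longrightarrow> Y \<in> Ob M \<Longrightarrow>
      \<guillemotleft>rgt_tens M X Y : (one X \<otimes> \<r> Y) \<odot> \<a> X Y I \<cong> \<r> (X \<cdot> Y)\<guillemotright>"
    and rgt_tens_modification: "\<guillemotleft>f : X \<rightarrow> X'\<guillemotright> \<Longrightarrow> \<guillemotleft>g : Y \<rightarrow> Y'\<guillemotright> \<Longrightarrow>
      [] \<lhd> rgtP X' Y' \<rhd> [(f \<otimes> g) \<otimes> one I] \<Zsemi> rgtN (f \<otimes> g) =
      [one X' \<otimes> \<r> Y'] \<lhd> assN f g (one I) \<rhd> [] \<Zsemi>
      [] \<lhd> sqtens (pinv (swap f)) (rgtN g) \<rhd> [\<a> X Y I] \<Zsemi>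
      [f \<otimes> g] \<lhd> rgtP X Y \<rhd> []"
    \<comment> \<open>the non-abelian 4-cocycle condition and the two normalization conditions\<close>
    and associativity_coherence:
      "V \<in> Ob M \<Longrightarrow> W \<in> Ob M \<Longrightarrow> X \<in> Ob M \<Longrightarrow> Y \<in> Ob M \<Longrightarrow> Z \<in> Ob M \<Longrightarrow>
      [one V \<otimes> (one W \<otimes> \<a> X Y Z), one V \<otimes> \<a> W (X \<cdot> Y) Z] \<lhd>
        pinv (assN (one V) (\<a> W X Y) (one Z)) \<rhd>
        [\<a> V (W \<cdot> X) Y \<otimes> one Z, (\<a> V W X \<otimes> one Y) \<otimes> one Z] \<Zsemi>
      [one V \<otimes> (one W \<otimes> \<a> X Y Z), one V \<otimes> \<a> W (X \<cdot> Y) Z, \<a> V (W \<cdot> (X \<cdot> Y)) Z] \<lhd>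
        rtens (pentP V W X Y) Z \<rhd> [] \<Zsemi>
      [one V \<otimes> (one W \<otimes> \<a> X Y Z)] \<lhd> pentP V W (X \<cdot> Y) Z \<rhd> [\<a> (V \<cdot> W) X Y \<otimes> one Z] \<Zsemi>
      [] \<lhd> pinv (assN (one V) (one W) (\<a> X Y Z)) \<rhd>
        [\<a> (V \<cdot> W) (X \<cdot> Y) Z, \<a> (V \<cdot> W) X Y \<otimes> one Z] \<Zsemi>
      [\<a> V W (X \<cdot> (Y \<cdot> Z))] \<lhd> pinv (split_one_left V W (\<a> X Y Z)) \<rhd>
        [\<a> (V \<cdot> W) (X \<cdot> Y) Z, \<a> (V \<cdot> W) X Y \<otimes> one Z] \<Zsemi>
      [\<a> V W (X \<cdot> (Y \<cdot> Z))] \<lhd> pentP (V \<cdot> W) X Y Z \<rhd> [] =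
      [] \<lhd> ltens V (pentP W X Y Z) \<rhd>
        [\<a> V ((W \<cdot> X) \<cdot> Y) Z, \<a> V (W \<cdot> X) Y \<otimes> one Z, (\<a> V W X \<otimes> one Y) \<otimes> one Z] \<Zsemi>
      [one V \<otimes> \<a> W X (Y \<cdot> Z)] \<lhd> pentP V (W \<cdot> X) Y Z \<rhd> [(\<a> V W X \<otimes> one Y) \<otimes> one Z] \<Zsemi>
      [one V \<otimes> \<a> W X (Y \<cdot> Z), \<a> V (W \<cdot> X) (Y \<cdot> Z)] \<lhd>
        assN (\<a> V W X) (one Y) (one Z) \<rhd> [] \<Zsemi>
      [one V \<otimes> \<a> W X (Y \<cdot> Z), \<a> V (W \<cdot> X) (Y \<cdot> Z)] \<lhd>
        pinv (split_one_right (\<a> V W X) Y Z) \<rhd> [\<a> ((V \<cdot> W) \<cdot> X) Y Z] \<Zsemi>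
      [] \<lhd> pentP V W X (Y \<cdot> Z) \<rhd> [\<a> ((V \<cdot> W) \<cdot> X) Y Z]"
    and left_normalization: "X \<in> Ob M \<Longrightarrow> Y \<in> Ob M \<Longrightarrow> Z \<in> Ob M \<Longrightarrow>
      [] \<lhd> ltens X (lftP Y Z) \<rhd> [\<a> X (I \<cdot> Y) Z, \<a> X I Y \<otimes> one Z] \<Zsemi>
      [] \<lhd> pinv (assN (one X) (\<l> Y) (one Z)) \<rhd> [\<a> X I Y \<otimes> one Z] \<Zsemi>
      [\<a> X Y Z] \<lhd> rtens (midP X Y) Z \<rhd> [] =
      [one X \<otimes> \<l> (Y \<cdot> Z)] \<lhd> pentP X I Y Z \<rhd> [] \<Zsemi>
      [] \<lhd> midP X (Y \<cdot> Z) \<rhd> [\<a> (X \<cdot> I) Y Z] \<Zsemi>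
      [] \<lhd> split_one_right (\<r> X) Y Z \<rhd> [\<a> (X \<cdot> I) Y Z] \<Zsemi>
      pinv (assN (\<r> X) (one Y) (one Z))"
    and right_normalization: "X \<in> Ob M \<Longrightarrow> Y \<in> Ob M \<Longrightarrow> Z \<in> Ob M \<Longrightarrow>
      [] \<lhd> ltens X (midP Y Z) \<rhd> [\<a> X (Y \<cdot> I) Z, \<a> X Y I \<otimes> one Z] \<Zsemi>
      [] \<lhd> pinv (assN (one X) (\<r> Y) (one Z)) \<rhd> [\<a> X Y I \<otimes> one Z] \<Zsemi>
      [\<a> X Y Z] \<lhd> rtens (rgtP X Y) Z \<rhd> [] =
      [one X \<otimes> (one Y \<otimes> \<l> Z)] \<lhd> pentP X Y I Z \<rhd> [] \<Zsemi>
      [] \<lhd> pinv (assN (one X) (one Y) (\<l> Z)) \<rhd> [\<a> (X \<cdot> Y) I Z] \<Zsemi>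
      [\<a> X Y Z] \<lhd> pinv (split_one_left X Y (\<l> Z)) \<rhd> [\<a> (X \<cdot> Y) I Z] \<Zsemi>
      [\<a> X Y Z] \<lhd> midP (X \<cdot> Y) Z \<rhd> []"

context tensor_data
begin

text \<open>The mate of \<open>assN\<close>: \<open>[\<a>\<^sup>*, f \<otimes> (g \<otimes> h)] \<Rightarrow> [(f \<otimes> g) \<otimes> h, \<a>\<^sup>*]\<close>.\<close>

definition assN' :: "'a \<Rightarrow> 'a \<Rightarrow> 'a \<Rightarrow> ('a, 'c) pcell" where
  "assN' f g h =
    (let X = src M f; Y = src M g; Z = src M h; X' = trg M f; Y' = trg M g; Z' = trg M h in
     [\<a>\<^sup>* X' Y' Z'] \<lhd> insert_after (f \<otimes> (g \<otimes> h)) (pinv (assEps X Y Z)) \<rhd> [] \<Zsemi>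
     [\<a>\<^sup>* X' Y' Z'] \<lhd> pinv (assN f g h) \<rhd> [\<a>\<^sup>* X Y Z] \<Zsemi>
     [] \<lhd> cancel_before (pinv (assEta X' Y' Z')) ((f \<otimes> g) \<otimes> h) \<rhd> [\<a>\<^sup>* X Y Z])"

text \<open>A mate of the pentagonator: \<open>[1 \<otimes> \<a>, \<a>] \<Rightarrow> [\<a>, \<a>, \<a>\<^sup>* \<otimes> 1]\<close>.\<close>

definition pentP' :: "'o \<Rightarrow> 'o \<Rightarrow> 'o \<Rightarrow> 'o \<Rightarrow> ('a, 'c) pcell" where
  "pentP' W X Y Z =
    [one W \<otimes> \<a> X Y Z] \<lhd>
      insert_after (\<a> W (X \<cdot> Y) Z)
        (oneP (W \<cdot> (X \<cdot> Y)) Z \<Zsemi> rtens (pinv (assEps W X Y)) Z) \<rhd> [] \<Zsemi>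
    [] \<lhd> pentP W X Y Z \<rhd> [\<a>\<^sup>* W X Y \<otimes> one Z]"

text \<open>
  The canonical cell \<open>\<r> I \<Rightarrow> \<l> I\<close>.  As in a monoidal category, \<open>1 \<otimes> \<l> I \<cong> \<l> (I \<cdot> I)\<close> by
  naturality of \<open>\<l>\<close> at \<open>\<l> I\<close>; combined with the middle and the left unitors this gives
  \<open>\<r> I \<otimes> 1 \<cong> \<l> I \<otimes> 1\<close>; and \<open>- \<otimes> 1\<close> is cancelled by means of naturality of \<open>\<r>\<close>.
\<close>

definition unit_cell_tens :: "('a, 'c) pcell" where
  "unit_cell_tens =
    pinv (midP I I) \<Zsemi>
    [] \<lhd> (pinv (lun (one I \<otimes> \<l> I)) \<Zsemi>
          [] \<lhd> lftEta I \<rhd> [one I \<otimes> \<l> I] \<Zsemi>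
          [\<l>\<^sup>* I] \<lhd> lftN (\<l> I) \<rhd> [] \<Zsemi>
          [] \<lhd> cancel_before (pinv (lftEta I)) (\<l> (I \<cdot> I)) \<rhd> []) \<rhd> [\<a> I I I] \<Zsemi>
    lftP I I"

definition unit_cell :: "('a, 'c) pcell" where
  "unit_cell =
    insert_after (\<r> I) (pinv (rgtEps (I \<cdot> I))) \<Zsemi>
    [] \<lhd> pinv (rgtN (\<r> I)) \<rhd> [\<r>\<^sup>* (I \<cdot> I)] \<Zsemi>
    [\<r> I] \<lhd> unit_cell_tens \<rhd> [\<r>\<^sup>* (I \<cdot> I)] \<Zsemi>
    [] \<lhd> rgtN (\<l> I) \<rhd> [\<r>\<^sup>* (I \<cdot> I)] \<Zsemi>
    cancel_after (\<l> I) (rgtEps (I \<cdot> I))"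

end


section \<open>Opmonoidal monads\<close>

text \<open>
  The data of a monoidale.  Variables in the element notation become identity arrows; the
  associator is a cell between arrows \<open>(MM)M \<rightarrow> M\<close>, the unitors between arrows \<open>IM \<rightarrow> M\<close> and
  \<open>MI \<rightarrow> M\<close>.  The notions of opmonoidal arrow, cell and monad refer to the data only; the only
  monoidale used is the enveloping one.
\<close>

record ('o, 'a, 'c) monoidale =
  mobj :: "'o"
  mmul :: "'a"
  muni :: "'a"
  mass :: "'c"
  mlun :: "'c"
  mrun :: "'c"

context tensor_data
begin

definition massP :: "('o, 'a, 'c) monoidale \<Rightarrow> ('a, 'c) pcell" where
  "massP N =
    ([mmul N, one (mobj N) \<otimes> mmul N, \<a> (mobj N) (mobj N) (mobj N)],
     mass N,
     [mmul N, mmul N \<otimes> one (mobj N)])"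

definition mlunP :: "('o, 'a, 'c) monoidale \<Rightarrow> ('a, 'c) pcell" where
  "mlunP N = ([\<l> (mobj N)], mlun N, [mmul N, muni N \<otimes> one (mobj N)])"

definition mrunP :: "('o, 'a, 'c) monoidale \<Rightarrow> ('a, 'c) pcell" where
  "mrunP N = ([mmul N, one (mobj N) \<otimes> muni N], mrun N, [\<r> (mobj N)])"

definition op2P :: "('o, 'a, 'c) monoidale \<Rightarrow> ('o, 'a, 'c) monoidale \<Rightarrow> 'a \<Rightarrow> 'c \<Rightarrow> ('a, 'c) pcell" where
  "op2P N N' C C2 = ([C, mmul N], C2, [mmul N', C \<otimes> C])"

definition op0P :: "('o, 'a, 'c) monoidale \<Rightarrow> ('o, 'a, 'c) monoidale \<Rightarrow> 'a \<Rightarrow> 'c \<Rightarrow> ('a, 'c) pcell" where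
  "op0P N N' C C0 = ([C, muni N], C0, [muni N'])"

definition opmonoidal_arrow ::
    "('o, 'a, 'c) monoidale \<Rightarrow> ('o, 'a, 'c) monoidale \<Rightarrow> 'a \<Rightarrow> 'c \<Rightarrow> 'c \<Rightarrow> bool" where
  "opmonoidal_arrow N N' C C2 C0 \<longleftrightarrow>
    (let X = mobj N; m = mmul N; u = muni N; m' = mmul N'; u' = muni N';
         C2P = op2P N N' C C2; C0P = op0P N N' C C0 \<Zsemi> pinv (run u') in
     \<guillemotleft>C : X \<rightarrow> mobj N'\<guillemotright> \<and>
     \<guillemotleft>C2 : C \<odot> m \<Rightarrow> m' \<odot> (C \<otimes> C)\<guillemotright> \<and>
     \<guillemotleft>C0 : C \<odot> u \<Rightarrow> u'\<guillemotright> \<and>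
     [] \<lhd> C2P \<rhd> [one X \<otimes> m, \<a> X X X] \<Zsemi>
     [m'] \<lhd> sqtens (swap C) C2P \<rhd> [\<a> X X X] \<Zsemi>
     [m', one (mobj N') \<otimes> m'] \<lhd> pinv (assN C C C) \<rhd> [] \<Zsemi>
     [] \<lhd> massP N' \<rhd> [(C \<otimes> C) \<otimes> C] =
     [C] \<lhd> massP N \<rhd> [] \<Zsemi>
     [] \<lhd> C2P \<rhd> [m \<otimes> one X] \<Zsemi>
     [m'] \<lhd> sqtens C2P (swap C) \<rhd> [] \<and>
     [] \<lhd> C2P \<rhd> [one X \<otimes> u] \<Zsemi>
     [m'] \<lhd> sqtens (swap C) C0P \<rhd> [] \<Zsemi>
     [] \<lhd> mrunP N' \<rhd> [C \<otimes> one I] \<Zsemi>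
     rgtN C =
     [C] \<lhd> mrunP N \<rhd> [] \<and>
     [C] \<lhd> mlunP N \<rhd> [] \<Zsemi>
     [] \<lhd> C2P \<rhd> [u \<otimes> one X] \<Zsemi>
     [m'] \<lhd> sqtens C0P (swap C) \<rhd> [] =
     pinv (lftN C) \<Zsemi>
     [] \<lhd> mlunP N' \<rhd> [one I \<otimes> C])"

definition opmonoidal_cell ::
    "('o, 'a, 'c) monoidale \<Rightarrow> ('o, 'a, 'c) monoidale \<Rightarrow>
      'a \<Rightarrow> 'c \<Rightarrow> 'c \<Rightarrow> 'a \<Rightarrow> 'c \<Rightarrow> 'c \<Rightarrow> 'c \<Rightarrow> bool" where
  "opmonoidal_cell N N' C C2 C0 C' C2' C0' \<xi> \<longleftrightarrow>
    \<guillemotleft>\<xi> : C \<Rightarrow> C'\<guillemotright> \<and>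
    C2' \<bullet> (\<xi> \<star> cid (mmul N)) = (cid (mmul N') \<star> (\<xi> \<otimes>\<^sub>c \<xi>)) \<bullet> C2 \<and>
    C0' \<bullet> (\<xi> \<star> cid (muni N)) = C0"

text \<open>The opmonoidal structures of the identity arrow and of \<open>B \<odot> B\<close>, for an opmonoidal \<open>B\<close>.\<close>

definition id_op2 :: "('o, 'a, 'c) monoidale \<Rightarrow> 'c" where
  "id_op2 N = pcell_cell
    (lun (mmul N) \<Zsemi> pinv (run (mmul N)) \<Zsemi> [mmul N] \<lhd> oneP (mobj N) (mobj N) \<rhd> [])"

definition id_op0 :: "('o, 'a, 'c) monoidale \<Rightarrow> 'c" where
  "id_op0 N = blun M (muni N)"

definition square_op2 :: "('o, 'a, 'c) monoidale \<Rightarrow> 'a \<Rightarrow> 'c \<Rightarrow> 'c" where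
  "square_op2 N B B2 = pcell_cell
    ([] \<lhd> expand [B, B] \<rhd> [mmul N] \<Zsemi>
     [B] \<lhd> op2P N N B B2 \<rhd> [] \<Zsemi>
     [] \<lhd> op2P N N B B2 \<rhd> [B \<otimes> B] \<Zsemi>
     [mmul N] \<lhd> ([B \<otimes> B, B \<otimes> B], tens_comp M B B B B, [(B \<odot> B) \<otimes> (B \<odot> B)]) \<rhd> [])"

definition square_op0 :: "('o, 'a, 'c) monoidale \<Rightarrow> 'a \<Rightarrow> 'c \<Rightarrow> 'c" where
  "square_op0 N B B0 = pcell_cell
    ([] \<lhd> expand [B, B] \<rhd> [muni N] \<Zsemi>
     [B] \<lhd> op0P N N B B0 \<rhd> [] \<Zsemi>
     op0P N N B B0)"

definition opmonoidal_monad ::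
    "('o, 'a, 'c) monoidale \<Rightarrow> 'a \<Rightarrow> 'c \<Rightarrow> 'c \<Rightarrow> 'c \<Rightarrow> 'c \<Rightarrow> bool" where
  "opmonoidal_monad N B B2 B0 \<mu> \<eta> \<longleftrightarrow>
    opmonoidal_arrow N N B B2 B0 \<and>
    opmonoidal_cell N N (B \<odot> B) (square_op2 N B B2) (square_op0 N B B0) B B2 B0 \<mu> \<and>
    opmonoidal_cell N N (one (mobj N)) (id_op2 N) (id_op0 N) B B2 B0 \<eta> \<and>
    \<mu> \<bullet> (\<mu> \<star> cid B) = \<mu> \<bullet> (cid B \<star> \<mu>) \<bullet> bass M B B B \<and>
    \<mu> \<bullet> (\<eta> \<star> cid B) = blun M B \<and>
    \<mu> \<bullet> (cid B \<star> \<eta>) = brun M B"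

end


section \<open>Bidualities, the enveloping monoidale and comodules\<close>

locale biduality_data = tensor_data M
  for M :: "('o, 'a, 'c) tensor_bicat" +
  fixes R R' :: 'o  \<comment> \<open>\<open>R'\<close> is the dual \<open>R\<degree>\<close>\<close>
    and n e :: 'a
    and \<sigma>l \<sigma>r :: 'c
begin

text \<open>The source of \<open>\<sigma>l\<close> is an arrow \<open>IR' \<rightarrow> R'\<close>, and that of \<open>\<sigma>r\<close> an arrow \<open>RI \<rightarrow> R\<close>.\<close>

definition siglP :: "('a, 'c) pcell" where
  "siglP = ([\<r> R', one R' \<otimes> e, \<a> R' R R', n \<otimes> one R'], \<sigma>l, [\<l> R'])"

definition sigrP :: "('a, 'c) pcell" where
  "sigrP = ([\<l> R, e \<otimes> one R, \<a>\<^sup>* R R' R, one R \<otimes> n], \<sigma>r, [\<r> R])"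

abbreviation E :: 'o where "E \<equiv> R' \<cdot> R"

text \<open>The action \<open>e1 : RE \<rightarrow> R\<close> and the product \<open>1e1 : EE \<rightarrow> E\<close>.\<close>

definition act :: 'a where
  "act = pth [\<l> R, e \<otimes> one R, \<a>\<^sup>* R R' R]"

definition mul :: 'a where
  "mul = pth [one R' \<otimes> act, \<a> R' R E]"

definition expand_act :: "('a, 'c) pcell" where
  "expand_act = expand [\<l> R, e \<otimes> one R, \<a>\<^sup>* R R' R]"

definition expand_mul :: "('a, 'c) pcell" where
  "expand_mul = expand [one R' \<otimes> act, \<a> R' R E]"

text \<open>\<open>act0 : [act, 1 \<otimes> n] \<Rightarrow> [\<r>]\<close>\<close>

definition act0 :: "('a, 'c) pcell" where
  "act0 = [] \<lhd> expand_act \<rhd> [one R \<otimes> n] \<Zsemi> sigrP"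

text \<open>\<open>act2 : [act, 1 \<otimes> mul, \<a>] \<Rightarrow> [act, act \<otimes> 1]\<close>, the interchange of the two copies of \<open>e\<close>\<close>

definition act2 :: "('a, 'c) pcell" where
  "act2 =
    [act] \<lhd> ltens R expand_mul \<rhd> [\<a> R E E] \<Zsemi>
    [] \<lhd> expand_act \<rhd> [one R \<otimes> (one R' \<otimes> act), one R \<otimes> \<a> R' R E, \<a> R E E] \<Zsemi>
    [\<l> R, e \<otimes> one R] \<lhd> assN' (one R) (one R') act \<rhd> [one R \<otimes> \<a> R' R E, \<a> R E E] \<Zsemi>
    [\<l> R, e \<otimes> one R] \<lhd> pinv (split_one_left R R' act) \<rhd>
      [\<a>\<^sup>* R R' (R \<cdot> E), one R \<otimes> \<a> R' R E, \<a> R E E] \<Zsemi>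
    [\<l> R] \<lhd> interchange e act \<rhd> [\<a>\<^sup>* R R' (R \<cdot> E), one R \<otimes> \<a> R' R E, \<a> R E E] \<Zsemi>
    [] \<lhd> lftN act \<rhd> [e \<otimes> one (R \<cdot> E), \<a>\<^sup>* R R' (R \<cdot> E), one R \<otimes> \<a> R' R E, \<a> R E E] \<Zsemi>
    [act, \<l> (R \<cdot> E), e \<otimes> one (R \<cdot> E), \<a>\<^sup>* R R' (R \<cdot> E)] \<lhd> pentP' R R' R E \<rhd> [] \<Zsemi>
    [act, \<l> (R \<cdot> E), e \<otimes> one (R \<cdot> E)] \<lhd>
      cancel_before (pinv (assEta R R' (R \<cdot> E))) (\<a> (R \<cdot> R') R E) \<rhd> [\<a>\<^sup>* R R' R \<otimes> one E] \<Zsemi>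
    [act, \<l> (R \<cdot> E)] \<lhd> split_one_right e R E \<rhd> [\<a> (R \<cdot> R') R E, \<a>\<^sup>* R R' R \<otimes> one E] \<Zsemi>
    [act, \<l> (R \<cdot> E)] \<lhd> pinv (assN e (one R) (one E)) \<rhd> [\<a>\<^sup>* R R' R \<otimes> one E] \<Zsemi>
    [act] \<lhd> lftP R E \<rhd> [(e \<otimes> one R) \<otimes> one E, \<a>\<^sup>* R R' R \<otimes> one E] \<Zsemi>
    [act] \<lhd> rtens (pinv expand_act) E \<rhd> []"

text \<open>\<open>env_ass : [mul, 1 \<otimes> mul, \<a>] \<Rightarrow> [mul, mul \<otimes> 1]\<close>\<close>

definition env_ass :: "('a, 'c) pcell" where
  "env_ass =
    [] \<lhd> expand_mul \<rhd> [one E \<otimes> mul, \<a> E E E] \<Zsemi>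
    [one R' \<otimes> act, \<a> R' R E] \<lhd> split_one_left R' R mul \<rhd> [\<a> E E E] \<Zsemi>
    [one R' \<otimes> act] \<lhd> assN (one R') (one R) mul \<rhd> [\<a> E E E] \<Zsemi>
    [one R' \<otimes> act, one R' \<otimes> (one R \<otimes> mul)] \<lhd> pinv (pentP R' R E E) \<rhd> [] \<Zsemi>
    [] \<lhd> ltens R' act2 \<rhd> [\<a> R' (R \<cdot> E) E, \<a> R' R E \<otimes> one E] \<Zsemi>
    [one R' \<otimes> act] \<lhd> pinv (assN (one R') act (one E)) \<rhd> [\<a> R' R E \<otimes> one E] \<Zsemi>
    [one R' \<otimes> act, \<a> R' R E] \<lhd> rtens (pinv expand_mul) E \<rhd> [] \<Zsemi>
    [] \<lhd> pinv expand_mul \<rhd> [mul \<otimes> one E]"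

text \<open>\<open>env_lun_inv : [mul, n \<otimes> 1] \<Rightarrow> [\<l>]\<close>, given by \<open>\<sigma>l \<otimes> 1\<close>\<close>

definition env_lun_inv :: "('a, 'c) pcell" where
  "env_lun_inv =
    [] \<lhd> expand_mul \<rhd> [n \<otimes> one E] \<Zsemi>
    [] \<lhd> ltens R' expand_act \<rhd> [\<a> R' R E, n \<otimes> one E] \<Zsemi>
    [one R' \<otimes> \<l> R, one R' \<otimes> (e \<otimes> one R), one R' \<otimes> \<a>\<^sup>* R R' R, \<a> R' R E] \<lhd>
      split_one_right n R' R \<rhd> [] \<Zsemi>
    [one R' \<otimes> \<l> R, one R' \<otimes> (e \<otimes> one R), one R' \<otimes> \<a>\<^sup>* R R' R, \<a> R' R E] \<lhd>
      insert_after (n \<otimes> (one R' \<otimes> one R)) (pinv (assEps I R' R)) \<rhd> [] \<Zsemi>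
    [one R' \<otimes> \<l> R, one R' \<otimes> (e \<otimes> one R), one R' \<otimes> \<a>\<^sup>* R R' R, \<a> R' R E] \<lhd>
      pinv (assN n (one R') (one R)) \<rhd> [\<a>\<^sup>* I R' R] \<Zsemi>
    [one R' \<otimes> \<l> R, one R' \<otimes> (e \<otimes> one R), one R' \<otimes> \<a>\<^sup>* R R' R] \<lhd>
      pinv (pentP R' R R' R) \<rhd> [(n \<otimes> one R') \<otimes> one R, \<a>\<^sup>* I R' R] \<Zsemi>
    [one R' \<otimes> \<l> R, one R' \<otimes> (e \<otimes> one R)] \<lhd>
      cancel_before
        (ltens R' (pinv (assEta R R' R)) \<Zsemi> pinv (oneP R' ((R \<cdot> R') \<cdot> R)))
        (\<a> R' (R \<cdot> R') R) \<rhd>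
      [\<a> R' R R' \<otimes> one R, (n \<otimes> one R') \<otimes> one R, \<a>\<^sup>* I R' R] \<Zsemi>
    [one R' \<otimes> \<l> R] \<lhd> pinv (assN (one R') e (one R)) \<rhd>
      [\<a> R' R R' \<otimes> one R, (n \<otimes> one R') \<otimes> one R, \<a>\<^sup>* I R' R] \<Zsemi>
    [] \<lhd> midP R' R \<rhd>
      [(one R' \<otimes> e) \<otimes> one R, \<a> R' R R' \<otimes> one R, (n \<otimes> one R') \<otimes> one R, \<a>\<^sup>* I R' R] \<Zsemi>
    [] \<lhd> rtens siglP R \<rhd> [\<a>\<^sup>* I R' R] \<Zsemi>
    [] \<lhd> pinv (lftP R' R) \<rhd> [\<a>\<^sup>* I R' R] \<Zsemi>
    cancel_after (\<l> E) (assEps I R' R)"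

text \<open>\<open>env_run : [mul, 1 \<otimes> n] \<Rightarrow> [\<r>]\<close>, given by \<open>1 \<otimes> \<sigma>r\<close>\<close>

definition env_run :: "('a, 'c) pcell" where
  "env_run =
    [] \<lhd> expand_mul \<rhd> [one E \<otimes> n] \<Zsemi>
    [one R' \<otimes> act, \<a> R' R E] \<lhd> split_one_left R' R n \<rhd> [] \<Zsemi>
    [one R' \<otimes> act] \<lhd> assN (one R') (one R) n \<rhd> [] \<Zsemi>
    [] \<lhd> ltens R' act0 \<rhd> [\<a> R' R I] \<Zsemi>
    rgtP R' R"

definition enveloping :: "('o, 'a, 'c) monoidale" where
  "enveloping =
    \<lparr> mobj = E, mmul = mul, muni = n, mass = pcell_cell env_ass,
      mlun = pcell_cell (pinv env_lun_inv), mrun = pcell_cell env_run \<rparr>"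

text \<open>
  The two swallowtail equations.  The first compares, for the path
  \<open>[e, 1 \<otimes> \<r>, 1 \<otimes> (1 \<otimes> e), 1 \<otimes> \<a>, 1 \<otimes> (n \<otimes> 1), \<a>]\<close> from \<open>(RI)R'\<close> to \<open>I\<close>, the cell
  obtained from \<open>1 \<otimes> \<sigma>l\<close> with the one obtained by interchanging the two copies of \<open>e\<close> and
  applying \<open>\<sigma>r \<otimes> 1\<close>.  The second compares \<open>1 \<otimes> \<sigma>r\<close> and \<open>\<sigma>l \<otimes> 1\<close> on \<open>[mul, 1 \<otimes> n, n \<otimes> 1]\<close>,
  from \<open>II\<close> to \<open>E\<close>.
\<close>

definition swallowtail_e :: bool where
  "swallowtail_e \<longleftrightarrow>
    [e] \<lhd> ltens R siglP \<rhd> [\<a> R I R'] \<Zsemi>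
    [e] \<lhd> midP R R' \<rhd> [] =
    [e, one R \<otimes> \<r> R', one R \<otimes> (one R' \<otimes> e), one R \<otimes> \<a> R' R R'] \<lhd>
      pinv (assN (one R) n (one R')) \<rhd> [] \<Zsemi>
    [e, one R \<otimes> \<r> R', one R \<otimes> (one R' \<otimes> e)] \<lhd>
      pentP' R R' R R' \<rhd> [(one R \<otimes> n) \<otimes> one R'] \<Zsemi>
    [e, one R \<otimes> \<r> R'] \<lhd> pinv (assN (one R) (one R') e) \<rhd>
      [\<a> (R \<cdot> R') R R', \<a>\<^sup>* R R' R \<otimes> one R', (one R \<otimes> n) \<otimes> one R'] \<Zsemi>
    [e] \<lhd> rgtP R R' \<rhd> [(one R \<otimes> one R') \<otimes> e,
      \<a> (R \<cdot> R') R R', \<a>\<^sup>* R R' R \<otimes> one R', (one R \<otimes> n) \<otimes> one R'] \<Zsemi>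
    [] \<lhd> pinv (rgtN e) \<rhd> [(one R \<otimes> one R') \<otimes> e,
      \<a> (R \<cdot> R') R R', \<a>\<^sup>* R R' R \<otimes> one R', (one R \<otimes> n) \<otimes> one R'] \<Zsemi>
    [\<r> I, e \<otimes> one I] \<lhd> pinv (split_one_left R R' e) \<rhd>
      [\<a> (R \<cdot> R') R R', \<a>\<^sup>* R R' R \<otimes> one R', (one R \<otimes> n) \<otimes> one R'] \<Zsemi>
    [\<r> I] \<lhd> interchange e e \<rhd>
      [\<a> (R \<cdot> R') R R', \<a>\<^sup>* R R' R \<otimes> one R', (one R \<otimes> n) \<otimes> one R'] \<Zsemi>
    [] \<lhd> unit_cell \<rhd> [one I \<otimes> e, e \<otimes> one (R \<cdot> R'),
      \<a> (R \<cdot> R') R R', \<a>\<^sup>* R R' R \<otimes> one R', (one R \<otimes> n) \<otimes> one R'] \<Zsemi>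
    [] \<lhd> lftN e \<rhd> [e \<otimes> one (R \<cdot> R'),
      \<a> (R \<cdot> R') R R', \<a>\<^sup>* R R' R \<otimes> one R', (one R \<otimes> n) \<otimes> one R'] \<Zsemi>
    [e, \<l> (R \<cdot> R')] \<lhd> split_one_right e R R' \<rhd>
      [\<a> (R \<cdot> R') R R', \<a>\<^sup>* R R' R \<otimes> one R', (one R \<otimes> n) \<otimes> one R'] \<Zsemi>
    [e, \<l> (R \<cdot> R')] \<lhd> pinv (assN e (one R) (one R')) \<rhd>
      [\<a>\<^sup>* R R' R \<otimes> one R', (one R \<otimes> n) \<otimes> one R'] \<Zsemi>
    [e] \<lhd> lftP R R' \<rhd>
      [(e \<otimes> one R) \<otimes> one R', \<a>\<^sup>* R R' R \<otimes> one R', (one R \<otimes> n) \<otimes> one R'] \<Zsemi>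
    [e] \<lhd> rtens sigrP R' \<rhd> []"

definition swallowtail_n :: bool where
  "swallowtail_n \<longleftrightarrow>
    [] \<lhd> env_run \<rhd> [n \<otimes> one I] \<Zsemi>
    rgtN n \<Zsemi>
    [n] \<lhd> unit_cell \<rhd> [] =
    [mul] \<lhd> pinv (interchange n n) \<rhd> [] \<Zsemi>
    [] \<lhd> env_lun_inv \<rhd> [one I \<otimes> n] \<Zsemi>
    lftN n"

text \<open>Right comodules from \<open>e1\<close> to \<open>e1\<close>.\<close>

definition comodP :: "'a \<Rightarrow> 'a \<Rightarrow> 'c \<Rightarrow> ('a, 'c) pcell" where
  "comodP B Y y = ([Y, act], y, [act, Y \<otimes> B])"

definition comodule :: "'a \<Rightarrow> 'c \<Rightarrow> 'c \<Rightarrow> 'a \<Rightarrow> 'c \<Rightarrow> bool" where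
  "comodule B B2 B0 Y y \<longleftrightarrow>
    \<guillemotleft>Y : R \<rightarrow> R\<guillemotright> \<and>
    \<guillemotleft>y : Y \<odot> act \<Rightarrow> act \<odot> (Y \<otimes> B)\<guillemotright> \<and>
    [Y] \<lhd> act2 \<rhd> [] \<Zsemi>
    [] \<lhd> comodP B Y y \<rhd> [act \<otimes> one E] \<Zsemi>
    [act] \<lhd> sqtens (comodP B Y y) (swap B) \<rhd> [] =
    [] \<lhd> comodP B Y y \<rhd> [one R \<otimes> mul, \<a> R E E] \<Zsemi>
    [act] \<lhd> sqtens (swap Y) (op2P enveloping enveloping B B2) \<rhd> [\<a> R E E] \<Zsemi>
    [act, one R \<otimes> mul] \<lhd> pinv (assN Y B B) \<rhd> [] \<Zsemi>
    [] \<lhd> act2 \<rhd> [(Y \<otimes> B) \<otimes> B] \<and>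
    [Y] \<lhd> act0 \<rhd> [] =
    [] \<lhd> comodP B Y y \<rhd> [one R \<otimes> n] \<Zsemi>
    [act] \<lhd> sqtens (swap Y) (op0P enveloping enveloping B B0 \<Zsemi> pinv (run n)) \<rhd> [] \<Zsemi>
    [] \<lhd> act0 \<rhd> [Y \<otimes> one I] \<Zsemi>
    rgtN Y"

definition comodule_morphism :: "'a \<Rightarrow> 'a \<Rightarrow> 'c \<Rightarrow> 'a \<Rightarrow> 'c \<Rightarrow> 'c \<Rightarrow> bool" where
  "comodule_morphism B Y y Y' y' \<gamma> \<longleftrightarrow>
    \<guillemotleft>\<gamma> : Y \<Rightarrow> Y'\<guillemotright> \<and>
    y' \<bullet> (\<gamma> \<star> cid act) = (cid act \<star> (\<gamma> \<otimes>\<^sub>c cid B)) \<bullet> y"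

text \<open>An arrow of the category of comodules is a cell together with its source and target
  comodules.\<close>

definition rComod :: "'a \<Rightarrow> 'c \<Rightarrow> 'c \<Rightarrow> ('a \<times> 'c, ('a \<times> 'c) \<times> 'c \<times> ('a \<times> 'c)) cat" where
  "rComod B B2 B0 =
    \<lparr> Obj = {(Y, y). comodule B B2 B0 Y y},
      Arr = {((Y, y), \<gamma>, (Y', y')). comodule B B2 B0 Y y \<and> comodule B B2 B0 Y' y' \<and>
        comodule_morphism B Y y Y' y' \<gamma>},
      Dom = (\<lambda>(Yy, \<gamma>, Yy'). Yy),
      Cod = (\<lambda>(Yy, \<gamma>, Yy'). Yy'),
      Id = (\<lambda>(Y, y). ((Y, y), cid Y, (Y, y))),
      Cmp = (\<lambda>(_, \<delta>, Yy'') (Yy, \<gamma>, _). (Yy, \<delta> \<bullet> \<gamma>, Yy'')) \<rparr>"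

definition forget_ob :: "'a \<times> 'c \<Rightarrow> 'a" where
  "forget_ob = (\<lambda>(Y, y). Y)"

definition forget_ar :: "('a \<times> 'c) \<times> 'c \<times> ('a \<times> 'c) \<Rightarrow> 'c" where
  "forget_ar = (\<lambda>(Yy, \<gamma>, Yy'). \<gamma>)"

definition biduality :: bool where
  "biduality \<longleftrightarrow>
    R \<in> Ob M \<and> R' \<in> Ob M \<and>
    \<guillemotleft>n : I \<rightarrow> R' \<cdot> R\<guillemotright> \<and> \<guillemotleft>e : R \<cdot> R' \<rightarrow> I\<guillemotright> \<and>
    \<guillemotleft>\<sigma>l : pth [\<r> R', one R' \<otimes> e, \<a> R' R R', n \<otimes> one R'] \<cong> \<l> R'\<guillemotright> \<and>
    \<guillemotleft>\<sigma>r : pth [\<l> R, e \<otimes> one R, \<a>\<^sup>* R R' R, one R \<otimes> n] \<cong> \<r> R\<guillemotright> \<and>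
    swallowtail_e \<and> swallowtail_n"

end

end

theory Submission
  imports Defs
begin

text \<open>Right comodules compose.  Given comodules \<open>(Y, y)\<close> and \<open>(Z, z)\<close>, the composite \<open>Y \<odot> Z\<close> carries
  the coaction
    \<open>Y(Z(x\<cdot>p)) \<rightarrow> Y(Zx\<cdot>Bp) \<rightarrow> YZx\<cdot>BBp \<rightarrow> YZx\<cdot>Bp\<close>
  made of \<open>z\<close>, \<open>y\<close> and the multiplication \<open>\<mu>\<close> of the monad, and the identity arrow carries the
  coaction \<open>x\<cdot>p \<rightarrow> x\<cdot>Bp\<close> given by the unit \<open>\<eta>\<close>.  The two comodule axioms for the composite follow
  from those for \<open>y\<close> and \<open>z\<close> because \<open>\<mu>\<close> is an opmonoidal cell (\<open>composite_act2\<close>,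
  \<open>composite_act0\<close>); for the identity they hold because \<open>\<eta>\<close> is one (\<open>unit_act2\<close>, \<open>unit_act0\<close>).
  The associativity and unit laws of the monad say that the associator and the unitors of
  \<open>M(R, R)\<close> are morphisms of comodules (\<open>comod_mor_assoc\<close>, \<open>comod_mor_left_unit\<close>,
  \<open>comod_mor_right_unit\<close>).  So the monoidal structure of \<open>M(R, R)\<close> lifts along the forgetful
  functor (\<open>monoidal_lifting\<close>), and this functor preserves it strictly.

  The work lies in doing these calculations in a bicategory that is not strict.  Two devices
  reduce them to rewriting of words.

  First, the pasting cells of a bicategory form a strict 2-category whose arrows are paths; the
  coherence axioms are used up in \<open>join_assoc\<close> (by the pentagon) and in \<open>runs_Cons\<close>,
  \<open>luns_Cons\<close> and \<open>luns_runs_middle\<close> (by Kelly's unit laws and the triangle).  In the same way the tensor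
  product, a pseudofunctor, becomes an operation \<open>\<boxtimes>\<close> on pasting cells between paths of equal
  lengths that strictly preserves vertical composition and whiskering (\<open>ptens_paste\<close>,
  \<open>ptens_wh\<close>); it generalizes the tensor product of squares.

  Secondly, vertical composition \<open>;;\<close> and whiskering \<open>wh\<close> are made total, with an absorbing
  ill-formed pasting cell as value where they make no sense.  Then associativity of \<open>;;\<close>,
  functoriality of \<open>wh\<close> and the interchange law hold for all arguments, and a chain of pastings
  can be rewritten without attention to sources and targets.\<close>

section \<open>Cells of a bicategory\<close>

context bicategory begin

definition invertible :: "'c \<Rightarrow> bool" where
  "invertible \<theta> \<longleftrightarrow> (\<exists>\<phi>. inverse_cells \<theta> \<phi>)"

lemma arrow_simps [simp]:
  "f \<in> Ar M ==> g \<in> Ar M ==> src M f = trg M g ==> f \<odot> g \<in> Ar M"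
  "f \<in> Ar M ==> g \<in> Ar M ==> src M f = trg M g ==> src M (f \<odot> g) = src M g"
  "f \<in> Ar M ==> g \<in> Ar M ==> src M f = trg M g ==> trg M (f \<odot> g) = trg M f"
  "X \<in> Ob M ==> one X \<in> Ar M"
  "X \<in> Ob M ==> src M (one X) = X"
  "X \<in> Ob M ==> trg M (one X) = X"
  "f \<in> Ar M ==> src M f \<in> Ob M"
  "f \<in> Ar M ==> trg M f \<in> Ob M"
  using acomp_arr one_arr src_in trg_in by blast+

lemma cell_simps [simp]:
  "\<theta> \<in> Ce M ==> cdom M \<theta> \<in> Ar M"
  "\<theta> \<in> Ce M ==> ccod M \<theta> \<in> Ar M"
  "\<theta> \<in> Ce M ==> src M (ccod M \<theta>) = src M (cdom M \<theta>)"
  "\<theta> \<in> Ce M ==> trg M (ccod M \<theta>) = trg M (cdom M \<theta>)"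
  "f \<in> Ar M ==> cid f \<in> Ce M"
  "f \<in> Ar M ==> cdom M (cid f) = f"
  "f \<in> Ar M ==> ccod M (cid f) = f"
  "\<theta> \<in> Ce M ==> \<phi> \<in> Ce M ==> cdom M \<theta> = ccod M \<phi> ==> \<theta> \<bullet> \<phi> \<in> Ce M"
  "\<theta> \<in> Ce M ==> \<phi> \<in> Ce M ==> cdom M \<theta> = ccod M \<phi> ==> cdom M (\<theta> \<bullet> \<phi>) = cdom M \<phi>"
  "\<theta> \<in> Ce M ==> \<phi> \<in> Ce M ==> cdom M \<theta> = ccod M \<phi> ==> ccod M (\<theta> \<bullet> \<phi>) = ccod M \<theta>"
  "\<theta> \<in> Ce M ==> \<phi> \<in> Ce M ==> src M (cdom M \<theta>) = trg M (cdom M \<phi>) ==> \<theta> \<star> \<phi> \<in> Ce M"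
  "\<theta> \<in> Ce M ==> \<phi> \<in> Ce M ==> src M (cdom M \<theta>) = trg M (cdom M \<phi>) ==>
    cdom M (\<theta> \<star> \<phi>) = cdom M \<theta> \<odot> cdom M \<phi>"
  "\<theta> \<in> Ce M ==> \<phi> \<in> Ce M ==> src M (cdom M \<theta>) = trg M (cdom M \<phi>) ==>
    ccod M (\<theta> \<star> \<phi>) = ccod M \<theta> \<odot> ccod M \<phi>"
  using cdom_in ccod_in src_parallel trg_parallel cid_cell vcomp_cell hcomp_cell by metis+

lemma cell_unit_simps [simp]:
  "\<theta> \<in> Ce M ==> ccod M \<theta> = f ==> cid f \<bullet> \<theta> = \<theta>"
  "\<theta> \<in> Ce M ==> cdom M \<theta> = f ==> \<theta> \<bullet> cid f = \<theta>"
  using vcomp_cid_left vcomp_cid_right by blast+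

lemma hcomp_cid_simp [simp]:
  "f \<in> Ar M ==> g \<in> Ar M ==> src M f = trg M g ==> cid f \<star> cid g = cid (f \<odot> g)"
  using hcomp_cid by blast

lemma vassoc:
  "\<theta> \<in> Ce M ==> \<phi> \<in> Ce M ==> \<psi> \<in> Ce M ==> cdom M \<theta> = ccod M \<phi> ==> cdom M \<phi> = ccod M \<psi> ==>
    (\<theta> \<bullet> \<phi>) \<bullet> \<psi> = \<theta> \<bullet> (\<phi> \<bullet> \<psi>)"
  using vcomp_assoc by blast

lemma hcomp_interchange:
  "\<theta> \<in> Ce M ==> \<theta>' \<in> Ce M ==> \<phi> \<in> Ce M ==> \<phi>' \<in> Ce M ==> cdom M \<theta>' = ccod M \<theta> ==>
   cdom M \<phi>' = ccod M \<phi> ==> src M (cdom M \<theta>) = trg M (cdom M \<phi>) ==>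
   (\<theta>' \<star> \<phi>') \<bullet> (\<theta> \<star> \<phi>) = (\<theta>' \<bullet> \<theta>) \<star> (\<phi>' \<bullet> \<phi>)"
  using hcomp_vcomp by metis

lemma inverse_cells_unique: "inverse_cells \<theta> \<phi> ==> inverse_cells \<theta> \<psi> ==> \<phi> = \<psi>"
proof -
  assume a: "inverse_cells \<theta> \<phi>" "inverse_cells \<theta> \<psi>"
  then show ?thesis
    unfolding inverse_cells_def by (metis cell_unit_simps vassoc)
qed

lemma cinv_eq: "inverse_cells \<theta> \<phi> ==> cinv \<theta> = \<phi>"
  unfolding cinv_def using inverse_cells_unique by blast

lemma inverse_cinv: "invertible \<theta> ==> inverse_cells \<theta> (cinv \<theta>)"
  unfolding invertible_def using cinv_eq by metis

lemma invertible_in: "invertible \<theta> ==> \<theta> \<in> Ce M"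
  using inverse_cinv unfolding inverse_cells_def by blast

lemma invertible_simps [simp]:
  "invertible \<theta> ==> cinv \<theta> \<in> Ce M"
  "invertible \<theta> ==> cdom M (cinv \<theta>) = ccod M \<theta>"
  "invertible \<theta> ==> ccod M (cinv \<theta>) = cdom M \<theta>"
  "invertible \<theta> ==> cinv \<theta> \<bullet> \<theta> = cid (cdom M \<theta>)"
  "invertible \<theta> ==> \<theta> \<bullet> cinv \<theta> = cid (ccod M \<theta>)"
  using inverse_cinv unfolding inverse_cells_def by blast+

lemma cancel_simps [simp]:
  "invertible \<theta> ==> \<phi> \<in> Ce M ==> ccod M \<phi> = cdom M \<theta> ==> cinv \<theta> \<bullet> (\<theta> \<bullet> \<phi>) = \<phi>"
  "invertible \<theta> ==> \<phi> \<in> Ce M ==> ccod M \<phi> = ccod M \<theta> ==> \<theta> \<bullet> (cinv \<theta> \<bullet> \<phi>) = \<phi>"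
  using vassoc[symmetric] by (simp_all add: invertible_in)

lemma icell_iff: "icell \<theta> f g \<longleftrightarrow> invertible \<theta> \<and> cdom M \<theta> = f \<and> ccod M \<theta> = g"
  unfolding icell_def invertible_def inverse_cells_def by blast

lemma inverse_cells_invertible: "inverse_cells \<theta> \<phi> ==> invertible \<theta>"
  unfolding invertible_def by blast

lemma inverse_cells_cid: "f \<in> Ar M ==> inverse_cells (cid f) (cid f)"
  unfolding inverse_cells_def by simp

lemma inverse_cells_cinv: "invertible \<theta> ==> inverse_cells (cinv \<theta>) \<theta>"
  unfolding inverse_cells_def by (simp add: invertible_in)

lemma inverse_cells_vcomp:
  "invertible \<theta> ==> invertible \<phi> ==> cdom M \<theta> = ccod M \<phi> ==>
   inverse_cells (\<theta> \<bullet> \<phi>) (cinv \<phi> \<bullet> cinv \<theta>)"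
  unfolding inverse_cells_def by (simp add: vassoc invertible_in)

lemma inverse_cells_hcomp:
  "invertible \<theta> ==> invertible \<phi> ==> src M (cdom M \<theta>) = trg M (cdom M \<phi>) ==>
   inverse_cells (\<theta> \<star> \<phi>) (cinv \<theta> \<star> cinv \<phi>)"
  unfolding inverse_cells_def by (simp add: hcomp_interchange invertible_in)

lemma invertible_closed [simp]:
  "f \<in> Ar M ==> invertible (cid f)"
  "invertible \<theta> ==> invertible (cinv \<theta>)"
  "invertible \<theta> ==> invertible \<phi> ==> cdom M \<theta> = ccod M \<phi> ==> invertible (\<theta> \<bullet> \<phi>)"
  "invertible \<theta> ==> invertible \<phi> ==> src M (cdom M \<theta>) = trg M (cdom M \<phi>) ==> invertible (\<theta> \<star> \<phi>)"
  using inverse_cells_cid inverse_cells_cinv inverse_cells_vcomp inverse_cells_hcomp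
  by (meson inverse_cells_invertible)+

lemma cinv_simps [simp]:
  "f \<in> Ar M ==> cinv (cid f) = cid f"
  "invertible \<theta> ==> cinv (cinv \<theta>) = \<theta>"
  "invertible \<theta> ==> invertible \<phi> ==> cdom M \<theta> = ccod M \<phi> ==> cinv (\<theta> \<bullet> \<phi>) = cinv \<phi> \<bullet> cinv \<theta>"
  "invertible \<theta> ==> invertible \<phi> ==> src M (cdom M \<theta>) = trg M (cdom M \<phi>) ==>
    cinv (\<theta> \<star> \<phi>) = cinv \<theta> \<star> cinv \<phi>"
  using inverse_cells_cid inverse_cells_cinv inverse_cells_vcomp inverse_cells_hcomp cinv_eq
  by meson+

lemma cancel_left:
  "invertible \<theta> ==> \<phi> \<in> Ce M ==> \<psi> \<in> Ce M ==> ccod M \<phi> = cdom M \<theta> ==> ccod M \<psi> = cdom M \<theta> ==>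
    \<theta> \<bullet> \<phi> = \<theta> \<bullet> \<psi> ==> \<phi> = \<psi>"
  by (metis cancel_simps(1))

lemma cancel_right:
  "invertible \<theta> ==> \<phi> \<in> Ce M ==> \<psi> \<in> Ce M ==> cdom M \<phi> = ccod M \<theta> ==> cdom M \<psi> = ccod M \<theta> ==>
    \<phi> \<bullet> \<theta> = \<psi> \<bullet> \<theta> ==> \<phi> = \<psi>"
  by (metis cell_unit_simps(2) invertible_simps invertible_in vassoc)

lemma bass_simps [simp]:
  assumes "f \<in> Ar M" "g \<in> Ar M" "h \<in> Ar M" "src M f = trg M g" "src M g = trg M h"
  shows "invertible (bass M f g h)" "bass M f g h \<in> Ce M"
    "cdom M (bass M f g h) = (f \<odot> g) \<odot> h" "ccod M (bass M f g h) = f \<odot> (g \<odot> h)"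
  using assms bass_icell unfolding icell_iff by (blast intro: invertible_in)+

lemma unitor_simps [simp]:
  assumes "f \<in> Ar M"
  shows "invertible (blun M f)" "invertible (brun M f)" "blun M f \<in> Ce M" "brun M f \<in> Ce M"
    "cdom M (blun M f) = one (trg M f) \<odot> f" "ccod M (blun M f) = f"
    "cdom M (brun M f) = f \<odot> one (src M f)" "ccod M (brun M f) = f"
  using assms blun_icell brun_icell unfolding icell_iff by (blast intro: invertible_in)+

lemma bass_nat:
  "\<theta> \<in> Ce M ==> \<phi> \<in> Ce M ==> \<psi> \<in> Ce M ==> src M (cdom M \<theta>) = trg M (cdom M \<phi>) ==>
   src M (cdom M \<phi>) = trg M (cdom M \<psi>) ==>
   bass M (ccod M \<theta>) (ccod M \<phi>) (ccod M \<psi>) \<bullet> ((\<theta> \<star> \<phi>) \<star> \<psi>) =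
   (\<theta> \<star> (\<phi> \<star> \<psi>)) \<bullet> bass M (cdom M \<theta>) (cdom M \<phi>) (cdom M \<psi>)"
  using bass_natural by blast

lemma vext: "\<theta> \<bullet> \<phi> = \<theta>' \<bullet> \<phi>' ==> \<theta> \<in> Ce M ==> \<phi> \<in> Ce M ==> \<theta>' \<in> Ce M ==> \<phi>' \<in> Ce M ==>
  \<psi> \<in> Ce M ==> cdom M \<theta> = ccod M \<phi> ==> cdom M \<theta>' = ccod M \<phi>' ==> cdom M \<phi> = ccod M \<psi> ==>
  cdom M \<phi>' = ccod M \<psi> ==> \<theta> \<bullet> (\<phi> \<bullet> \<psi>) = \<theta>' \<bullet> (\<phi>' \<bullet> \<psi>)"
  by (metis vassoc)

lemma cid_hcomp_vcomp:
  "\<theta> \<in> Ce M ==> \<phi> \<in> Ce M ==> cdom M \<theta> = ccod M \<phi> ==> f \<in> Ar M ==> src M f = trg M (cdom M \<phi>) ==>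
    cid f \<star> (\<theta> \<bullet> \<phi>) = (cid f \<star> \<theta>) \<bullet> (cid f \<star> \<phi>)"
  using hcomp_interchange[of "cid f" "cid f" \<phi> \<theta>] by simp

section \<open>Coherence of the unit constraints\<close>

text \<open>Whiskering with an identity arrow is faithful, as it is isomorphic to the identity functor. This
  is how equations between unit constraints are reduced to the triangle and the pentagon.\<close>

lemma cancel_one_left:
  assumes "\<theta> \<in> Ce M" "\<phi> \<in> Ce M" "cdom M \<theta> = cdom M \<phi>" "ccod M \<theta> = ccod M \<phi>"
    and "cid (one (trg M (cdom M \<theta>))) \<star> \<theta> = cid (one (trg M (cdom M \<theta>))) \<star> \<phi>"
  shows "\<theta> = \<phi>"
proof -
  have "\<theta> \<bullet> blun M (cdom M \<theta>) = \<phi> \<bullet> blun M (cdom M \<theta>)"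
    using assms blun_natural by metis
  then show ?thesis by (rule cancel_right[rotated 5]) (simp_all add: assms(1-4))
qed

lemma cancel_one_right:
  assumes "\<theta> \<in> Ce M" "\<phi> \<in> Ce M" "cdom M \<theta> = cdom M \<phi>" "ccod M \<theta> = ccod M \<phi>"
    and "\<theta> \<star> cid (one (src M (cdom M \<theta>))) = \<phi> \<star> cid (one (src M (cdom M \<theta>)))"
  shows "\<theta> = \<phi>"
proof -
  have "\<theta> \<bullet> brun M (cdom M \<theta>) = \<phi> \<bullet> brun M (cdom M \<theta>)"
    using assms brun_natural by metis
  then show ?thesis by (rule cancel_right[rotated 5]) (simp_all add: assms(1-4))
qed

text \<open>Kelly's argument: after whiskering with an identity arrow on the left, both sides become
  comparable by the pentagon for \<open>(1, 1, f, g)\<close> and two instances of the triangle.\<close>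

lemma blun_comp:
  assumes [simp]: "f \<in> Ar M" "g \<in> Ar M" "src M f = trg M g"
  shows "blun M (f \<odot> g) \<bullet> bass M (one (trg M f)) f g = blun M f \<star> cid g"
proof (rule cancel_one_left)
  let ?i = "one (trg M f)"
  have 1: "(cid ?i \<star> bass M ?i f g) \<bullet> bass M ?i (?i \<odot> f) g \<bullet> (bass M ?i ?i f \<star> cid g) =
      bass M ?i ?i (f \<odot> g) \<bullet> bass M (?i \<odot> ?i) f g"
    by (rule bicat_pentagon) auto
  have tri: "(cid ?i \<star> blun M h) \<bullet> bass M ?i ?i h = brun M ?i \<star> cid h"
    if "h \<in> Ar M" "trg M h = trg M f" for h
    by (rule bicat_triangle) (use that in auto)
  let ?L = "cid ?i \<star> (blun M (f \<odot> g) \<bullet> bass M ?i f g)" and ?Q = "cid ?i \<star> (blun M f \<star> cid g)"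
    and ?w = "bass M ?i (?i \<odot> f) g \<bullet> (bass M ?i ?i f \<star> cid g)"
  have "?L \<bullet> ?w = (cid ?i \<star> blun M (f \<odot> g)) \<bullet> ((cid ?i \<star> bass M ?i f g) \<bullet> ?w)"
    by (simp add: vassoc[symmetric] hcomp_interchange)
  also have "\<dots> = (cid ?i \<star> blun M (f \<odot> g)) \<bullet> (bass M ?i ?i (f \<odot> g) \<bullet> bass M (?i \<odot> ?i) f g)"
    using 1 by simp
  also have "\<dots> = (brun M ?i \<star> cid (f \<odot> g)) \<bullet> bass M (?i \<odot> ?i) f g"
    by (simp add: vassoc[symmetric] tri)
  also have "\<dots> = bass M ?i f g \<bullet> ((brun M ?i \<star> cid f) \<star> cid g)"
    using bass_nat[of "brun M ?i" "cid f" "cid g"] by simp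
  also have "\<dots> = bass M ?i f g \<bullet> (((cid ?i \<star> blun M f) \<bullet> bass M ?i ?i f) \<star> cid g)"
    by (simp add: tri)
  also have "\<dots> = bass M ?i f g \<bullet> ((cid ?i \<star> blun M f) \<star> cid g) \<bullet> (bass M ?i ?i f \<star> cid g)"
    by (simp add: hcomp_interchange)
  also have "\<dots> = ?Q \<bullet> ?w"
    using bass_nat[of "cid ?i" "blun M f" "cid g"] by (simp add: vassoc[symmetric])
  finally have e: "?L \<bullet> ?w = ?Q \<bullet> ?w" .
  show "cid (one (trg M (cdom M (blun M (f \<odot> g) \<bullet> bass M ?i f g)))) \<star> (blun M (f \<odot> g) \<bullet> bass M ?i f g)
      = cid (one (trg M (cdom M (blun M (f \<odot> g) \<bullet> bass M ?i f g)))) \<star> (blun M f \<star> cid g)"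
    using cancel_right[OF _ _ _ _ _ e] by simp
qed auto

text \<open>The mirror image of \<open>blun_comp\<close>, from the pentagon for \<open>(f, g, 1, 1)\<close>.\<close>

lemma brun_comp:
  assumes [simp]: "f \<in> Ar M" "g \<in> Ar M" "src M f = trg M g"
  shows "(cid f \<star> brun M g) \<bullet> bass M f g (one (src M g)) = brun M (f \<odot> g)"
proof (rule cancel_one_right)
  let ?i = "one (src M g)"
  have 1: "(cid f \<star> bass M g ?i ?i) \<bullet> bass M f (g \<odot> ?i) ?i \<bullet> (bass M f g ?i \<star> cid ?i) =
      bass M f g (?i \<odot> ?i) \<bullet> bass M (f \<odot> g) ?i ?i"
    by (rule bicat_pentagon) auto
  have tri: "(cid h \<star> blun M ?i) \<bullet> bass M h ?i ?i = brun M h \<star> cid ?i"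
    if "h \<in> Ar M" "src M h = src M g" for h
    by (rule bicat_triangle) (use that in auto)
  let ?L = "((cid f \<star> brun M g) \<bullet> bass M f g ?i) \<star> cid ?i" and ?Q = "brun M (f \<odot> g) \<star> cid ?i"
  have "bass M f g ?i \<bullet> ?L = bass M f g ?i \<bullet> ((cid f \<star> brun M g) \<star> cid ?i) \<bullet> (bass M f g ?i \<star> cid ?i)"
    by (simp add: hcomp_interchange)
  also have "\<dots> = (cid f \<star> (brun M g \<star> cid ?i)) \<bullet> bass M f (g \<odot> ?i) ?i \<bullet> (bass M f g ?i \<star> cid ?i)"
    using bass_nat[of "cid f" "brun M g" "cid ?i"] by (simp add: vassoc[symmetric])
  also have "\<dots> = ((cid f \<star> (cid g \<star> blun M ?i)) \<bullet> (cid f \<star> bass M g ?i ?i)) \<bullet> bass M f (g \<odot> ?i) ?i \<bullet> (bass M f g ?i \<star> cid ?i)"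
    by (simp add: hcomp_interchange tri)
  also have "\<dots> = (cid f \<star> (cid g \<star> blun M ?i)) \<bullet> bass M f g (?i \<odot> ?i) \<bullet> bass M (f \<odot> g) ?i ?i"
    by (simp add: vassoc 1 del: hcomp_cid_simp)
  also have "\<dots> = bass M f g ?i \<bullet> ((cid (f \<odot> g) \<star> blun M ?i) \<bullet> bass M (f \<odot> g) ?i ?i)"
    using bass_nat[of "cid f" "cid g" "blun M ?i"] by (simp add: vassoc[symmetric])
  also have "\<dots> = bass M f g ?i \<bullet> ?Q"
    by (simp add: tri)
  finally have e: "bass M f g ?i \<bullet> ?L = bass M f g ?i \<bullet> ?Q" .
  show "((cid f \<star> brun M g) \<bullet> bass M f g ?i) \<star> cid (one (src M (cdom M ((cid f \<star> brun M g) \<bullet> bass M f g ?i))))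
     = brun M (f \<odot> g) \<star> cid (one (src M (cdom M ((cid f \<star> brun M g) \<bullet> bass M f g ?i))))"
    using cancel_left[OF _ _ _ _ _ e] by simp
qed auto

text \<open>Naturality of the left unitor at itself gives \<open>1 \<star> l = l\<^bsub>1 1\<^esub>\<close>, so that the triangle and
  \<open>blun_comp\<close> have the same left hand side.\<close>

lemma blun_one: "X \<in> Ob M ==> blun M (one X) = brun M (one X)"
proof (rule cancel_one_right)
  assume [simp]: "X \<in> Ob M"
  let ?i = "one X"
  have "blun M ?i \<bullet> (cid ?i \<star> blun M ?i) = blun M ?i \<bullet> blun M (?i \<odot> ?i)"
    using blun_natural[of "blun M ?i" "?i \<odot> ?i" ?i] by simp
  then have "cid ?i \<star> blun M ?i = blun M (?i \<odot> ?i)"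
    by (rule cancel_left[rotated 5]) simp_all
  moreover have "(cid ?i \<star> blun M ?i) \<bullet> bass M ?i ?i ?i = brun M ?i \<star> cid ?i"
    by (rule bicat_triangle) auto
  ultimately show "blun M ?i \<star> cid (one (src M (cdom M (blun M ?i)))) =
      brun M ?i \<star> cid (one (src M (cdom M (blun M ?i))))"
    using blun_comp[of ?i ?i] by simp
qed auto

section \<open>Composites of paths\<close>

fun composable :: "'a list \<Rightarrow> bool" where
  "composable [] \<longleftrightarrow> True"
| "composable (f # fs) \<longleftrightarrow> f \<in> Ar M \<and> (fs \<noteq> [] \<longrightarrow> src M f = trg M (hd fs)) \<and> composable fs"

lemma composable_append [simp]:
  "composable (fs @ gs) \<longleftrightarrow> composable fs \<and> composable gs \<and>
    (fs \<noteq> [] \<and> gs \<noteq> [] \<longrightarrow> src M (last fs) = trg M (hd gs))"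
  by (induction fs) auto

lemma pth_Cons: "fs \<noteq> [] ==> pth (f # fs) = f \<odot> pth fs"
  by (cases fs) auto

lemma pth_arrow [simp]:
  assumes "fs \<noteq> []" "composable fs"
  shows "pth fs \<in> Ar M" (is ?A1)
    "src M (pth fs) = src M (last fs)" (is ?A2)
    "trg M (pth fs) = trg M (hd fs)" (is ?A3)
proof -
  have "?A1 \<and> ?A2 \<and> ?A3"
    using assms
  proof (induction fs)
    case (Cons f fs)
    then show ?case by (cases "fs = []") (auto simp: pth_Cons)
  qed simp
  then show ?A1 ?A2 ?A3
    by auto
qed

lemma composable_ends [simp]:
  "composable fs ==> fs \<noteq> [] ==> hd fs \<in> Ar M"
  "composable fs ==> fs \<noteq> [] ==> last fs \<in> Ar M"
  by (induction fs) auto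

lemma join_Cons:
  "ps \<noteq> [] ==> join (f # ps) vs = (cid f \<star> join ps vs) \<bullet> bass M f (pth ps) (pth vs)"
  by (cases ps) auto

lemma join_cell [simp]:
  assumes "ps \<noteq> []" "vs \<noteq> []" "composable ps" "composable vs" "src M (last ps) = trg M (hd vs)"
  shows "invertible (join ps vs)" (is ?A1) "join ps vs \<in> Ce M" (is ?A2)
    "cdom M (join ps vs) = pth ps \<odot> pth vs" (is ?A3) "ccod M (join ps vs) = pth (ps @ vs)" (is ?A4)
proof -
  have "?A1 \<and> ?A3 \<and> ?A4"
    using assms
  proof (induction ps)
    case (Cons f ps)
    then show ?case by (cases "ps = []") (auto simp: pth_Cons join_Cons invertible_in)
  qed simp
  then show ?A1 ?A2 ?A3 ?A4
    by (auto simp: invertible_in)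
qed

text \<open>All rebracketings of a composite of three paths agree. The induction on the first path uses one
  pentagon for each of its entries.\<close>

lemma join_assoc:
  assumes "ps \<noteq> []" "qs \<noteq> []" "vs \<noteq> []" "composable ps" "composable qs" "composable vs"
    "src M (last ps) = trg M (hd qs)" "src M (last qs) = trg M (hd vs)"
  shows "join (ps @ qs) vs \<bullet> (join ps qs \<star> cid (pth vs)) =
    join ps (qs @ vs) \<bullet> (cid (pth ps) \<star> join qs vs) \<bullet> bass M (pth ps) (pth qs) (pth vs)"
  using assms
proof (induction ps)
  case (Cons f ps)
  show ?case
  proof (cases "ps = []")
    case True
    then show ?thesis using Cons.prems by (simp add: join_Cons)
  next
    case False
    note [simp] = Cons.prems False
    have f[simp]: "f \<in> Ar M" "composable ps" "src M f = trg M (hd ps)" "src M (last ps) = trg M (hd qs)"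
      using Cons.prems False by auto
    have IH: "join (ps @ qs) vs \<bullet> (join ps qs \<star> cid (pth vs)) =
      join ps (qs @ vs) \<bullet> (cid (pth ps) \<star> join qs vs) \<bullet> bass M (pth ps) (pth qs) (pth vs)"
      by (rule Cons.IH) auto
    let ?b = "bass M f (pth ps) (pth qs) \<star> cid (pth vs)"
    let ?X = "bass M f (pth ps \<odot> pth qs) (pth vs) \<bullet> ?b"
    have "join ((f # ps) @ qs) vs \<bullet> (join (f # ps) qs \<star> cid (pth vs)) =
      (cid f \<star> join (ps @ qs) vs) \<bullet> (bass M f (pth (ps @ qs)) (pth vs) \<bullet>
        ((cid f \<star> join ps qs) \<star> cid (pth vs))) \<bullet> ?b"
      by (simp add: join_Cons hcomp_interchange vassoc)
    also have "bass M f (pth (ps @ qs)) (pth vs) \<bullet> ((cid f \<star> join ps qs) \<star> cid (pth vs)) =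
       (cid f \<star> (join ps qs \<star> cid (pth vs))) \<bullet> bass M f (pth ps \<odot> pth qs) (pth vs)"
      using bass_nat[of "cid f" "join ps qs" "cid (pth vs)"] by simp
    also have "(cid f \<star> join (ps @ qs) vs) \<bullet> (\<dots>) \<bullet> ?b =
       (cid f \<star> (join (ps @ qs) vs \<bullet> (join ps qs \<star> cid (pth vs)))) \<bullet> ?X"
      by (simp add: vassoc[symmetric] hcomp_interchange)
    also have "\<dots> = (cid f \<star> (join ps (qs @ vs) \<bullet> (cid (pth ps) \<star> join qs vs))) \<bullet>
        ((cid f \<star> bass M (pth ps) (pth qs) (pth vs)) \<bullet> ?X)"
      unfolding IH by (simp add: vassoc[symmetric] hcomp_interchange)
    also have "(cid f \<star> bass M (pth ps) (pth qs) (pth vs)) \<bullet> ?X =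
        bass M f (pth ps) (pth qs \<odot> pth vs) \<bullet> bass M (f \<odot> pth ps) (pth qs) (pth vs)"
      by (rule bicat_pentagon) auto
    also have "(cid f \<star> (join ps (qs @ vs) \<bullet> (cid (pth ps) \<star> join qs vs))) \<bullet> \<dots> =
       (cid f \<star> join ps (qs @ vs)) \<bullet> ((cid f \<star> (cid (pth ps) \<star> join qs vs)) \<bullet>
        bass M f (pth ps) (pth qs \<odot> pth vs)) \<bullet> bass M (f \<odot> pth ps) (pth qs) (pth vs)"
      by (simp add: vassoc[symmetric] hcomp_interchange)
    also have "(cid f \<star> (cid (pth ps) \<star> join qs vs)) \<bullet> bass M f (pth ps) (pth qs \<odot> pth vs) =
       bass M f (pth ps) (pth (qs @ vs)) \<bullet> ((cid (f \<odot> pth ps)) \<star> join qs vs)"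
      using bass_nat[of "cid f" "cid (pth ps)" "join qs vs"] by simp
    finally show ?thesis by (simp add: join_Cons pth_Cons vassoc)
  qed
qed simp

section \<open>Horizontal composition of pasting cells\<close>

definition psrc :: "('a, 'c) pcell \<Rightarrow> 'a list" where "psrc P = fst P"
definition ptrg :: "('a, 'c) pcell \<Rightarrow> 'a list" where "ptrg P = snd (snd P)"

text \<open>Only cells between the composites of two nonempty composable paths are pasting cells in earnest;
  that the two paths have the same ends then follows, since cells are globular.\<close>

definition valid :: "('a, 'c) pcell \<Rightarrow> bool" where
  "valid P \<longleftrightarrow> psrc P \<noteq> [] \<and> ptrg P \<noteq> [] \<and> composable (psrc P) \<and> composable (ptrg P) \<and>
    \<guillemotleft>pcell_cell P : pth (psrc P) \<Rightarrow> pth (ptrg P)\<guillemotright>"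

lemma pcell_eqI: "psrc P = psrc Q ==> pcell_cell P = pcell_cell Q ==> ptrg P = ptrg Q ==> P = Q"
  by (cases P; cases Q) (auto simp: psrc_def ptrg_def pcell_cell_def)

lemma pcell_sel [simp]:
  "psrc (ps, \<theta>, qs) = ps" "ptrg (ps, \<theta>, qs) = qs" "pcell_cell (ps, \<theta>, qs) = \<theta>"
  by (auto simp: psrc_def ptrg_def pcell_cell_def)

lemma valid_ends:
  assumes "valid P"
  shows "src M (last (ptrg P)) = src M (last (psrc P))" "trg M (hd (ptrg P)) = trg M (hd (psrc P))"
  using assms unfolding valid_def by (metis pth_arrow(2,3) cell_simps(3,4))+

lemma validD [simp]:
  assumes "valid P"
  shows "psrc P \<noteq> []" "ptrg P \<noteq> []" "composable (psrc P)" "composable (ptrg P)"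
    "pcell_cell P \<in> Ce M" "cdom M (pcell_cell P) = pth (psrc P)" "ccod M (pcell_cell P) = pth (ptrg P)"
    "src M (last (ptrg P)) = src M (last (psrc P))" "trg M (hd (ptrg P)) = trg M (hd (psrc P))"
  using assms valid_ends unfolding valid_def by auto

lemma validI:
  "ps \<noteq> [] ==> qs \<noteq> [] ==> composable ps ==> composable qs ==> \<theta> \<in> Ce M ==>
   cdom M \<theta> = pth ps ==> ccod M \<theta> = pth qs ==> valid (ps, \<theta>, qs)"
  unfolding valid_def by simp

definition pident :: "'a list \<Rightarrow> ('a, 'c) pcell" where "pident ps = (ps, cid (pth ps), ps)"

lemma pident_sel [simp]: "psrc (pident ps) = ps" "ptrg (pident ps) = ps" "pcell_cell (pident ps) = cid (pth ps)"
  by (auto simp: pident_def)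

lemma valid_pident [simp]: "valid (pident ps) \<longleftrightarrow> ps \<noteq> [] \<and> composable ps"
  unfolding valid_def by auto

lemma pvcomp_sel [simp]:
  "psrc (P \<Zsemi> Q) = psrc P" "ptrg (P \<Zsemi> Q) = ptrg Q"
  "pcell_cell (P \<Zsemi> Q) = pcell_cell Q \<bullet> pcell_cell P"
  by (cases P; cases Q; simp)+

lemma valid_pvcomp: "valid P ==> valid Q ==> ptrg P = psrc Q ==> valid (P \<Zsemi> Q)"
  unfolding valid_def by simp

text \<open>The horizontal composition of the strict 2-category of paths. It is strictly associative because
  the isomorphisms \<open>join\<close> by which \<open>\<star>\<close> is conjugated are coherent.\<close>

definition phcomp :: "('a, 'c) pcell \<Rightarrow> ('a, 'c) pcell \<Rightarrow> ('a, 'c) pcell" where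
  "phcomp P Q = (psrc P @ psrc Q,
     join (ptrg P) (ptrg Q) \<bullet> (pcell_cell P \<star> pcell_cell Q) \<bullet> cinv (join (psrc P) (psrc Q)),
     ptrg P @ ptrg Q)"

lemma phcomp_sel [simp]: "psrc (phcomp P Q) = psrc P @ psrc Q" "ptrg (phcomp P Q) = ptrg P @ ptrg Q"
  unfolding phcomp_def by auto

lemma valid_phcomp [simp]:
  assumes "valid P" "valid Q" "src M (last (psrc P)) = trg M (hd (psrc Q))"
  shows "valid (phcomp P Q)"
  using assms unfolding valid_def[of "phcomp P Q"] by (simp add: phcomp_def)

lemma phcomp_cell:
  assumes "valid P" "valid Q" "src M (last (psrc P)) = trg M (hd (psrc Q))"
  shows "pcell_cell (phcomp P Q) \<bullet> join (psrc P) (psrc Q) = join (ptrg P) (ptrg Q) \<bullet> (pcell_cell P \<star> pcell_cell Q)"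
  using assms by (simp add: phcomp_def vassoc)

lemma phcomp_cell_ext:
  assumes "valid P" "valid Q" "src M (last (psrc P)) = trg M (hd (psrc Q))"
    and "\<phi> \<in> Ce M" "ccod M \<phi> = pth (psrc P) \<odot> pth (psrc Q)"
  shows "pcell_cell (phcomp P Q) \<bullet> (join (psrc P) (psrc Q) \<bullet> \<phi>) =
    join (ptrg P) (ptrg Q) \<bullet> ((pcell_cell P \<star> pcell_cell Q) \<bullet> \<phi>)"
  using vext[OF phcomp_cell[OF assms(1-3)]] assms validD[OF valid_phcomp[OF assms(1-3)]] by simp

text \<open>Horizontal composites are characterized by an equation free of inverses, which is easier to
  verify than an equality with the definition.\<close>

lemma phcomp_eqI:
  assumes "valid P" "valid Q" "src M (last (psrc P)) = trg M (hd (psrc Q))"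
    and "valid S" "psrc S = psrc P @ psrc Q" "ptrg S = ptrg P @ ptrg Q"
    "pcell_cell S \<bullet> join (psrc P) (psrc Q) = join (ptrg P) (ptrg Q) \<bullet> (pcell_cell P \<star> pcell_cell Q)"
  shows "S = phcomp P Q"
proof (rule pcell_eqI)
  have "pcell_cell S \<bullet> join (psrc P) (psrc Q) = pcell_cell (phcomp P Q) \<bullet> join (psrc P) (psrc Q)"
    unfolding assms(7) phcomp_cell[OF assms(1-3)] ..
  then show "pcell_cell S = pcell_cell (phcomp P Q)"
    by (rule cancel_right[rotated 5])
      (use assms(1-6) validD[OF valid_phcomp[OF assms(1-3)]] in simp_all)
qed (use assms in auto)

lemma phcomp_pident:
  assumes "ps \<noteq> []" "qs \<noteq> []" "composable (ps @ qs)"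
  shows "phcomp (pident ps) (pident qs) = pident (ps @ qs)"
  by (rule phcomp_eqI[symmetric]) (use assms in auto)

text \<open>The interchange law.\<close>

lemma phcomp_pvcomp:
  assumes "valid P" "valid P'" "valid Q" "valid Q'" "ptrg P = psrc P'" "ptrg Q = psrc Q'"
    and "src M (last (psrc P)) = trg M (hd (psrc Q))"
  shows "phcomp (P \<Zsemi> P') (Q \<Zsemi> Q') = phcomp P Q \<Zsemi> phcomp P' Q'"
proof (rule phcomp_eqI[symmetric])
  have b: "src M (last (psrc P')) = trg M (hd (psrc Q'))"
    using assms by (metis valid_ends)
  have "pcell_cell (phcomp P Q \<Zsemi> phcomp P' Q') \<bullet> join (psrc P) (psrc Q) =
     pcell_cell (phcomp P' Q') \<bullet> (pcell_cell (phcomp P Q) \<bullet> join (psrc P) (psrc Q))"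
    using assms b validD[OF valid_phcomp[OF assms(1,3,7)]] validD[OF valid_phcomp[OF assms(2,4) b]]
    by (simp add: vassoc)
  also have "\<dots> = (pcell_cell (phcomp P' Q') \<bullet> join (psrc P') (psrc Q')) \<bullet> (pcell_cell P \<star> pcell_cell Q)"
    using assms b validD[OF valid_phcomp[OF assms(1,3,7)]] validD[OF valid_phcomp[OF assms(2,4) b]]
    by (simp add: phcomp_cell phcomp_cell_ext vassoc)
  also have "\<dots> = join (ptrg P') (ptrg Q') \<bullet> ((pcell_cell P' \<bullet> pcell_cell P) \<star> (pcell_cell Q' \<bullet> pcell_cell Q))"
    using assms b by (simp add: phcomp_cell phcomp_cell_ext vassoc hcomp_interchange)
  finally show "pcell_cell (phcomp P Q \<Zsemi> phcomp P' Q') \<bullet> join (psrc (P \<Zsemi> P')) (psrc (Q \<Zsemi> Q')) =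
     join (ptrg (P \<Zsemi> P')) (ptrg (Q \<Zsemi> Q')) \<bullet> (pcell_cell (P \<Zsemi> P') \<star> pcell_cell (Q \<Zsemi> Q'))"
    using assms by simp
  show "valid (phcomp P Q \<Zsemi> phcomp P' Q')" using assms b by (simp add: valid_pvcomp)
qed (use assms in \<open>auto simp: valid_pvcomp\<close>)

lemma phcomp_assoc:
  assumes P: "valid P" and Q: "valid Q" and S: "valid S"
    and a: "src M (last (psrc P)) = trg M (hd (psrc Q))" "src M (last (psrc Q)) = trg M (hd (psrc S))"
  shows "phcomp (phcomp P Q) S = phcomp P (phcomp Q S)"
proof (rule phcomp_eqI)
  note [simp] = assms
  have v1 [simp]: "valid (phcomp P Q)" "valid (phcomp Q S)" by auto
  have v2 [simp]: "valid (phcomp (phcomp P Q) S)" by simp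
  note [simp] = validD(5-7)[OF v1(1), simplified] validD(5-7)[OF v1(2), simplified] validD(5-7)[OF v2, simplified]
  let ?j = "join (psrc P @ psrc Q) (psrc S) \<bullet> (join (psrc P) (psrc Q) \<star> cid (pth (psrc S)))"
  let ?p = "pcell_cell P" and ?q = "pcell_cell Q" and ?s = "pcell_cell S"
  let ?b = "cinv (bass M (pth (psrc P)) (pth (psrc Q)) (pth (psrc S)))"
  have "pcell_cell (phcomp (phcomp P Q) S) \<bullet> ?j = join (ptrg P @ ptrg Q) (ptrg S) \<bullet>
      (pcell_cell (phcomp P Q) \<star> ?s) \<bullet> (join (psrc P) (psrc Q) \<star> cid (pth (psrc S)))"
    using phcomp_cell[of "phcomp P Q" S] by (simp add: vassoc[symmetric])
  also have "\<dots> = join (ptrg P @ ptrg Q) (ptrg S) \<bullet> ((join (ptrg P) (ptrg Q) \<bullet> (?p \<star> ?q)) \<star> ?s)"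
    by (simp add: hcomp_interchange phcomp_cell)
  also have "\<dots> = (join (ptrg P @ ptrg Q) (ptrg S) \<bullet> (join (ptrg P) (ptrg Q) \<star> cid (pth (ptrg S)))) \<bullet> ((?p \<star> ?q) \<star> ?s)"
    by (simp add: vassoc hcomp_interchange)
  also have "\<dots> = (join (ptrg P) (ptrg Q @ ptrg S) \<bullet> (cid (pth (ptrg P)) \<star> join (ptrg Q) (ptrg S))) \<bullet>
      (bass M (pth (ptrg P)) (pth (ptrg Q)) (pth (ptrg S)) \<bullet> ((?p \<star> ?q) \<star> ?s))"
    by (subst join_assoc) (simp_all add: vassoc)
  also have "bass M (pth (ptrg P)) (pth (ptrg Q)) (pth (ptrg S)) \<bullet> ((?p \<star> ?q) \<star> ?s) =
      (?p \<star> (?q \<star> ?s)) \<bullet> bass M (pth (psrc P)) (pth (psrc Q)) (pth (psrc S))"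
    using bass_nat[of ?p ?q ?s] by simp
  finally have "(pcell_cell (phcomp (phcomp P Q) S) \<bullet> ?j) \<bullet> ?b = ((join (ptrg P) (ptrg Q @ ptrg S) \<bullet> (cid (pth (ptrg P)) \<star> join (ptrg Q) (ptrg S))) \<bullet>
      ((?p \<star> (?q \<star> ?s)) \<bullet> bass M (pth (psrc P)) (pth (psrc Q)) (pth (psrc S)))) \<bullet> ?b"
    by simp
  also have "\<dots> = join (ptrg P) (ptrg Q @ ptrg S) \<bullet> (cid (pth (ptrg P)) \<star> join (ptrg Q) (ptrg S)) \<bullet> (?p \<star> (?q \<star> ?s))"
    by (simp add: vassoc)
  also have "\<dots> = join (ptrg P) (ptrg Q @ ptrg S) \<bullet> (?p \<star> (pcell_cell (phcomp Q S) \<bullet> join (psrc Q) (psrc S)))"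
    by (simp add: phcomp_cell hcomp_interchange)
  also have "\<dots> = (join (ptrg P) (ptrg Q @ ptrg S) \<bullet> (?p \<star> pcell_cell (phcomp Q S))) \<bullet> (cid (pth (psrc P)) \<star> join (psrc Q) (psrc S))"
    by (simp add: vassoc hcomp_interchange)
  finally have 1: "(pcell_cell (phcomp (phcomp P Q) S) \<bullet> ?j) \<bullet> ?b = \<dots>" .
  have "(pcell_cell (phcomp (phcomp P Q) S) \<bullet> ?j) \<bullet> ?b =
    (pcell_cell (phcomp (phcomp P Q) S) \<bullet> join (psrc P) (psrc Q @ psrc S)) \<bullet> (cid (pth (psrc P)) \<star> join (psrc Q) (psrc S))"
    by (subst join_assoc) (simp_all add: vassoc)
  with 1 have 2: "(pcell_cell (phcomp (phcomp P Q) S) \<bullet> join (psrc P) (psrc Q @ psrc S)) \<bullet> (cid (pth (psrc P)) \<star> join (psrc Q) (psrc S)) =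
    (join (ptrg P) (ptrg Q @ ptrg S) \<bullet> (?p \<star> pcell_cell (phcomp Q S))) \<bullet> (cid (pth (psrc P)) \<star> join (psrc Q) (psrc S))"
    by simp
  show "pcell_cell (phcomp (phcomp P Q) S) \<bullet> join (psrc P) (psrc (phcomp Q S)) = join (ptrg P) (ptrg (phcomp Q S)) \<bullet> (?p \<star> pcell_cell (phcomp Q S))"
    using cancel_right[OF _ _ _ _ _ 2] by simp
qed (use assms in auto)

section \<open>Whiskering\<close>

text \<open>Since there are no empty pasting cells, whiskering by an empty path is treated apart.\<close>

definition lwhisk :: "'a list \<Rightarrow> ('a, 'c) pcell \<Rightarrow> ('a, 'c) pcell" where
  "lwhisk us P = (if us = [] then P else phcomp (pident us) P)"

definition rwhisk :: "('a, 'c) pcell \<Rightarrow> 'a list \<Rightarrow> ('a, 'c) pcell" where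
  "rwhisk P vs = (if vs = [] then P else phcomp P (pident vs))"

lemma lwhisk_rwhisk_sel [simp]:
  "psrc (lwhisk us P) = us @ psrc P" "ptrg (lwhisk us P) = us @ ptrg P"
  "psrc (rwhisk P vs) = psrc P @ vs" "ptrg (rwhisk P vs) = ptrg P @ vs"
  unfolding lwhisk_def rwhisk_def by auto

lemma valid_lwhisk [simp]: "valid P ==> composable (us @ psrc P) ==> valid (lwhisk us P)"
  unfolding lwhisk_def by auto

lemma valid_rwhisk [simp]: "valid P ==> composable (psrc P @ vs) ==> valid (rwhisk P vs)"
  unfolding rwhisk_def by auto

lemma lwhisk_lwhisk: "valid P ==> composable (us @ us' @ psrc P) ==> lwhisk us (lwhisk us' P) = lwhisk (us @ us') P"
  unfolding lwhisk_def by (auto simp: phcomp_assoc[symmetric] phcomp_pident)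

lemma rwhisk_rwhisk: "valid P ==> composable (psrc P @ vs @ vs') ==> rwhisk (rwhisk P vs) vs' = rwhisk P (vs @ vs')"
  unfolding rwhisk_def by (auto simp: phcomp_assoc phcomp_pident)

lemma lwhisk_rwhisk: "valid P ==> composable (us @ psrc P @ vs) ==> lwhisk us (rwhisk P vs) = rwhisk (lwhisk us P) vs"
  unfolding lwhisk_def rwhisk_def by (auto simp: phcomp_assoc)

lemma pident_pvcomp_pident: "ps \<noteq> [] ==> composable ps ==> pident ps \<Zsemi> pident ps = pident ps"
  unfolding pident_def by simp

lemma pident_left: "valid P ==> psrc P = ps ==> pident ps \<Zsemi> P = P"
  by (rule pcell_eqI) auto

lemma pident_right: "valid P ==> ptrg P = ps ==> P \<Zsemi> pident ps = P"
  by (rule pcell_eqI) auto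

lemma lwhisk_pvcomp: "valid P ==> valid Q ==> ptrg P = psrc Q ==> composable (us @ psrc P) ==>
    lwhisk us (P \<Zsemi> Q) = lwhisk us P \<Zsemi> lwhisk us Q"
  unfolding lwhisk_def by (auto simp: phcomp_pvcomp[symmetric] pident_pvcomp_pident)

lemma rwhisk_pvcomp: "valid P ==> valid Q ==> ptrg P = psrc Q ==> composable (psrc P @ vs) ==>
    rwhisk (P \<Zsemi> Q) vs = rwhisk P vs \<Zsemi> rwhisk Q vs"
  unfolding rwhisk_def by (auto simp: phcomp_pvcomp[symmetric] pident_pvcomp_pident)

lemma rwhisk_lwhisk_interchange:
  assumes [simp]: "valid P" "valid Q" "src M (last (psrc P)) = trg M (hd (psrc Q))"
  shows "rwhisk P (psrc Q) \<Zsemi> lwhisk (ptrg P) Q = lwhisk (psrc P) Q \<Zsemi> rwhisk P (ptrg Q)"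
  unfolding lwhisk_def rwhisk_def by (simp add: phcomp_pvcomp[symmetric] pident_left pident_right)

lemma whisk_right_rwhisk: "valid P ==> composable (psrc P @ vs) ==> whisk_right P vs = rwhisk P vs"
  unfolding rwhisk_def phcomp_def by (cases P; cases vs) auto

lemma foldr_whisk_left: "valid P ==> composable (us @ psrc P) ==> foldr whisk_left us P = lwhisk us P"
proof (induction us)
  case (Cons f us)
  let ?P = "lwhisk us P"
  have v: "valid ?P" using Cons.prems by auto
  have c: "src M f = trg M (hd (psrc ?P))" using Cons.prems by (auto simp: hd_append)
  have "foldr whisk_left (f # us) P = whisk_left f ?P"
    using Cons by simp
  also have "\<dots> = phcomp (pident [f]) ?P"
  proof (rule pcell_eqI)
    show "pcell_cell (whisk_left f ?P) = pcell_cell (phcomp (pident [f]) ?P)"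
      using validD[OF v] c Cons.prems by (cases ?P) (auto simp: phcomp_def simp del: lwhisk_rwhisk_sel)
  qed (cases ?P, simp)+
  also have "\<dots> = lwhisk [f] ?P" by (simp add: lwhisk_def)
  also have "\<dots> = lwhisk (f # us) P" using Cons.prems by (subst lwhisk_lwhisk) auto
  finally show ?case .
qed (simp add: lwhisk_def)

text \<open>The whiskering by which pasting diagrams are written is horizontal composition with identities,
  so that it inherits the laws of a strict 2-category.\<close>

lemma whisk_eq: "valid P ==> composable (us @ psrc P @ vs) ==> us \<lhd> P \<rhd> vs = lwhisk us (rwhisk P vs)"
  unfolding whisk_def by (simp add: whisk_right_rwhisk foldr_whisk_left)

section \<open>The strict calculus of pasting cells\<close>

text \<open>The empty path is the source of no valid pasting cell.\<close>

definition ill_formed :: "('a, 'c) pcell" where "ill_formed = ([], undefined, [])"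

definition paste :: "('a, 'c) pcell \<Rightarrow> ('a, 'c) pcell \<Rightarrow> ('a, 'c) pcell" (infixr ";;" 52) where
  "P ;; Q = (if valid P \<and> valid Q \<and> ptrg P = psrc Q then P \<Zsemi> Q else ill_formed)"

definition wh :: "'a list \<Rightarrow> ('a, 'c) pcell \<Rightarrow> 'a list \<Rightarrow> ('a, 'c) pcell" where
  "wh us P vs = (if valid P \<and> composable (us @ psrc P @ vs) then us \<lhd> P \<rhd> vs else ill_formed)"

lemma not_valid_ill_formed [simp]: "\<not> valid ill_formed"
  unfolding ill_formed_def valid_def by simp

lemma valid_paste [simp]: "valid (P ;; Q) \<longleftrightarrow> valid P \<and> valid Q \<and> ptrg P = psrc Q"
  unfolding paste_def by (auto simp: valid_pvcomp)

lemma paste_sel [simp]: "valid P ==> valid Q ==> ptrg P = psrc Q ==> psrc (P ;; Q) = psrc P"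
  "valid P ==> valid Q ==> ptrg P = psrc Q ==> ptrg (P ;; Q) = ptrg Q"
  "valid P ==> valid Q ==> ptrg P = psrc Q ==> pcell_cell (P ;; Q) = pcell_cell Q \<bullet> pcell_cell P"
  unfolding paste_def by auto

lemma paste_ill_formed [simp]: "P ;; ill_formed = ill_formed" "ill_formed ;; P = ill_formed"
  unfolding paste_def by auto

lemma paste_assoc: "(P ;; Q) ;; S = P ;; (Q ;; S)"
proof (cases "valid P \<and> valid Q \<and> valid S \<and> ptrg P = psrc Q \<and> ptrg Q = psrc S")
  case True
  then show ?thesis by (intro pcell_eqI) (simp_all add: vassoc)
next
  case False
  then show ?thesis unfolding paste_def[of "P ;; Q"] paste_def[of P "Q ;; S"] by auto
qed

lemma paste_ext: "P ;; Q = P' ;; Q' ==> P ;; (Q ;; S) = P' ;; (Q' ;; S)"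
  by (metis paste_assoc)

lemma pvcomp_paste: "valid P ==> valid Q ==> ptrg P = psrc Q ==> P \<Zsemi> Q = P ;; Q"
  unfolding paste_def by simp

lemma whisk_wh: "valid P ==> composable (us @ psrc P @ vs) ==> us \<lhd> P \<rhd> vs = wh us P vs"
  unfolding wh_def by simp

lemma wh_eq: "valid P ==> composable (us @ psrc P @ vs) ==> wh us P vs = lwhisk us (rwhisk P vs)"
  unfolding wh_def by (simp add: whisk_eq del: composable_append)

lemma valid_wh [simp]: "valid (wh us P vs) \<longleftrightarrow> valid P \<and> composable (us @ psrc P @ vs)"
proof (cases "valid P \<and> composable (us @ psrc P @ vs)")
  case True
  then show ?thesis by (subst wh_eq) auto
qed (auto simp: wh_def)

lemma wh_sel [simp]:
  "valid P ==> composable (us @ psrc P @ vs) ==> psrc (wh us P vs) = us @ psrc P @ vs"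
  "valid P ==> composable (us @ psrc P @ vs) ==> ptrg (wh us P vs) = us @ ptrg P @ vs"
  by (simp_all add: wh_eq del: composable_append)

text \<open>A pasting cell replaces a segment of a path by one with the same ends.\<close>

lemma composable_replace:
  "valid P ==> composable (us @ psrc P @ vs) \<longleftrightarrow> composable (us @ ptrg P @ vs)"
  by auto

text \<open>Both sides are ill-formed under the same conditions; this is what makes the equation, and
  likewise \<open>wh_paste\<close> and \<open>wh_interchange\<close>, hold without premises.\<close>

lemma wh_wh [simp]: "wh us (wh us' P vs') vs = wh (us @ us') P (vs' @ vs)"
proof (cases "valid P \<and> composable (us @ us' @ psrc P @ vs' @ vs)")
  case True
  then have "wh us (wh us' P vs') vs = lwhisk us (rwhisk (lwhisk us' (rwhisk P vs')) vs)"
    by (subst wh_eq) (auto simp: wh_eq)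
  also have "\<dots> = lwhisk us (lwhisk us' (rwhisk (rwhisk P vs') vs))"
    using True by (subst lwhisk_rwhisk[of _ us']) auto
  also have "\<dots> = lwhisk (us @ us') (rwhisk P (vs' @ vs))"
    using True by (auto simp: lwhisk_lwhisk rwhisk_rwhisk)
  finally show ?thesis using True by (subst wh_eq) auto
next
  case False
  then have "\<not> valid (wh us' P vs') \<or> \<not> composable (us @ psrc (wh us' P vs') @ vs)"
    by (cases "valid (wh us' P vs')") auto
  then have "wh us (wh us' P vs') vs = ill_formed"
    unfolding wh_def[of us] by presburger
  moreover have "wh (us @ us') P (vs' @ vs) = ill_formed"
    unfolding wh_def using False unfolding append_assoc by presburger
  ultimately show ?thesis by simp
qed

lemma wh_nil [simp]: "valid P ==> wh [] P [] = P"
  by (subst wh_eq) (auto simp: lwhisk_def rwhisk_def)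

lemma wh_ill_formed: "\<not> valid P ==> wh us P vs = ill_formed"
  unfolding wh_def by simp

lemma wh_paste: "wh us (P ;; Q) vs = wh us P vs ;; wh us Q vs"
proof (cases "valid P \<and> valid Q \<and> ptrg P = psrc Q \<and> composable (us @ psrc P @ vs)")
  case True
  then have c: "composable (us @ psrc Q @ vs)" using composable_replace by metis
  have "wh us (P ;; Q) vs = lwhisk us (rwhisk (P \<Zsemi> Q) vs)"
    using True by (subst wh_eq) (auto simp: paste_def valid_pvcomp)
  also have "\<dots> = lwhisk us (rwhisk P vs) \<Zsemi> lwhisk us (rwhisk Q vs)"
    using True c by (simp add: rwhisk_pvcomp lwhisk_pvcomp)
  also have "\<dots> = wh us P vs \<Zsemi> wh us Q vs"
    using True c by (simp add: wh_eq del: composable_append)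
  also have "\<dots> = wh us P vs ;; wh us Q vs"
    using True c by (intro pvcomp_paste) (auto simp del: composable_append)
  finally show ?thesis .
next
  case False
  have "wh us (P ;; Q) vs = ill_formed"
    using False by (cases "valid (P ;; Q)") (auto simp: wh_def)
  moreover have "\<not> valid (wh us P vs ;; wh us Q vs)"
  proof
    assume "valid (wh us P vs ;; wh us Q vs)"
    then have "valid P" "valid Q" "composable (us @ psrc P @ vs)" "composable (us @ psrc Q @ vs)"
       "ptrg (wh us P vs) = psrc (wh us Q vs)"
      by (auto simp del: composable_append)
    then show False using False by (simp del: composable_append)
  qed
  ultimately show ?thesis unfolding paste_def by (auto simp: valid_pvcomp)
qed

text \<open>Rewritings of disjoint segments of a path commute.\<close>

lemma wh_interchange:
  "wh us P (ms @ psrc Q @ vs) ;; wh (us @ ptrg P @ ms) Q vs =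
   wh (us @ psrc P @ ms) Q vs ;; wh us P (ms @ ptrg Q @ vs)"
proof (cases "valid P \<and> valid Q \<and> composable (us @ psrc P @ ms @ psrc Q @ vs)")
  case True
  define P' where "P' = wh [] P ms"
  have P': "valid P'" "psrc P' = psrc P @ ms" "ptrg P' = ptrg P @ ms"
    using True by (auto simp: P'_def)
  have e: "src M (last (psrc P')) = trg M (hd (psrc Q))"
    using True P' by (cases "ms = []") auto
  have "wh [] P' (psrc Q) ;; wh (ptrg P') Q [] = wh (psrc P') Q [] ;; wh [] P' (ptrg Q)"
    using rwhisk_lwhisk_interchange[OF P'(1) _ e] True P'(1) e validD[OF P'(1)]
    by (simp add: paste_def wh_eq) (simp add: lwhisk_def rwhisk_def)
  then have "wh us (wh [] P' (psrc Q) ;; wh (ptrg P') Q []) vs = wh us (wh (psrc P') Q [] ;; wh [] P' (ptrg Q)) vs"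
    by simp
  then show ?thesis unfolding wh_paste P' unfolding P'_def by simp
next
  case False
  then consider "\<not> valid P" | "\<not> valid Q" | "\<not> composable (us @ psrc P @ ms @ psrc Q @ vs)"
    by blast
  then show ?thesis
  proof cases
    case 3
    then have "wh us P (ms @ psrc Q @ vs) = ill_formed" "wh (us @ psrc P @ ms) Q vs = ill_formed"
      unfolding wh_def append_assoc by presburger+
    then show ?thesis by simp
  qed (simp_all add: wh_ill_formed)
qed

lemma wh_pident: "ps \<noteq> [] ==> composable (us @ ps @ vs) ==> wh us (pident ps) vs = pident (us @ ps @ vs)"
  by (subst wh_eq) (auto simp: lwhisk_def rwhisk_def phcomp_pident)

lemma pident_paste [simp]: "valid P ==> psrc P = ps ==> pident ps ;; P = P"
  unfolding paste_def by (auto simp: pident_left)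

lemma paste_pident [simp]: "valid P ==> ptrg P = ps ==> P ;; pident ps = P"
  unfolding paste_def by (auto simp: pident_right)

text \<open>Unfolded with \<open>paste_assoc\<close>, this turns an equation between two composites into a rule that
  rewrites them inside of a longer composite.\<close>

lemma paste_app: "P = Q ==> P ;; S = Q ;; S" by simp

lemma wh_cong: "P = Q ==> wh us P vs = wh us Q vs" by simp

lemmas wh_simps = wh_paste wh_wh append_Cons append_Nil

lemma pcell_cell_wh_left:
  assumes "valid P" "f \<in> Ar M" "src M f = trg M (hd (psrc P))"
  shows "pcell_cell (wh [f] P []) = cid f \<star> pcell_cell P"
  using assms by (simp add: wh_eq lwhisk_def rwhisk_def) (simp add: phcomp_def)

lemma pcell_cell_wh_right:
  assumes "valid P" "f \<in> Ar M" "src M (last (psrc P)) = trg M f" "length (psrc P) = 1" "length (ptrg P) = 1"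
  shows "pcell_cell (wh [] P [f]) = pcell_cell P \<star> cid f"
proof -
  obtain p q where "psrc P = [p]" "ptrg P = [q]"
    using assms(4,5) by (auto simp: length_Suc_conv)
  then show ?thesis
    using validD[OF assms(1)] assms by (simp add: wh_eq lwhisk_def rwhisk_def) (simp add: phcomp_def)
qed

section \<open>Invertible pasting cells\<close>

definition pinvertible :: "('a, 'c) pcell \<Rightarrow> bool" where
  "pinvertible P \<longleftrightarrow> valid P \<and> invertible (pcell_cell P)"

lemma pinv_sel [simp]: "psrc (pinv P) = ptrg P" "ptrg (pinv P) = psrc P" "pcell_cell (pinv P) = cinv (pcell_cell P)"
  by (cases P; simp)+

lemma pinvertible_valid: "pinvertible P ==> valid P"
  unfolding pinvertible_def by simp

lemma pinvertible_pinv [simp]: "pinvertible P ==> pinvertible (pinv P)"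
  unfolding pinvertible_def valid_def by simp

lemma valid_pinv [simp]: "pinvertible P ==> valid (pinv P)"
  using pinvertible_pinv pinvertible_valid by blast

lemma paste_pinv [simp]:
  assumes "pinvertible P"
  shows "P ;; pinv P = pident (psrc P)" "pinv P ;; P = pident (ptrg P)"
  using assms by (intro pcell_eqI; simp add: pinvertible_valid; simp add: pinvertible_def)+

lemma pinv_cancel [simp]:
  assumes "pinvertible P"
  shows "valid Q ==> psrc Q = psrc P ==> P ;; pinv P ;; Q = Q"
    "valid Q ==> psrc Q = ptrg P ==> pinv P ;; P ;; Q = Q"
  using assms by (simp_all add: paste_assoc[symmetric])

lemma paste_cancel_left:
  assumes "pinvertible P" "P ;; Q = P ;; Q'" "valid Q" "valid Q'" "psrc Q = ptrg P" "psrc Q' = ptrg P"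
  shows "Q = Q'"
proof -
  have "pinv P ;; P ;; Q = pinv P ;; P ;; Q'" using assms(2) by simp
  then show ?thesis using assms(1,3-6) by simp
qed

lemma pinv_unique:
  assumes "pinvertible P" "P ;; Q = pident (psrc P)" "valid Q" "psrc Q = ptrg P"
  shows "Q = pinv P"
  using assms by (auto intro!: paste_cancel_left[OF assms(1), of Q "pinv P"] simp: pinvertible_valid)

lemma pinvertible_pident [simp]: "ps \<noteq> [] ==> composable ps ==> pinvertible (pident ps)"
  unfolding pinvertible_def by simp

lemma pinvertible_phcomp:
  assumes "pinvertible P" "pinvertible Q" "src M (last (psrc P)) = trg M (hd (psrc Q))"
  shows "pinvertible (phcomp P Q)"
proof -
  have "valid P" "valid Q" "invertible (pcell_cell P)" "invertible (pcell_cell Q)"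
    using assms unfolding pinvertible_def by auto
  then show ?thesis using assms(3) unfolding pinvertible_def by (simp add: phcomp_def[of P Q]) (simp flip: phcomp_def)
qed

lemma pinvertible_wh [simp]:
  "pinvertible P ==> composable (us @ psrc P @ vs) ==> pinvertible (wh us P vs)"
  by (subst wh_eq) (auto simp: lwhisk_def rwhisk_def pinvertible_valid intro!: pinvertible_phcomp)

lemma wh_pinv:
  assumes "pinvertible P" "composable (us @ psrc P @ vs)"
  shows "wh us (pinv P) vs = pinv (wh us P vs)"
  using assms
  by (intro pinv_unique[where P="wh us P vs"]) (auto simp: wh_paste[symmetric] wh_pident pinvertible_valid)

lemma pinvertible_paste [simp]:
  assumes "pinvertible P" "pinvertible Q" "ptrg P = psrc Q"
  shows "pinvertible (P ;; Q)"
proof -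
  have "invertible (pcell_cell P)" "invertible (pcell_cell Q)" "valid P" "valid Q"
    using assms unfolding pinvertible_def by auto
  then show ?thesis using assms(3) unfolding pinvertible_def by simp
qed

lemma pinv_pinv [simp]: "pinvertible P ==> pinv (pinv P) = P"
  by (rule pcell_eqI) (simp_all add: pinvertible_def)

lemma pinv_paste:
  "pinvertible P ==> pinvertible Q ==> ptrg P = psrc Q ==> pinv (P ;; Q) = pinv Q ;; pinv P"
  by (rule pinv_unique[symmetric]) (simp_all add: paste_assoc pinvertible_valid)

lemma pinv_pident: "ps \<noteq> [] ==> composable ps ==> pinv (pident ps) = pident ps"
  by (rule pcell_eqI) auto

section \<open>Moving identity arrows along paths\<close>

text \<open>Removal of an identity arrow at the right and at the left end of a path. In this form both are
  visibly natural in the path; the lemmas \<open>runs_Cons\<close>, \<open>luns_Cons\<close> and \<open>luns_runs_middle\<close>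
  say that it does not matter at which entry an identity arrow is absorbed.\<close>

definition runs :: "'a list \<Rightarrow> ('a, 'c) pcell" where
  "runs ps = (ps @ [one (src M (last ps))],
    brun M (pth ps) \<bullet> cinv (join ps [one (src M (last ps))]), ps)"

definition luns :: "'a list \<Rightarrow> ('a, 'c) pcell" where
  "luns ps = (one (trg M (hd ps)) # ps, blun M (pth ps), ps)"

lemma runs_luns_sel [simp]:
  "psrc (runs ps) = ps @ [one (src M (last ps))]" "ptrg (runs ps) = ps"
  "psrc (luns ps) = one (trg M (hd ps)) # ps" "ptrg (luns ps) = ps"
  unfolding runs_def luns_def by auto

lemma pinvertible_runs [simp]: "ps \<noteq> [] ==> composable ps ==> pinvertible (runs ps)"
  unfolding pinvertible_def valid_def by (auto simp: runs_def invertible_in)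

lemma pinvertible_luns [simp]: "ps \<noteq> [] ==> composable ps ==> pinvertible (luns ps)"
  unfolding pinvertible_def valid_def by (auto simp: luns_def pth_Cons)

lemma valid_runs_luns [simp]:
  "ps \<noteq> [] ==> composable ps ==> valid (runs ps)"
  "ps \<noteq> [] ==> composable ps ==> valid (luns ps)"
  by (simp_all add: pinvertible_valid)

lemma runs_natural:
  assumes [simp]: "valid P" and X: "X = src M (last (psrc P))"
  shows "wh [] P [one X] ;; runs (ptrg P) = runs (psrc P) ;; P"
proof (rule pcell_eqI)
  let ?i = "one (src M (last (psrc P)))"
  have a: "wh [] P [one X] = phcomp P (pident [?i])"
    by (subst wh_eq) (auto simp: lwhisk_def rwhisk_def X)
  have [simp]: "valid (wh [] P [one X])" by (auto simp: X)
  show "pcell_cell (wh [] P [one X] ;; runs (ptrg P)) = pcell_cell (runs (psrc P) ;; P)"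
    using vassoc[of "brun M (pth (ptrg P))" "pcell_cell P \<star> cid ?i" "cinv (join (psrc P) [?i])"]
      brun_natural[of "pcell_cell P" "pth (psrc P)" "pth (ptrg P)"]
    by (simp add: X) (simp add: a[unfolded X] runs_def phcomp_def vassoc invertible_in)
qed (auto simp: X)

lemma luns_natural:
  assumes [simp]: "valid P" and X: "X = trg M (hd (psrc P))"
  shows "wh [one X] P [] ;; luns (ptrg P) = luns (psrc P) ;; P"
proof (rule pcell_eqI)
  let ?i = "one (trg M (hd (psrc P)))"
  have a: "wh [one X] P [] = phcomp (pident [?i]) P"
    by (subst wh_eq) (auto simp: lwhisk_def rwhisk_def X)
  show "pcell_cell (wh [one X] P [] ;; luns (ptrg P)) = pcell_cell (luns (psrc P) ;; P)"
    using blun_natural[of "pcell_cell P" "pth (psrc P)" "pth (ptrg P)"]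
    by (simp add: X) (simp add: a[unfolded X] luns_def phcomp_def)
qed (auto simp: X)

lemma runs_Cons:
  assumes [simp]: "composable (f # ps)" "ps \<noteq> []"
  shows "runs (f # ps) = wh [f] (runs ps) []"
proof (rule pcell_eqI)
  let ?i = "one (src M (last ps))"
  have [simp]: "f \<in> Ar M" "composable ps" "src M f = trg M (hd ps)" using assms by auto
  have a: "wh [f] (runs ps) [] = phcomp (pident [f]) (runs ps)"
    by (subst wh_eq) (auto simp: lwhisk_def rwhisk_def)
  have b: "brun M (f \<odot> pth ps) = (cid f \<star> brun M (pth ps)) \<bullet> bass M f (pth ps) ?i"
    using brun_comp[of f "pth ps"] by simp
  show "pcell_cell (runs (f # ps)) = pcell_cell (wh [f] (runs ps) [])"
    unfolding a by (simp add: runs_def phcomp_def join_Cons pth_Cons b invertible_in vassoc hcomp_interchange)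
qed (use assms in auto)

lemma luns_Cons:
  assumes [simp]: "composable (f # ps)" "ps \<noteq> []"
  shows "luns (f # ps) = wh [] (luns [f]) ps"
proof (rule pcell_eqI)
  have [simp]: "f \<in> Ar M" "composable ps" "src M f = trg M (hd ps)" using assms by auto
  have a: "wh [] (luns [f]) ps = phcomp (luns [f]) (pident ps)"
    by (subst wh_eq) (auto simp: lwhisk_def rwhisk_def)
  let ?b = "bass M (one (trg M f)) f (pth ps)"
  have b: "blun M (f \<odot> pth ps) = (blun M f \<star> cid (pth ps)) \<bullet> cinv ?b"
    using blun_comp[of f "pth ps", symmetric] by (simp add: vassoc)
  show "pcell_cell (luns (f # ps)) = pcell_cell (wh [] (luns [f]) ps)"
    unfolding a by (simp add: luns_def phcomp_def join_Cons pth_Cons b invertible_in)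
qed (use assms in auto)

lemma luns_runs_middle:
  assumes [simp]: "composable (f # ps)" "ps \<noteq> []"
  shows "wh [f] (luns ps) [] = wh [] (runs [f]) ps"
proof (rule pcell_eqI)
  have [simp]: "f \<in> Ar M" "composable ps" "src M f = trg M (hd ps)" using assms by auto
  have a: "wh [] (runs [f]) ps = phcomp (runs [f]) (pident ps)" "wh [f] (luns ps) [] = phcomp (pident [f]) (luns ps)"
    by (subst wh_eq; auto simp: lwhisk_def rwhisk_def)+
  have "brun M f \<star> cid (pth ps) = (cid f \<star> blun M (pth ps)) \<bullet> bass M f (one (trg M (hd ps))) (pth ps)"
    using bicat_triangle[of "pth ps" _ _ f] by simp
  then show "pcell_cell (wh [f] (luns ps) []) = pcell_cell (wh [] (runs [f]) ps)"
    unfolding a by (simp add: luns_def runs_def phcomp_def join_Cons pth_Cons invertible_in vassoc)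
qed (use assms in auto)

text \<open>Transport of an identity arrow from the right to the left end of a path. Being natural
  (\<open>swaps_natural\<close>) and computable entry by entry (\<open>swaps_Cons\<close>), it accounts for the identity arrows
  that stand for the variables of the element notation.\<close>

definition swaps :: "'a list \<Rightarrow> ('a, 'c) pcell" where
  "swaps ps = runs ps ;; pinv (luns ps)"

lemma swaps_simps [simp]:
  assumes "ps \<noteq> []" "composable ps"
  shows "valid (swaps ps)" "pinvertible (swaps ps)" "psrc (swaps ps) = ps @ [one (src M (last ps))]"
    "ptrg (swaps ps) = one (trg M (hd ps)) # ps"
proof -
  show "valid (swaps ps)" "psrc (swaps ps) = ps @ [one (src M (last ps))]"
    "ptrg (swaps ps) = one (trg M (hd ps)) # ps"
    using assms by (auto simp: swaps_def)
  have "invertible (pcell_cell (runs ps))" "invertible (pcell_cell (luns ps))"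
    using pinvertible_runs[OF assms] pinvertible_luns[OF assms] unfolding pinvertible_def by auto
  then show "pinvertible (swaps ps)"
    unfolding pinvertible_def using assms \<open>valid (swaps ps)\<close> by (simp add: swaps_def)
qed

text \<open>The cell \<open>P\<close> slides past \<open>runs\<close>, and then past the inverse of \<open>luns\<close>.\<close>

lemma swaps_natural:
  assumes v: "valid P" and X: "X = src M (last (psrc P))" and Y: "Y = trg M (hd (psrc P))"
  shows "wh [] P [one X] ;; swaps (ptrg P) = swaps (psrc P) ;; wh [one Y] P []"
proof -
  note [simp] = v
  have "wh [] P [one X] ;; swaps (ptrg P) = runs (psrc P) ;; P ;; pinv (luns (ptrg P))"
    unfolding swaps_def by (rule paste_ext[OF runs_natural, OF v X, unfolded])
  also have "P ;; pinv (luns (ptrg P)) = pinv (luns (psrc P)) ;; (luns (psrc P) ;; P) ;; pinv (luns (ptrg P))"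
    by (simp add: paste_assoc)
  also have "\<dots> = pinv (luns (psrc P)) ;; wh [one Y] P []"
    unfolding luns_natural[OF v Y, symmetric] by (auto simp: paste_assoc Y)
  finally show ?thesis unfolding swaps_def by (simp add: paste_assoc)
qed

lemma swaps_Cons:
  assumes [simp]: "composable (f # ps)" "ps \<noteq> []"
  shows "swaps (f # ps) = wh [f] (swaps ps) [] ;; wh [] (swaps [f]) ps"
proof -
  have [simp]: "f \<in> Ar M" "composable ps" "src M f = trg M (hd ps)" using assms by auto
  have m: "wh [f] (pinv (luns ps)) [] ;; wh [] (runs [f]) ps = pident (f # ps)"
    unfolding luns_runs_middle[OF assms, symmetric] by (simp add: wh_paste[symmetric] wh_pident)
  have "wh [f] (swaps ps) [] ;; wh [] (swaps [f]) ps = runs (f # ps) ;;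
      (wh [f] (pinv (luns ps)) [] ;; wh [] (runs [f]) ps) ;; wh [] (pinv (luns [f])) ps"
    unfolding swaps_def wh_paste runs_Cons[OF assms] by (simp add: paste_assoc)
  also have "\<dots> = runs (f # ps) ;; wh [] (pinv (luns [f])) ps"
    unfolding m by (subst pident_paste) auto
  also have "\<dots> = swaps (f # ps)"
    unfolding swaps_def luns_Cons[OF assms] by (subst wh_pinv) auto
  finally show ?thesis by simp
qed

lemma swap_swaps: "f \<in> Ar M ==> swap f = swaps [f]"
  by (rule pcell_eqI) (auto simp: swap_def swaps_def runs_def luns_def run_def lun_def
      pvcomp_paste[symmetric] valid_def paste_def pth_Cons)

lemma run_runs: "f \<in> Ar M ==> run f = runs [f]"
  by (rule pcell_eqI) (auto simp: runs_def run_def)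

lemma lun_luns: "f \<in> Ar M ==> lun f = luns [f]"
  by (rule pcell_eqI) (auto simp: luns_def lun_def)

lemma swaps_one: "X \<in> Ob M ==> swaps [one X] = pident [one X, one X]"
proof -
  assume X[simp]: "X \<in> Ob M"
  have "runs [one X] = luns [one X]"
    by (rule pcell_eqI) (auto simp: runs_def luns_def blun_one)
  then show ?thesis unfolding swaps_def by simp
qed

lemma pinv_swaps_Cons:
  assumes "composable (f # ps)" "ps \<noteq> []"
  shows "pinv (swaps (f # ps)) = wh [] (pinv (swaps [f])) ps ;; wh [f] (pinv (swaps ps)) []"
  using assms by (simp add: swaps_Cons wh_pinv pinv_paste)

lemma pinv_swaps_natural:
  assumes v: "valid P" and X: "X = src M (last (psrc P))" and Y: "Y = trg M (hd (psrc P))"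
  shows "wh [one Y] P [] ;; pinv (swaps (ptrg P)) = pinv (swaps (psrc P)) ;; wh [] P [one X]"
proof -
  have "pinv (swaps (psrc P)) ;; (swaps (psrc P) ;; wh [one Y] P []) ;; pinv (swaps (ptrg P)) =
      pinv (swaps (psrc P)) ;; (wh [] P [one X] ;; swaps (ptrg P)) ;; pinv (swaps (ptrg P))"
    unfolding swaps_natural[OF assms] ..
  then show ?thesis using v by (simp add: paste_assoc X Y)
qed

lemma pinv_swaps: "ps \<noteq> [] ==> composable ps ==> pinv (swaps ps) = luns ps ;; pinv (runs ps)"
  unfolding swaps_def by (simp add: pinv_paste)

end

context monoidal_bicategory begin

section \<open>Tensor product of pasting cells\<close>

lemma tens_arrow [simp]:
  "f \<in> Ar M ==> g \<in> Ar M ==> f \<otimes> g \<in> Ar M"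
  "f \<in> Ar M ==> g \<in> Ar M ==> src M (f \<otimes> g) = src M f \<cdot> src M g"
  "f \<in> Ar M ==> g \<in> Ar M ==> trg M (f \<otimes> g) = trg M f \<cdot> trg M g"
  "X \<in> Ob M ==> Y \<in> Ob M ==> X \<cdot> Y \<in> Ob M"
  "I \<in> Ob M"
  using tens_arr tens_ob_in unit_ob_in by blast+

lemma tens_cell_simps [simp]:
  "\<theta> \<in> Ce M ==> \<phi> \<in> Ce M ==> \<theta> \<otimes>\<^sub>c \<phi> \<in> Ce M"
  "\<theta> \<in> Ce M ==> \<phi> \<in> Ce M ==> cdom M (\<theta> \<otimes>\<^sub>c \<phi>) = cdom M \<theta> \<otimes> cdom M \<phi>"
  "\<theta> \<in> Ce M ==> \<phi> \<in> Ce M ==> ccod M (\<theta> \<otimes>\<^sub>c \<phi>) = ccod M \<theta> \<otimes> ccod M \<phi>"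
  "f \<in> Ar M ==> g \<in> Ar M ==> cid f \<otimes>\<^sub>c cid g = cid (f \<otimes> g)"
  using tens_cell tens_cid by blast+

lemma tens_interchange:
  "\<theta> \<in> Ce M ==> \<theta>' \<in> Ce M ==> \<phi> \<in> Ce M ==> \<phi>' \<in> Ce M ==> cdom M \<theta>' = ccod M \<theta> ==>
   cdom M \<phi>' = ccod M \<phi> ==>
   (\<theta>' \<otimes>\<^sub>c \<phi>') \<bullet> (\<theta> \<otimes>\<^sub>c \<phi>) = (\<theta>' \<bullet> \<theta>) \<otimes>\<^sub>c (\<phi>' \<bullet> \<phi>)"
  using tens_vcomp by metis

lemma inverse_cells_tens:
  "invertible \<theta> ==> invertible \<phi> ==> inverse_cells (\<theta> \<otimes>\<^sub>c \<phi>) (cinv \<theta> \<otimes>\<^sub>c cinv \<phi>)"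
  unfolding inverse_cells_def by (simp add: tens_interchange invertible_in)

lemma invertible_tens [simp]:
  "invertible \<theta> ==> invertible \<phi> ==> invertible (\<theta> \<otimes>\<^sub>c \<phi>)"
  "invertible \<theta> ==> invertible \<phi> ==> cinv (\<theta> \<otimes>\<^sub>c \<phi>) = cinv \<theta> \<otimes>\<^sub>c cinv \<phi>"
  using inverse_cells_tens inverse_cells_invertible cinv_eq by blast+

lemma tens_comp_simps [simp]:
  assumes "f \<in> Ar M" "f' \<in> Ar M" "g \<in> Ar M" "g' \<in> Ar M" "src M f = trg M g" "src M f' = trg M g'"
  shows "invertible (tens_comp M f f' g g')" (is ?A1) "tens_comp M f f' g g' \<in> Ce M" (is ?A2)
    "cdom M (tens_comp M f f' g g') = (f \<otimes> f') \<odot> (g \<otimes> g')" (is ?A3)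
    "ccod M (tens_comp M f f' g g') = (f \<odot> g) \<otimes> (f' \<odot> g')" (is ?A4)
proof -
  have "\<guillemotleft>tens_comp M f f' g g' : (f \<otimes> f') \<odot> (g \<otimes> g') \<cong> (f \<odot> g) \<otimes> (f' \<odot> g')\<guillemotright>"
    by (rule tens_comp_icell) (use assms in auto)
  then show ?A1 ?A2 ?A3 ?A4
    unfolding icell_iff by (auto simp: invertible_in)
qed

lemma tens_comp_nat:
  "\<theta> \<in> Ce M ==> \<theta>' \<in> Ce M ==> \<phi> \<in> Ce M ==> \<phi>' \<in> Ce M ==>
   src M (cdom M \<theta>) = trg M (cdom M \<phi>) ==> src M (cdom M \<theta>') = trg M (cdom M \<phi>') ==>
   tens_comp M (ccod M \<theta>) (ccod M \<theta>') (ccod M \<phi>) (ccod M \<phi>') \<bullet> ((\<theta> \<otimes>\<^sub>c \<theta>') \<star> (\<phi> \<otimes>\<^sub>c \<phi>')) =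
   ((\<theta> \<star> \<phi>) \<otimes>\<^sub>c (\<theta>' \<star> \<phi>')) \<bullet> tens_comp M (cdom M \<theta>) (cdom M \<theta>') (cdom M \<phi>) (cdom M \<phi>')"
  using tens_comp_natural by blast

abbreviation tens_path :: "'a list \<Rightarrow> 'a list \<Rightarrow> 'a list" where
  "tens_path \<equiv> map2 (\<otimes>)"

lemma tens_path_ends [simp]:
  "length fs = length gs ==> fs \<noteq> [] ==> hd (tens_path fs gs) = hd fs \<otimes> hd gs"
  "length fs = length gs ==> fs \<noteq> [] ==> last (tens_path fs gs) = last fs \<otimes> last gs"
  by (induction fs gs rule: list_induct2) (auto simp: neq_Nil_conv)

lemma composable_tens_path [simp]:
  "length fs = length gs ==> composable fs ==> composable gs ==> composable (tens_path fs gs)"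
  by (induction fs gs rule: list_induct2) (auto split: if_splits)

text \<open>The canonical cell \<open>pth (tens_path fs gs) \<Rightarrow> pth fs \<otimes> pth gs\<close>.\<close>

fun tjoin :: "'a list \<Rightarrow> 'a list \<Rightarrow> 'c" where
  "tjoin (f # fs) (g # gs) = (if fs = [] then cid (f \<otimes> g) else
     tens_comp M f g (pth fs) (pth gs) \<bullet> (cid (f \<otimes> g) \<star> tjoin fs gs))"
| "tjoin _ _ = undefined"

lemma tjoin_cell [simp]:
  assumes "length fs = length gs" "fs \<noteq> []" "composable fs" "composable gs"
  shows "invertible (tjoin fs gs)" (is ?A1) "tjoin fs gs \<in> Ce M" (is ?A2)
    "cdom M (tjoin fs gs) = pth (tens_path fs gs)" (is ?A3) "ccod M (tjoin fs gs) = pth fs \<otimes> pth gs" (is ?A4)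
proof -
  have "?A1 \<and> ?A3 \<and> ?A4"
    using assms
  proof (induction fs gs rule: list_induct2)
    case (Cons f fs g gs)
    show ?case
    proof (cases "fs = []")
      case False
      then have "gs \<noteq> []" using Cons.hyps by auto
      then show ?thesis using Cons False by (auto simp: pth_Cons invertible_in)
    qed (use Cons in auto)
  qed simp
  then show ?A1 ?A2 ?A3 ?A4
    by (auto simp: invertible_in)
qed

text \<open>Coherence of the pseudofunctor \<open>\<otimes>\<close> with respect to concatenation of paths, by induction with one
  use of its associativity axiom for each entry of the first path.\<close>

lemma tjoin_append:
  assumes "length fs = length gs" "fs \<noteq> []" "composable fs" "composable gs"
    and "length us = length vs" "us \<noteq> []" "composable us" "composable vs"
    and "src M (last fs) = trg M (hd us)" "src M (last gs) = trg M (hd vs)"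
  shows "tjoin (fs @ us) (gs @ vs) \<bullet> join (tens_path fs gs) (tens_path us vs) =
    (join fs us \<otimes>\<^sub>c join gs vs) \<bullet> tens_comp M (pth fs) (pth gs) (pth us) (pth vs) \<bullet>
      (tjoin fs gs \<star> tjoin us vs)"
  using assms
proof (induction fs gs rule: list_induct2)
  case (Cons f fs g gs)
  have [simp]: "vs \<noteq> []" using Cons.prems by auto
  show ?case
  proof (cases "fs = []")
    case True
    with Cons show ?thesis by simp
  next
    case False
    then have [simp]: "fs \<noteq> []" "gs \<noteq> []" using Cons.hyps by auto
    note [simp] = Cons.hyps Cons.prems(4-7)
    have [simp]: "f \<in> Ar M" "g \<in> Ar M" "composable fs" "composable gs" "src M f = trg M (hd fs)"
      "src M g = trg M (hd gs)" "src M (last fs) = trg M (hd us)" "src M (last gs) = trg M (hd vs)"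
      using Cons.prems by auto
    let ?p = "pth fs" and ?q = "pth gs" and ?u = "pth us" and ?v = "pth vs"
    let ?c = "cid (f \<otimes> g)"
    have IH: "tjoin (fs @ us) (gs @ vs) \<bullet> join (tens_path fs gs) (tens_path us vs) =
      (join fs us \<otimes>\<^sub>c join gs vs) \<bullet> tens_comp M ?p ?q ?u ?v \<bullet> (tjoin fs gs \<star> tjoin us vs)"
      by (rule Cons.IH) auto
    have n1: "tens_comp M f g (pth (fs @ us)) (pth (gs @ vs)) \<bullet> (?c \<star> (join fs us \<otimes>\<^sub>c join gs vs)) =
      ((cid f \<star> join fs us) \<otimes>\<^sub>c (cid g \<star> join gs vs)) \<bullet> tens_comp M f g (?p \<odot> ?u) (?q \<odot> ?v)"
      using tens_comp_nat[of "cid f" "cid g" "join fs us" "join gs vs"] by simp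
    have n2: "(?c \<star> (tjoin fs gs \<star> tjoin us vs)) \<bullet> bass M (f \<otimes> g) (pth (tens_path fs gs)) (pth (tens_path us vs)) =
       bass M (f \<otimes> g) (?p \<otimes> ?q) (?u \<otimes> ?v) \<bullet> ((?c \<star> tjoin fs gs) \<star> tjoin us vs)"
      using bass_nat[of ?c "tjoin fs gs" "tjoin us vs"] by simp
    have n3: "(bass M f ?p ?u \<otimes>\<^sub>c bass M g ?q ?v) \<bullet> tens_comp M (f \<odot> ?p) (g \<odot> ?q) ?u ?v \<bullet>
        (tens_comp M f g ?p ?q \<star> cid (?u \<otimes> ?v)) =
      tens_comp M f g (?p \<odot> ?u) (?q \<odot> ?v) \<bullet> (?c \<star> tens_comp M ?p ?q ?u ?v) \<bullet>
        bass M (f \<otimes> g) (?p \<otimes> ?q) (?u \<otimes> ?v)"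
      by (rule tens_assoc) auto
    have "tjoin ((f # fs) @ us) ((g # gs) @ vs) \<bullet> join (tens_path (f # fs) (g # gs)) (tens_path us vs) =
      tens_comp M f g (pth (fs @ us)) (pth (gs @ vs)) \<bullet>
      ((?c \<star> (tjoin (fs @ us) (gs @ vs) \<bullet> join (tens_path fs gs) (tens_path us vs))) \<bullet>
      bass M (f \<otimes> g) (pth (tens_path fs gs)) (pth (tens_path us vs)))"
      by (simp add: join_Cons vassoc cid_hcomp_vcomp)
    also have "\<dots> = (tens_comp M f g (pth (fs @ us)) (pth (gs @ vs)) \<bullet> (?c \<star> (join fs us \<otimes>\<^sub>c join gs vs))) \<bullet>
       (?c \<star> tens_comp M ?p ?q ?u ?v) \<bullet>
       ((?c \<star> (tjoin fs gs \<star> tjoin us vs)) \<bullet> bass M (f \<otimes> g) (pth (tens_path fs gs)) (pth (tens_path us vs)))"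
      unfolding IH by (simp add: vassoc cid_hcomp_vcomp)
    also have "\<dots> = ((cid f \<star> join fs us) \<otimes>\<^sub>c (cid g \<star> join gs vs)) \<bullet>
       (tens_comp M f g (?p \<odot> ?u) (?q \<odot> ?v) \<bullet> (?c \<star> tens_comp M ?p ?q ?u ?v) \<bullet>
        bass M (f \<otimes> g) (?p \<otimes> ?q) (?u \<otimes> ?v)) \<bullet> ((?c \<star> tjoin fs gs) \<star> tjoin us vs)"
      unfolding n1 n2 by (simp add: vassoc)
    also have "\<dots> = (((cid f \<star> join fs us) \<bullet> bass M f ?p ?u) \<otimes>\<^sub>c ((cid g \<star> join gs vs) \<bullet> bass M g ?q ?v)) \<bullet>
      tens_comp M (f \<odot> ?p) (g \<odot> ?q) ?u ?v \<bullet>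
        ((tens_comp M f g ?p ?q \<bullet> (?c \<star> tjoin fs gs)) \<star> tjoin us vs)"
      unfolding n3[symmetric] by (simp add: vassoc[symmetric] tens_interchange) (simp add: vassoc hcomp_interchange)
    finally show ?thesis by (simp add: join_Cons pth_Cons)
  qed
qed simp

text \<open>The tensor product of pasting cells that proceed in parallel: it presupposes equal lengths of the
  two source paths and of the two target paths, which is why identity arrows are inserted into
  paths and moved along them.\<close>

definition ptens :: "('a, 'c) pcell \<Rightarrow> ('a, 'c) pcell \<Rightarrow> ('a, 'c) pcell" (infixr "\<boxtimes>" 70) where
  "P \<boxtimes> Q = (tens_path (psrc P) (psrc Q),
     cinv (tjoin (ptrg P) (ptrg Q)) \<bullet> (pcell_cell P \<otimes>\<^sub>c pcell_cell Q) \<bullet> tjoin (psrc P) (psrc Q),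
     tens_path (ptrg P) (ptrg Q))"

lemma ptens_sel [simp]:
  "psrc (P \<boxtimes> Q) = tens_path (psrc P) (psrc Q)" "ptrg (P \<boxtimes> Q) = tens_path (ptrg P) (ptrg Q)"
  unfolding ptens_def by auto

lemma valid_ptens [simp]:
  assumes "valid P" "valid Q" "length (psrc P) = length (psrc Q)" "length (ptrg P) = length (ptrg Q)"
  shows "valid (P \<boxtimes> Q)"
  using assms unfolding valid_def[of "P \<boxtimes> Q"] by (simp add: ptens_def)

lemma ptens_cell:
  assumes "valid P" "valid Q" "length (psrc P) = length (psrc Q)" "length (ptrg P) = length (ptrg Q)"
  shows "tjoin (ptrg P) (ptrg Q) \<bullet> pcell_cell (P \<boxtimes> Q) = (pcell_cell P \<otimes>\<^sub>c pcell_cell Q) \<bullet> tjoin (psrc P) (psrc Q)"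
  using assms by (simp add: ptens_def)

lemma ptens_paste:
  assumes "valid (P ;; P')" "valid (Q ;; Q')" "length (psrc P) = length (psrc Q)"
    "length (ptrg P) = length (ptrg Q)" "length (ptrg P') = length (ptrg Q')"
  shows "(P ;; P') \<boxtimes> (Q ;; Q') = (P \<boxtimes> Q) ;; (P' \<boxtimes> Q')"
proof (rule pcell_eqI)
  show "pcell_cell ((P ;; P') \<boxtimes> (Q ;; Q')) = pcell_cell ((P \<boxtimes> Q) ;; (P' \<boxtimes> Q'))"
    using assms by (simp add: ptens_def[of "P ;; P'"]) (simp add: ptens_def vassoc tens_interchange[symmetric])
qed (use assms in auto)

lemma pinvertible_ptens [simp]:
  assumes "pinvertible P" "pinvertible Q" "length (psrc P) = length (psrc Q)" "length (ptrg P) = length (ptrg Q)"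
  shows "pinvertible (P \<boxtimes> Q)"
proof -
  have "valid P" "valid Q" "invertible (pcell_cell P)" "invertible (pcell_cell Q)"
    using assms unfolding pinvertible_def by auto
  then show ?thesis
    using assms(3,4) unfolding pinvertible_def by (simp add: ptens_def[of P Q]) (simp flip: ptens_def)
qed

lemma ptens_pident:
  assumes "length fs = length gs" "fs \<noteq> []" "composable fs" "composable gs"
  shows "pident fs \<boxtimes> pident gs = pident (tens_path fs gs)"
proof (rule pcell_eqI)
  have "gs \<noteq> []" using assms by auto
  then show "pcell_cell (pident fs \<boxtimes> pident gs) = pcell_cell (pident (tens_path fs gs))"
    using assms by (simp add: ptens_def)
qed auto

lemma ptens_pinv:
  assumes "pinvertible P" "pinvertible Q" "length (psrc P) = length (psrc Q)" "length (ptrg P) = length (ptrg Q)"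
  shows "pinv P \<boxtimes> pinv Q = pinv (P \<boxtimes> Q)"
  by (rule pinv_unique[OF pinvertible_ptens[OF assms]])
    (use assms in \<open>auto simp: ptens_paste[symmetric] pinvertible_valid ptens_pident\<close>)

text \<open>After composition with the invertible cells \<open>tjoin\<close> and \<open>join\<close>, both sides become the cell
  \<open>(p \<star> p') \<otimes> (q \<star> q')\<close>, by \<open>tjoin_append\<close> and naturality of the constraint of \<open>\<otimes>\<close>.\<close>

lemma ptens_phcomp:
  assumes v: "valid P" "valid P'" "valid Q" "valid Q'"
    and l: "length (psrc P) = length (psrc Q)" "length (ptrg P) = length (ptrg Q)"
      "length (psrc P') = length (psrc Q')" "length (ptrg P') = length (ptrg Q')"
    and c: "src M (last (psrc P)) = trg M (hd (psrc P'))" "src M (last (psrc Q)) = trg M (hd (psrc Q'))"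
  shows "phcomp P P' \<boxtimes> phcomp Q Q' = phcomp (P \<boxtimes> Q) (P' \<boxtimes> Q')"
proof (rule phcomp_eqI)
  note [simp] = assms
  show v1: "valid (P \<boxtimes> Q)" "valid (P' \<boxtimes> Q')" by auto
  have v2: "valid (phcomp P P')" "valid (phcomp Q Q')" by auto
  show v3: "valid (phcomp P P' \<boxtimes> phcomp Q Q')" using v2 by simp
  note [simp] = validD(5-7)[OF v1(1), simplified] validD(5-7)[OF v1(2), simplified]
    validD(5-7)[OF v2(1), simplified] validD(5-7)[OF v2(2), simplified]
    validD(5-7)[OF v3, simplified]
  let ?s = "join (tens_path (psrc P) (psrc Q)) (tens_path (psrc P') (psrc Q'))"
  let ?t = "join (tens_path (ptrg P) (ptrg Q)) (tens_path (ptrg P') (ptrg Q'))"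
  let ?J = "tjoin (ptrg P @ ptrg P') (ptrg Q @ ptrg Q')"
  let ?p = "pcell_cell P" and ?p' = "pcell_cell P'" and ?q = "pcell_cell Q" and ?q' = "pcell_cell Q'"
  have "?J \<bullet> (pcell_cell (phcomp P P' \<boxtimes> phcomp Q Q') \<bullet> ?s) =
    (pcell_cell (phcomp P P') \<otimes>\<^sub>c pcell_cell (phcomp Q Q')) \<bullet> (tjoin (psrc P @ psrc P') (psrc Q @ psrc Q') \<bullet> ?s)"
    using ptens_cell[of "phcomp P P'" "phcomp Q Q'"] by (simp add: vassoc[symmetric])
  also have "\<dots> = ((pcell_cell (phcomp P P') \<bullet> join (psrc P) (psrc P')) \<otimes>\<^sub>c (pcell_cell (phcomp Q Q') \<bullet> join (psrc Q) (psrc Q'))) \<bullet>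
      tens_comp M (pth (psrc P)) (pth (psrc Q)) (pth (psrc P')) (pth (psrc Q')) \<bullet> (tjoin (psrc P) (psrc Q) \<star> tjoin (psrc P') (psrc Q'))"
    by (subst tjoin_append) (simp_all add: vassoc[symmetric] tens_interchange)
  also have "\<dots> = (join (ptrg P) (ptrg P') \<otimes>\<^sub>c join (ptrg Q) (ptrg Q')) \<bullet> (((?p \<star> ?p') \<otimes>\<^sub>c (?q \<star> ?q')) \<bullet>
      tens_comp M (pth (psrc P)) (pth (psrc Q)) (pth (psrc P')) (pth (psrc Q'))) \<bullet> (tjoin (psrc P) (psrc Q) \<star> tjoin (psrc P') (psrc Q'))"
    by (simp add: phcomp_cell vassoc tens_interchange[symmetric])
  also have "((?p \<star> ?p') \<otimes>\<^sub>c (?q \<star> ?q')) \<bullet> tens_comp M (pth (psrc P)) (pth (psrc Q)) (pth (psrc P')) (pth (psrc Q')) =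
     tens_comp M (pth (ptrg P)) (pth (ptrg Q)) (pth (ptrg P')) (pth (ptrg Q')) \<bullet> ((?p \<otimes>\<^sub>c ?q) \<star> (?p' \<otimes>\<^sub>c ?q'))"
    using tens_comp_nat[of ?p ?q ?p' ?q'] by simp
  also have "(join (ptrg P) (ptrg P') \<otimes>\<^sub>c join (ptrg Q) (ptrg Q')) \<bullet> (\<dots>) \<bullet> (tjoin (psrc P) (psrc Q) \<star> tjoin (psrc P') (psrc Q')) =
     (join (ptrg P) (ptrg P') \<otimes>\<^sub>c join (ptrg Q) (ptrg Q')) \<bullet> tens_comp M (pth (ptrg P)) (pth (ptrg Q)) (pth (ptrg P')) (pth (ptrg Q')) \<bullet>
     ((tjoin (ptrg P) (ptrg Q) \<bullet> pcell_cell (P \<boxtimes> Q)) \<star> (tjoin (ptrg P') (ptrg Q') \<bullet> pcell_cell (P' \<boxtimes> Q')))"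
    by (simp add: ptens_cell hcomp_interchange vassoc)
  also have "\<dots> = (?J \<bullet> ?t) \<bullet> (pcell_cell (P \<boxtimes> Q) \<star> pcell_cell (P' \<boxtimes> Q'))"
    by (subst tjoin_append) (simp_all add: hcomp_interchange vassoc)
  also have "\<dots> = ?J \<bullet> (?t \<bullet> (pcell_cell (P \<boxtimes> Q) \<star> pcell_cell (P' \<boxtimes> Q')))"
    by (simp add: vassoc)
  finally have "?J \<bullet> (pcell_cell (phcomp P P' \<boxtimes> phcomp Q Q') \<bullet> ?s) = \<dots>" .
  then have "pcell_cell (phcomp P P' \<boxtimes> phcomp Q Q') \<bullet> ?s = ?t \<bullet> (pcell_cell (P \<boxtimes> Q) \<star> pcell_cell (P' \<boxtimes> Q'))"
    by (rule cancel_left[rotated 5]) simp_all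
  then show "pcell_cell (phcomp P P' \<boxtimes> phcomp Q Q') \<bullet> join (psrc (P \<boxtimes> Q)) (psrc (P' \<boxtimes> Q')) =
    join (ptrg (P \<boxtimes> Q)) (ptrg (P' \<boxtimes> Q')) \<bullet> (pcell_cell (P \<boxtimes> Q) \<star> pcell_cell (P' \<boxtimes> Q'))"
    by simp
qed (use assms in auto)

lemma ptens_wh:
  assumes "valid (wh us P vs)" "valid (wh us' Q vs')"
    and "length us = length us'" "length vs = length vs'"
    and "length (psrc P) = length (psrc Q)" "length (ptrg P) = length (ptrg Q)"
  shows "wh us P vs \<boxtimes> wh us' Q vs' = wh (tens_path us us') (P \<boxtimes> Q) (tens_path vs vs')"
proof -
  have [simp]: "us' = [] \<longleftrightarrow> us = []" "vs' = [] \<longleftrightarrow> vs = []" using assms by auto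
  have v: "valid P" "valid Q" and c: "composable (us @ psrc P @ vs)" "composable (us' @ psrc Q @ vs')"
    using assms(1,2) by auto
  have e: "rwhisk P vs \<boxtimes> rwhisk Q vs' = rwhisk (P \<boxtimes> Q) (tens_path vs vs')"
    unfolding rwhisk_def using v c assms(3-6) by (auto simp: ptens_phcomp ptens_pident)
  have "wh us P vs \<boxtimes> wh us' Q vs' = lwhisk us (rwhisk P vs) \<boxtimes> lwhisk us' (rwhisk Q vs')"
    using v c by (simp add: wh_eq del: composable_append)
  also have "\<dots> = lwhisk (tens_path us us') (rwhisk P vs \<boxtimes> rwhisk Q vs')"
    unfolding lwhisk_def[of us] lwhisk_def[of us'] lwhisk_def[of "tens_path us us'"]
    using v c assms(3-6) by (auto simp: ptens_phcomp ptens_pident)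
  also have "\<dots> = wh (tens_path us us') (P \<boxtimes> Q) (tens_path vs vs')"
    unfolding e using v c assms(3-6) by (subst wh_eq) auto
  finally show ?thesis .
qed

section \<open>The constraints of a monoidal bicategory\<close>

lemma sqtens_ptens:
  assumes "valid P" "valid Q" "length (psrc P) = 2" "length (ptrg P) = 2" "length (psrc Q) = 2" "length (ptrg Q) = 2"
  shows "sqtens P Q = P \<boxtimes> Q"
proof -
  obtain f g \<theta> h k where P: "P = ([f, g], \<theta>, [h, k])"
    using assms(3,4) by (cases P) (auto simp: length_Suc_conv numeral_2_eq_2)
  obtain f' g' \<theta>' h' k' where Q: "Q = ([f', g'], \<theta>', [h', k'])"
    using assms(5,6) by (cases Q) (auto simp: length_Suc_conv numeral_2_eq_2)
  have "f \<in> Ar M" "g \<in> Ar M" "h \<in> Ar M" "k \<in> Ar M" "src M f = trg M g" "src M h = trg M k"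
    "f' \<in> Ar M" "g' \<in> Ar M" "h' \<in> Ar M" "k' \<in> Ar M" "src M f' = trg M g'" "src M h' = trg M k'"
    using validD(3,4)[OF assms(1)] validD(3,4)[OF assms(2)] unfolding P Q by auto
  then show ?thesis unfolding P Q by (simp add: ptens_def)
qed

text \<open>Composition of two arrows as a rewriting of a path. It is an identity cell, but not an identity
  of the strict 2-category of paths.\<close>

definition contract :: "'a \<Rightarrow> 'a \<Rightarrow> ('a, 'c) pcell" where
  "contract f g = ([f, g], cid (f \<odot> g), [f \<odot> g])"

lemma contract_sel [simp]: "psrc (contract f g) = [f, g]" "ptrg (contract f g) = [f \<odot> g]"
  by (simp_all add: contract_def)

lemma pinvertible_contract [simp]:
  "f \<in> Ar M ==> g \<in> Ar M ==> src M f = trg M g ==> pinvertible (contract f g)"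
  unfolding pinvertible_def valid_def by (simp add: contract_def)

lemma valid_contract [simp]:
  "f \<in> Ar M ==> g \<in> Ar M ==> src M f = trg M g ==> valid (contract f g)"
  by (simp add: pinvertible_valid)

lemma expand_contract: "f \<in> Ar M ==> g \<in> Ar M ==> src M f = trg M g ==> expand [f, g] = pinv (contract f g)"
  unfolding expand_def contract_def by simp

lemma oneP_sel [simp]: "psrc (oneP X Y) = [one (X \<cdot> Y)]" "ptrg (oneP X Y) = [one X \<otimes> one Y]"
  by (simp_all add: oneP_def)

lemma tens_one_simps [simp]:
  assumes "X \<in> Ob M" "Y \<in> Ob M"
  shows "invertible (tens_one M X Y)" "tens_one M X Y \<in> Ce M"
    "cdom M (tens_one M X Y) = one (X \<cdot> Y)" "ccod M (tens_one M X Y) = one X \<otimes> one Y"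
  using tens_one_icell[OF assms] unfolding icell_iff by (auto simp: invertible_in)

lemma pinvertible_oneP [simp]: "X \<in> Ob M ==> Y \<in> Ob M ==> pinvertible (oneP X Y)"
  unfolding pinvertible_def valid_def by (simp add: oneP_def)

lemma valid_oneP [simp]: "X \<in> Ob M ==> Y \<in> Ob M ==> valid (oneP X Y)"
  by (simp add: pinvertible_valid)

lemma split_one_left_ptens:
  "X \<in> Ob M ==> Y \<in> Ob M ==> f \<in> Ar M ==> split_one_left X Y f = oneP X Y \<boxtimes> pident [f]"
  by (rule pcell_eqI) (simp_all add: split_one_left_def ptens_def oneP_def)

lemma split_one_right_ptens:
  "X \<in> Ob M ==> Y \<in> Ob M ==> f \<in> Ar M ==> split_one_right f X Y = pident [f] \<boxtimes> oneP X Y"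
  by (rule pcell_eqI) (simp_all add: split_one_right_def ptens_def oneP_def)

text \<open>The right unit axiom of the pseudofunctor \<open>\<otimes>\<close>.\<close>

lemma runs_tens:
  assumes [simp]: "f \<in> Ar M" "g \<in> Ar M" and X: "X = src M f" "Y = src M g"
  shows "wh [f \<otimes> g] (oneP X Y) [] ;; (runs [f] \<boxtimes> runs [g]) = runs [f \<otimes> g]"
proof (rule pcell_eqI)
  have c: "pcell_cell (oneP X Y) = tens_one M X Y" by (simp add: oneP_def)
  show "pcell_cell (wh [f \<otimes> g] (oneP X Y) [] ;; (runs [f] \<boxtimes> runs [g])) = pcell_cell (runs [f \<otimes> g])"
    using tens_right_unit[of f "src M f" "trg M f" g "src M g" "trg M g"]
    by (simp add: X pcell_cell_wh_left pcell_cell_wh_right c[unfolded X]) (simp add: runs_def ptens_def vassoc)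
qed (simp_all add: X)

text \<open>The left unit axiom of the pseudofunctor \<open>\<otimes>\<close>.\<close>

lemma luns_tens:
  assumes [simp]: "f \<in> Ar M" "g \<in> Ar M" and X: "X = trg M f" "Y = trg M g"
  shows "wh [] (oneP X Y) [f \<otimes> g] ;; (luns [f] \<boxtimes> luns [g]) = luns [f \<otimes> g]"
proof (rule pcell_eqI)
  have c: "pcell_cell (oneP X Y) = tens_one M X Y" by (simp add: oneP_def)
  show "pcell_cell (wh [] (oneP X Y) [f \<otimes> g] ;; (luns [f] \<boxtimes> luns [g])) = pcell_cell (luns [f \<otimes> g])"
    using tens_left_unit[of f "src M f" "trg M f" g "src M g" "trg M g"]
    by (simp add: X pcell_cell_wh_left pcell_cell_wh_right c[unfolded X]) (simp add: luns_def ptens_def vassoc)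
qed (simp_all add: X)

lemma swaps_tens:
  assumes [simp]: "f \<in> Ar M" "g \<in> Ar M"
    and X: "X = src M f" "Y = src M g" and Z: "Z = trg M f" "W = trg M g"
  shows "wh [f \<otimes> g] (oneP X Y) [] ;; (swaps [f] \<boxtimes> swaps [g]) = swaps [f \<otimes> g] ;; wh [] (oneP Z W) [f \<otimes> g]"
proof -
  have p: "pinv (luns [f]) \<boxtimes> pinv (luns [g]) = pinv (luns [f] \<boxtimes> luns [g])"
    by (rule ptens_pinv) auto
  have l: "pinvertible (luns [f] \<boxtimes> luns [g])" by auto
  have "wh [f \<otimes> g] (oneP X Y) [] ;; (swaps [f] \<boxtimes> swaps [g]) =
     (wh [f \<otimes> g] (oneP X Y) [] ;; (runs [f] \<boxtimes> runs [g])) ;; pinv (luns [f] \<boxtimes> luns [g])"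
    unfolding swaps_def by (simp add: ptens_paste p paste_assoc)
  also have "\<dots> = runs [f \<otimes> g] ;; pinv (luns [f \<otimes> g]) ;; luns [f \<otimes> g] ;; pinv (luns [f] \<boxtimes> luns [g])"
    unfolding runs_tens[OF assms(1,2) X] by simp
  also have "luns [f \<otimes> g] ;; pinv (luns [f] \<boxtimes> luns [g]) = wh [] (oneP Z W) [f \<otimes> g]"
    unfolding luns_tens[OF assms(1,2) Z, symmetric] using l by (simp add: paste_assoc Z)
  finally show ?thesis by (simp add: swaps_def paste_assoc)
qed

lemma pinv_swaps_tens:
  assumes [simp]: "f \<in> Ar M" "g \<in> Ar M"
    and X: "X = src M f" "Y = src M g" and Z: "Z = trg M f" "W = trg M g"
  shows "wh [] (oneP Z W) [f \<otimes> g] ;; (pinv (swaps [f]) \<boxtimes> pinv (swaps [g])) =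
    pinv (swaps [f \<otimes> g]) ;; wh [f \<otimes> g] (oneP X Y) []"
proof -
  let ?s = "pinv (swaps [f]) \<boxtimes> pinv (swaps [g])"
  have s: "(swaps [f] \<boxtimes> swaps [g]) ;; ?s = pident [f \<otimes> g, one X \<otimes> one Y]"
    by (simp add: ptens_paste[symmetric] ptens_pident X)
  have "pinv (swaps [f \<otimes> g]) ;; (wh [f \<otimes> g] (oneP X Y) [] ;; (swaps [f] \<boxtimes> swaps [g])) ;; ?s =
      pinv (swaps [f \<otimes> g]) ;; (swaps [f \<otimes> g] ;; wh [] (oneP Z W) [f \<otimes> g]) ;; ?s"
    unfolding swaps_tens[OF assms] ..
  then show ?thesis by (simp add: paste_assoc s X Z)
qed

definition single :: "'c \<Rightarrow> ('a, 'c) pcell" where "single \<theta> = ([cdom M \<theta>], \<theta>, [ccod M \<theta>])"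

lemma single_sel [simp]: "psrc (single \<theta>) = [cdom M \<theta>]" "ptrg (single \<theta>) = [ccod M \<theta>]" "pcell_cell (single \<theta>) = \<theta>"
  by (simp_all add: single_def)

lemma valid_single [simp]: "\<theta> \<in> Ce M ==> valid (single \<theta>)"
  unfolding valid_def by simp

lemma single_cid: "f \<in> Ar M ==> single (cid f) = pident [f]"
  by (rule pcell_eqI) auto

lemma single_ptens: "\<theta> \<in> Ce M ==> \<phi> \<in> Ce M ==> single \<theta> \<boxtimes> single \<phi> = single (\<theta> \<otimes>\<^sub>c \<phi>)"
  by (rule pcell_eqI) (auto simp: ptens_def)

lemma valid_singleton:
  assumes "valid P" "psrc P = [f]" "ptrg P = [g]"
  shows "P = single (pcell_cell P)"
  using assms validD(6,7)[OF assms(1)] by (intro pcell_eqI) simp_all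

lemma ass_arrow [simp]:
  assumes "X \<in> Ob M" "Y \<in> Ob M" "Z \<in> Ob M"
  shows "\<a> X Y Z \<in> Ar M" "src M (\<a> X Y Z) = (X \<cdot> Y) \<cdot> Z" "trg M (\<a> X Y Z) = X \<cdot> (Y \<cdot> Z)"
  using ass_equivalence[OF assms] unfolding adjoint_equivalence_def by auto

lemma rgt_arrow [simp]:
  assumes "X \<in> Ob M" shows "\<r> X \<in> Ar M" "src M (\<r> X) = X \<cdot> I" "trg M (\<r> X) = X"
  using rgt_equivalence[OF assms] unfolding adjoint_equivalence_def by auto

lemma assN_sel [simp]:
  "psrc (assN f g h) = [\<a> (trg M f) (trg M g) (trg M h), (f \<otimes> g) \<otimes> h]"
  "ptrg (assN f g h) = [f \<otimes> (g \<otimes> h), \<a> (src M f) (src M g) (src M h)]"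
  by (simp_all add: assN_def)

lemma pinvertible_assN [simp]:
  assumes [simp]: "f \<in> Ar M" "g \<in> Ar M" "h \<in> Ar M" shows "pinvertible (assN f g h)" "valid (assN f g h)"
proof -
  have "\<guillemotleft>ass_nat M f g h : \<a> (trg M f) (trg M g) (trg M h) \<odot> ((f \<otimes> g) \<otimes> h) \<cong>
      (f \<otimes> (g \<otimes> h)) \<odot> \<a> (src M f) (src M g) (src M h)\<guillemotright>"
    by (rule ass_nat_icell) auto
  then show "pinvertible (assN f g h)"
    unfolding pinvertible_def valid_def icell_iff by (auto simp: assN_def invertible_in)
  then show "valid (assN f g h)" by (rule pinvertible_valid)
qed

lemma rgtN_sel [simp]:
  "psrc (rgtN f) = [\<r> (trg M f), f \<otimes> one I]" "ptrg (rgtN f) = [f, \<r> (src M f)]"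
  by (simp_all add: rgtN_def)

lemma pinvertible_rgtN [simp]:
  assumes [simp]: "f \<in> Ar M" shows "pinvertible (rgtN f)" "valid (rgtN f)"
proof -
  have "\<guillemotleft>rgt_nat M f : \<r> (trg M f) \<odot> (f \<otimes> one I) \<cong> f \<odot> \<r> (src M f)\<guillemotright>"
    by (rule rgt_nat_icell) auto
  then show "pinvertible (rgtN f)"
    unfolding pinvertible_def valid_def icell_iff by (auto simp: rgtN_def invertible_in)
  then show "valid (rgtN f)" by (rule pinvertible_valid)
qed

lemma assN_natural_single:
  assumes [simp]: "\<theta> \<in> Ce M" "\<phi> \<in> Ce M" "\<psi> \<in> Ce M"
  shows "wh [\<a> (trg M (cdom M \<theta>)) (trg M (cdom M \<phi>)) (trg M (cdom M \<psi>))] ((single \<theta> \<boxtimes> single \<phi>) \<boxtimes> single \<psi>) [] ;;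
      assN (ccod M \<theta>) (ccod M \<phi>) (ccod M \<psi>) =
    assN (cdom M \<theta>) (cdom M \<phi>) (cdom M \<psi>) ;;
      wh [] (single \<theta> \<boxtimes> (single \<phi> \<boxtimes> single \<psi>)) [\<a> (src M (cdom M \<theta>)) (src M (cdom M \<phi>)) (src M (cdom M \<psi>))]"
    (is "?L = ?R")
proof (rule pcell_eqI)
  have [simp]: "pcell_cell (assN u v w) = ass_nat M u v w" for u v w by (simp add: assN_def)
  show "pcell_cell ?L = pcell_cell ?R"
    using ass_nat_natural[of \<theta> "cdom M \<theta>" "ccod M \<theta>" \<phi> "cdom M \<phi>" "ccod M \<phi>" \<psi> "cdom M \<psi>" "ccod M \<psi>"] assms
    by (simp add: single_ptens pcell_cell_wh_left pcell_cell_wh_right)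
qed (use assms in \<open>simp_all add: single_ptens\<close>)

lemma assN_natural:
  assumes v: "valid P" "valid Q" "valid S" and l: "psrc P = [f]" "psrc Q = [g]" "psrc S = [h]"
    "ptrg P = [f']" "ptrg Q = [g']" "ptrg S = [h']"
  shows "wh [\<a> (trg M f) (trg M g) (trg M h)] ((P \<boxtimes> Q) \<boxtimes> S) [] ;; assN f' g' h' =
    assN f g h ;; wh [] (P \<boxtimes> (Q \<boxtimes> S)) [\<a> (src M f) (src M g) (src M h)]"
proof -
  have "P = single (pcell_cell P)" "Q = single (pcell_cell Q)" "S = single (pcell_cell S)"
    using valid_singleton v l by blast+
  moreover have "cdom M (pcell_cell P) = f" "ccod M (pcell_cell P) = f'" "cdom M (pcell_cell Q) = g"
    "ccod M (pcell_cell Q) = g'" "cdom M (pcell_cell S) = h" "ccod M (pcell_cell S) = h'"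
    using v l by simp_all
  ultimately show ?thesis
    using assN_natural_single[OF validD(5)[OF v(1)] validD(5)[OF v(2)] validD(5)[OF v(3)]] by metis
qed

text \<open>The constraint of the pseudofunctor \<open>\<otimes>\<close> is the tensor product of two contractions. So the axioms
  that express compatibility of a transformation with composition become equations between
  tensor products of contractions.\<close>

lemma ptens_contract:
  assumes [simp]: "f \<in> Ar M" "g \<in> Ar M" "f' \<in> Ar M" "g' \<in> Ar M" "src M f = trg M g" "src M f' = trg M g'"
  shows "contract f g \<boxtimes> contract f' g' = ([f \<otimes> f', g \<otimes> g'], tens_comp M f f' g g', [(f \<odot> g) \<otimes> (f' \<odot> g')])"
  by (simp add: ptens_def contract_def)

lemma ptens_contract3:
  assumes [simp]: "f \<in> Ar M" "f' \<in> Ar M" "g \<in> Ar M" "g' \<in> Ar M" "h \<in> Ar M" "h' \<in> Ar M"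
    "src M f' = trg M f" "src M g' = trg M g" "src M h' = trg M h"
  shows "contract f' f \<boxtimes> (contract g' g \<boxtimes> contract h' h) = ([f' \<otimes> (g' \<otimes> h'), f \<otimes> (g \<otimes> h)],
            (cid (f' \<odot> f) \<otimes>\<^sub>c tens_comp M g' h' g h) \<bullet> tens_comp M f' (g' \<otimes> h') f (g \<otimes> h),
            [(f' \<odot> f) \<otimes> ((g' \<odot> g) \<otimes> (h' \<odot> h))])"
    "(contract f' f \<boxtimes> contract g' g) \<boxtimes> contract h' h = ([(f' \<otimes> g') \<otimes> h', (f \<otimes> g) \<otimes> h],
         (tens_comp M f' g' f g \<otimes>\<^sub>c cid (h' \<odot> h)) \<bullet> tens_comp M (f' \<otimes> g') h' (f \<otimes> g) h,
         [((f' \<odot> f) \<otimes> (g' \<odot> g)) \<otimes> (h' \<odot> h)])"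
  by (simp add: ptens_contract, simp add: ptens_def contract_def)+

lemma assN_comp:
  assumes [simp]: "f \<in> Ar M" "f' \<in> Ar M" "g \<in> Ar M" "g' \<in> Ar M" "h \<in> Ar M" "h' \<in> Ar M"
    "src M f' = trg M f" "src M g' = trg M g" "src M h' = trg M h"
  shows "wh [] (assN f' g' h') [(f \<otimes> g) \<otimes> h] ;; wh [f' \<otimes> (g' \<otimes> h')] (assN f g h) [] ;;
      wh [] (contract f' f \<boxtimes> (contract g' g \<boxtimes> contract h' h)) [\<a> (src M f) (src M g) (src M h)] =
    wh [\<a> (trg M f') (trg M g') (trg M h')] ((contract f' f \<boxtimes> contract g' g) \<boxtimes> contract h' h) [] ;;
      assN (f' \<odot> f) (g' \<odot> g) (h' \<odot> h)"
proof -
  have "[] \<lhd> assN f' g' h' \<rhd> [(f \<otimes> g) \<otimes> h] \<Zsemi>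
      [f' \<otimes> (g' \<otimes> h')] \<lhd> assN f g h \<rhd> [] \<Zsemi>
      [] \<lhd> contract f' f \<boxtimes> (contract g' g \<boxtimes> contract h' h) \<rhd> [\<a> (src M f) (src M g) (src M h)] =
      [\<a> (trg M f') (trg M g') (trg M h')] \<lhd> (contract f' f \<boxtimes> contract g' g) \<boxtimes> contract h' h \<rhd> [] \<Zsemi>
      assN (f' \<odot> f) (g' \<odot> g) (h' \<odot> h)"
    unfolding ptens_contract3[OF assms] by (rule ass_nat_comp) auto
  then show ?thesis by (simp add: whisk_wh pvcomp_paste paste_assoc)
qed

lemma assN_one:
  assumes [simp]: "X \<in> Ob M" "Y \<in> Ob M" "Z \<in> Ob M"
  shows "wh [\<a> X Y Z] (oneP (X \<cdot> Y) Z ;; (oneP X Y \<boxtimes> pident [one Z])) [] ;; assN (one X) (one Y) (one Z) =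
    swaps [\<a> X Y Z] ;; wh [] (oneP X (Y \<cdot> Z) ;; (pident [one X] \<boxtimes> oneP Y Z)) [\<a> X Y Z]"
  using ass_nat_one[OF assms]
  by (simp add: split_one_left_ptens split_one_right_ptens swap_swaps whisk_wh pvcomp_paste paste_assoc)

text \<open>On the constant factor, tensoring with \<open>X\<close> contracts \<open>1 1\<close> to \<open>1\<close> by the unitor.\<close>

lemma rtens_contract:
  assumes [simp]: "f \<in> Ar M" "g \<in> Ar M" "src M f = trg M g" "X \<in> Ob M"
  shows "rtens (contract f g) X = contract f g \<boxtimes> luns [one X]"
  by (simp add: ptens_def contract_def luns_def)

lemma rgtN_comp:
  assumes [simp]: "f \<in> Ar M" "g \<in> Ar M" "src M f = trg M g"
  shows "wh [] (rgtN f) [g \<otimes> one I] ;; wh [f] (rgtN g) [] ;; wh [] (contract f g) [\<r> (src M g)] =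
    wh [\<r> (trg M f)] (contract f g \<boxtimes> luns [one I]) [] ;; rgtN (f \<odot> g)"
proof -
  have "[] \<lhd> rgtN f \<rhd> [g \<otimes> one I] \<Zsemi> [f] \<lhd> rgtN g \<rhd> [] \<Zsemi> [] \<lhd> pinv (expand [f, g]) \<rhd> [\<r> (src M g)] =
      [\<r> (trg M f)] \<lhd> rtens (pinv (expand [f, g])) I \<rhd> [] \<Zsemi> rgtN (f \<odot> g)"
    by (rule rgt_nat_comp) auto
  moreover have "pinv (expand [f, g]) = contract f g"
    by (simp add: expand_def contract_def)
  ultimately show ?thesis by (simp add: rtens_contract whisk_wh pvcomp_paste paste_assoc)
qed

lemma rgtN_one:
  assumes [simp]: "X \<in> Ob M"
  shows "wh [\<r> X] (oneP X I) [] ;; rgtN (one X) = swaps [\<r> X]"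
  using rgt_nat_one[OF assms] by (simp add: swap_swaps whisk_wh pvcomp_paste)

lemma single_paste: "\<theta> \<in> Ce M ==> \<phi> \<in> Ce M ==> cdom M \<phi> = ccod M \<theta> ==> single \<theta> ;; single \<phi> = single (\<phi> \<bullet> \<theta>)"
  by (rule pcell_eqI) simp_all

lemma pinv_single: "invertible \<theta> ==> pinvertible (single \<theta>) \<and> pinv (single \<theta>) = single (cinv \<theta>)"
  unfolding pinvertible_def by (auto intro!: pcell_eqI simp: invertible_in)

lemma contract_cell [simp]: "pcell_cell (contract f g) = cid (f \<odot> g)"
  by (simp add: contract_def)

text \<open>Under contraction of paths, horizontal composites of cells become whiskerings. Likewise the
  associator becomes an identity (\<open>assoc_single\<close>), and the unitors become the removal of identity
  arrows (\<open>unit_single\<close>). In this form the tensor product and the constraints of \<open>M(R, R)\<close> enter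
  the calculations with comodules.\<close>

lemma composite_single:
  assumes g: "g \<in> Ce M" "cdom M g = Y" "ccod M g = Y'" and h: "h \<in> Ce M" "cdom M h = Z" "ccod M h = Z'"
    and c: "src M Y = trg M Z"
  shows "contract Y Z ;; single (g \<star> h) = wh [] (single g) [Z] ;; wh [Y'] (single h) [] ;; contract Y' Z'"
proof -
  have [simp]: "Y \<in> Ar M" "Y' \<in> Ar M" "Z \<in> Ar M" "Z' \<in> Ar M" "src M Y' = src M Y" "src M Z' = src M Z"
    "trg M Y' = trg M Y" "trg M Z' = trg M Z"
    using g h cell_simps(1-4) by metis+
  show ?thesis
    by (rule pcell_eqI) (simp_all add: g h c pcell_cell_wh_left pcell_cell_wh_right hcomp_interchange)
qed

lemma assoc_single:
  assumes [simp]: "Y \<in> Ar M" "Z \<in> Ar M" "W \<in> Ar M" "src M Y = trg M Z" "src M Z = trg M W"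
  shows "wh [] (contract Y Z) [W] ;; contract (Y \<odot> Z) W ;; single (bass M Y Z W) = wh [Y] (contract Z W) [] ;; contract Y (Z \<odot> W)"
proof (rule pcell_eqI)
  have a: "pcell_cell (wh [] (contract Y Z) [W]) = cinv (bass M Y Z W)"
    by (simp add: wh_eq lwhisk_def rwhisk_def) (simp add: phcomp_def)
  show "pcell_cell (wh [] (contract Y Z) [W] ;; contract (Y \<odot> Z) W ;; single (bass M Y Z W)) =
      pcell_cell (wh [Y] (contract Z W) [] ;; contract Y (Z \<odot> W))"
    by (simp add: a pcell_cell_wh_left)
qed simp_all

lemma unit_single:
  assumes [simp]: "Y \<in> Ar M"
  shows "contract (one (trg M Y)) Y ;; single (blun M Y) = luns [Y]" "contract Y (one (src M Y)) ;; single (brun M Y) = runs [Y]"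
  by (rule pcell_eqI; simp; simp add: luns_def runs_def)+

end

section \<open>Composition of comodules\<close>

text \<open>An arrow \<open>act : RE \<rightarrow> R\<close> with constraint cells \<open>act2\<close> and \<open>act0\<close> for a product \<open>mul\<close> and a unit \<open>n\<close>
  on \<open>E\<close>, and a monad \<open>(B, \<mu>, \<eta>)\<close> on \<open>E\<close> whose multiplication and unit respect the cells \<open>B2\<close> and
  \<open>B0\<close>. The multiplication is a pasting cell \<open>[B, B] \<Rightarrow> [B]\<close>, and all laws are stated for paths.\<close>

locale comodule_calculus = monoidal_bicategory M
  for M :: "('o, 'a, 'c) tensor_bicat" +
  fixes R E :: 'o and act mul n B :: 'a and act2 act0 B2 B0 mu eta :: "('a, 'c) pcell"
  assumes obs [simp]: "R \<in> Ob M" "E \<in> Ob M"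
    and arrs [simp]: "act \<in> Ar M" "src M act = R \<cdot> E" "trg M act = R"
      "mul \<in> Ar M" "src M mul = E \<cdot> E" "trg M mul = E"
      "n \<in> Ar M" "src M n = I" "trg M n = E" "B \<in> Ar M" "src M B = E" "trg M B = E"
    and act2 [simp]: "valid act2" "psrc act2 = [act, one R \<otimes> mul, \<a> R E E]" "ptrg act2 = [act, act \<otimes> one E]"
    and act0 [simp]: "valid act0" "psrc act0 = [act, one R \<otimes> n]" "ptrg act0 = [\<r> R]"
    and B2 [simp]: "valid B2" "psrc B2 = [B, mul]" "ptrg B2 = [mul, B \<otimes> B]"
    and B0 [simp]: "valid B0" "psrc B0 = [B, n]" "ptrg B0 = [n]"
    and mu [simp]: "valid mu" "psrc mu = [B, B]" "ptrg mu = [B]"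
    and eta [simp]: "valid eta" "psrc eta = [one E]" "ptrg eta = [B]"
    and mu_B2: "wh [] mu [mul] ;; B2 = wh [B] B2 [] ;; wh [] B2 [B \<otimes> B] ;; wh [mul] (mu \<boxtimes> mu) []"
    and mu_B0: "wh [] mu [n] ;; B0 = wh [B] B0 [] ;; B0"
    and eta_B2: "wh [] eta [mul] ;; B2 = pinv (swaps [mul]) ;; wh [mul] (oneP E E ;; (eta \<boxtimes> eta)) []"
    and eta_B0: "wh [] eta [n] ;; B0 = luns [n]"
    and mu_assoc: "wh [] mu [B] ;; mu = wh [B] mu [] ;; mu"
    and mu_eta_left: "wh [] eta [B] ;; mu = luns [B]"
    and mu_eta_right: "wh [B] eta [] ;; mu = runs [B]"
begin

text \<open>The identity arrow on the unit object is kept, so that \<open>B0'\<close> can be tensored with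
  \<open>swaps [Y] : [Y, 1] \<Rightarrow> [1, Y]\<close>.\<close>

definition B0' :: "('a, 'c) pcell" where "B0' = B0 ;; pinv (runs [n])"

lemma B0'_simps [simp]: "valid B0'" "psrc B0' = [B, n]" "ptrg B0' = [n, one I]"
  by (auto simp: B0'_def)

text \<open>The comodule axioms in the strict calculus; \<open>swaps [Y]\<close> and \<open>swaps [B]\<close> are the tensor factors in
  which nothing happens.\<close>

definition comod :: "'a \<Rightarrow> ('a, 'c) pcell \<Rightarrow> bool" where
  "comod Y y \<longleftrightarrow> Y \<in> Ar M \<and> src M Y = R \<and> trg M Y = R \<and>
    valid y \<and> psrc y = [Y, act] \<and> ptrg y = [act, Y \<otimes> B] \<and>
    wh [Y] act2 [] ;; wh [] y [act \<otimes> one E] ;; wh [act] (y \<boxtimes> swaps [B]) [] =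
    wh [] y [one R \<otimes> mul, \<a> R E E] ;; wh [act] (swaps [Y] \<boxtimes> B2) [\<a> R E E] ;;
      wh [act, one R \<otimes> mul] (pinv (assN Y B B)) [] ;; wh [] act2 [(Y \<otimes> B) \<otimes> B] \<and>
    wh [Y] act0 [] = wh [] y [one R \<otimes> n] ;; wh [act] (swaps [Y] \<boxtimes> B0') [] ;;
      wh [] act0 [Y \<otimes> one I] ;; rgtN Y"

lemma comod_act2:
  "comod Y y ==> wh [Y] act2 [] ;; wh [] y [act \<otimes> one E] ;; wh [act] (y \<boxtimes> swaps [B]) [] =
    wh [] y [one R \<otimes> mul, \<a> R E E] ;; wh [act] (swaps [Y] \<boxtimes> B2) [\<a> R E E] ;;
      wh [act, one R \<otimes> mul] (pinv (assN Y B B)) [] ;; wh [] act2 [(Y \<otimes> B) \<otimes> B]"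
  unfolding comod_def by blast

lemma comod_act0:
  "comod Y y ==> wh [Y] act0 [] = wh [] y [one R \<otimes> n] ;; wh [act] (swaps [Y] \<boxtimes> B0') [] ;;
      wh [] act0 [Y \<otimes> one I] ;; rgtN Y"
  unfolding comod_def by blast

text \<open>The coaction \<open>Y(Z(x\<cdot>p)) \<rightarrow> Y(Zx\<cdot>Bp) \<rightarrow> YZx\<cdot>BBp \<rightarrow> YZx\<cdot>Bp\<close>.\<close>

definition composite :: "'a \<Rightarrow> ('a, 'c) pcell \<Rightarrow> 'a \<Rightarrow> ('a, 'c) pcell \<Rightarrow> ('a, 'c) pcell" where
  "composite Y y Z z = wh [] (pinv (contract Y Z)) [act] ;; wh [Y] z [] ;; wh [] y [Z \<otimes> B] ;;
     wh [act] (contract Y Z \<boxtimes> mu) []"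

text \<open>The coaction \<open>x\<cdot>p \<rightarrow> x\<cdot>Bp\<close>, with the identity of \<open>RE\<close> moved past \<open>act\<close> and then written as a tensor
  product.\<close>

definition unit_coaction :: "('a, 'c) pcell" where
  "unit_coaction = pinv (swaps [act]) ;; wh [act] (oneP R E ;; (pident [one R] \<boxtimes> eta)) []"

text \<open>The law \<open>mu_B0\<close> for the cell \<open>B0'\<close>: two applications of \<open>B0'\<close> produce two identity arrows, one of
  which has to be absorbed.\<close>

lemma mu_B0':
  "wh [] mu [n] ;; B0' = wh [B] B0' [] ;; wh [] B0' [one I] ;; wh [n] (luns [one I]) []"
proof -
  have a: "wh [] (pinv (runs [n])) [one I] ;; wh [n] (luns [one I]) [] = pident [n, one I]"
    using luns_runs_middle[of n "[one I]"] by (simp add: wh_paste[symmetric] wh_pident)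
  have b: "runs [B, n] = wh [B] (runs [n]) []" by (rule runs_Cons) auto
  have "wh [] B0 [one I] ;; runs [n] = runs [B, n] ;; B0"
    using runs_natural[OF _ refl, of B0] by simp
  then have "wh [B] (pinv (runs [n])) [] ;; wh [] B0 [one I] ;; runs [n] ;; pinv (runs [n]) =
      wh [B] (pinv (runs [n])) [] ;; runs [B, n] ;; B0 ;; pinv (runs [n])"
    by (metis paste_assoc)
  then have c: "wh [B] (pinv (runs [n])) [] ;; wh [] B0 [one I] = B0 ;; pinv (runs [n])"
    unfolding b by (simp add: wh_pinv del: paste_pident) (simp add: b)
  have "wh [B] B0' [] ;; wh [] B0' [one I] ;; wh [n] (luns [one I]) [] =
    wh [B] B0 [] ;; (wh [B] (pinv (runs [n])) [] ;; wh [] B0 [one I]) ;;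
      (wh [] (pinv (runs [n])) [one I] ;; wh [n] (luns [one I]) [])"
    unfolding B0'_def wh_paste by (simp add: paste_assoc)
  also have "\<dots> = wh [B] B0 [] ;; B0 ;; pinv (runs [n])"
    unfolding a c by (simp add: paste_assoc)
  also have "\<dots> = wh [] mu [n] ;; B0'"
    unfolding B0'_def by (simp only: paste_assoc[symmetric] mu_B0)
  finally show ?thesis by simp
qed

text \<open>Compatibility of the associator with composition of arrows and its naturality at \<open>\<mu>\<close>.\<close>

lemma assN_mu:
  assumes [simp]: "Y \<in> Ar M" "Z \<in> Ar M" "src M Y = trg M Z"
    and X: "X = src M Z" "X' = trg M Y"
  shows "wh [Y \<otimes> (B \<otimes> B)] (pinv (assN Z B B)) [] ;; wh [] (pinv (assN Y B B)) [(Z \<otimes> B) \<otimes> B] ;;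
      wh [\<a> X' E E] ((contract Y Z \<boxtimes> mu) \<boxtimes> mu) [] =
    wh [] (contract Y Z \<boxtimes> (mu \<boxtimes> mu)) [\<a> X E E] ;; pinv (assN (Y \<odot> Z) B B)"
proof -
  define m where "m = pinv (contract B B) ;; mu"
  have m [simp]: "valid m" "psrc m = [B \<odot> B]" "ptrg m = [B]" by (auto simp: m_def)
  have mu_m: "mu = contract B B ;; m" by (simp add: m_def)
  have e1: "(contract Y Z \<boxtimes> mu) \<boxtimes> mu = ((contract Y Z \<boxtimes> contract B B) \<boxtimes> contract B B) ;; ((pident [Y \<odot> Z] \<boxtimes> m) \<boxtimes> m)"
    unfolding mu_m by (simp add: ptens_paste[symmetric])
  have e2: "contract Y Z \<boxtimes> (mu \<boxtimes> mu) = (contract Y Z \<boxtimes> (contract B B \<boxtimes> contract B B)) ;; (pident [Y \<odot> Z] \<boxtimes> (m \<boxtimes> m))"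
    unfolding mu_m by (simp add: ptens_paste[symmetric])
  have n: "wh [\<a> X' E E] ((pident [Y \<odot> Z] \<boxtimes> m) \<boxtimes> m) [] ;; assN (Y \<odot> Z) B B =
      assN (Y \<odot> Z) (B \<odot> B) (B \<odot> B) ;; wh [] (pident [Y \<odot> Z] \<boxtimes> (m \<boxtimes> m)) [\<a> X E E]"
    using assN_natural[of "pident [Y \<odot> Z]" m m "Y \<odot> Z" "B \<odot> B" "B \<odot> B" "Y \<odot> Z" B B] by (simp add: X)
  have c: "wh [] (assN Y B B) [(Z \<otimes> B) \<otimes> B] ;; wh [Y \<otimes> (B \<otimes> B)] (assN Z B B) [] ;;
      wh [] (contract Y Z \<boxtimes> (contract B B \<boxtimes> contract B B)) [\<a> X E E] =
    wh [\<a> X' E E] ((contract Y Z \<boxtimes> contract B B) \<boxtimes> contract B B) [] ;; assN (Y \<odot> Z) (B \<odot> B) (B \<odot> B)"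
    using assN_comp[of Z Y B B B B] by (simp add: X)
  have "wh [] (assN Y B B) [(Z \<otimes> B) \<otimes> B] ;; wh [Y \<otimes> (B \<otimes> B)] (assN Z B B) [] ;;
      wh [] (contract Y Z \<boxtimes> (mu \<boxtimes> mu)) [\<a> X E E] =
    wh [\<a> X' E E] ((contract Y Z \<boxtimes> mu) \<boxtimes> mu) [] ;; assN (Y \<odot> Z) B B"
    unfolding e1 e2 wh_paste paste_assoc n by (simp only: c[THEN paste_app, unfolded paste_assoc])
  then have "wh [Y \<otimes> (B \<otimes> B)] (pinv (assN Z B B)) [] ;; wh [] (pinv (assN Y B B)) [(Z \<otimes> B) \<otimes> B] ;;
    (wh [] (assN Y B B) [(Z \<otimes> B) \<otimes> B] ;; wh [Y \<otimes> (B \<otimes> B)] (assN Z B B) [] ;;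
      wh [] (contract Y Z \<boxtimes> (mu \<boxtimes> mu)) [\<a> X E E]) ;; pinv (assN (Y \<odot> Z) B B) =
    wh [Y \<otimes> (B \<otimes> B)] (pinv (assN Z B B)) [] ;; wh [] (pinv (assN Y B B)) [(Z \<otimes> B) \<otimes> B] ;;
    (wh [\<a> X' E E] ((contract Y Z \<boxtimes> mu) \<boxtimes> mu) [] ;; assN (Y \<odot> Z) B B) ;; pinv (assN (Y \<odot> Z) B B)"
    by simp
  then show ?thesis by (simp add: paste_assoc wh_pinv X)
qed

context
  fixes Y y Z z
  assumes Y: "comod Y y" and Z: "comod Z z"
begin

lemma arrows [simp]: "Y \<in> Ar M" "src M Y = R" "trg M Y = R" "Z \<in> Ar M" "src M Z = R" "trg M Z = R"
  and coactions [simp]: "valid y" "psrc y = [Y, act]" "ptrg y = [act, Y \<otimes> B]"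
    "valid z" "psrc z = [Z, act]" "ptrg z = [act, Z \<otimes> B]"
  using Y Z unfolding comod_def by auto

abbreviation "c \<equiv> contract Y Z"

text \<open>The composite coaction without the contraction of its source. Calculations start from the path
  \<open>[Y, Z, act, \<dots>]\<close> instead of \<open>[Y \<odot> Z, act, \<dots>]\<close>; this loses nothing, since contraction is
  invertible.\<close>

abbreviation "K \<equiv> wh [Y] z [] ;; wh [] y [Z \<otimes> B] ;; wh [act] (c \<boxtimes> mu) []"

lemma composite_simps [simp]:
  "valid (composite Y y Z z)" "psrc (composite Y y Z z) = [Y \<odot> Z, act]"
  "ptrg (composite Y y Z z) = [act, (Y \<odot> Z) \<otimes> B]"
  unfolding composite_def by simp_all

lemma contract_composite: "wh [] c [act] ;; composite Y y Z z = K"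
  unfolding composite_def by (simp add: wh_pinv)

lemma swaps_contract: "wh [] c [one R] ;; swaps [Y \<odot> Z] = wh [Y] (swaps [Z]) [] ;; wh [] (swaps [Y]) [Z] ;; wh [one R] c []"
proof -
  have "swaps [Y, Z] = wh [Y] (swaps [Z]) [] ;; wh [] (swaps [Y]) [Z]"
    by (rule swaps_Cons) simp_all
  then show ?thesis
    using swaps_natural[OF _ refl refl, of c] by (simp add: paste_assoc)
qed

lemma swaps_mu: "wh [] mu [one E] ;; swaps [B] = wh [B] (swaps [B]) [] ;; wh [] (swaps [B]) [B] ;; wh [one E] mu []"
proof -
  have "swaps [B, B] = wh [B] (swaps [B]) [] ;; wh [] (swaps [B]) [B]"
    by (rule swaps_Cons) simp_all
  then show ?thesis
    using swaps_natural[OF _ refl refl, of mu] by (simp add: paste_assoc)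
qed

text \<open>Splitting the second coaction into its three parts reduces the left hand side to the left hand
  side of the axiom for \<open>Z\<close>, followed by that of the axiom for \<open>Y\<close>, followed by two copies of \<open>\<mu>\<close>. On
  the right hand sides the two copies of \<open>B2\<close> and of \<open>\<mu>\<close> combine by \<open>mu_B2\<close> to a single \<open>B2\<close> preceded
  by one \<open>\<mu>\<close>.\<close>

lemma composite_act2:
  "wh [Y \<odot> Z] act2 [] ;; wh [] (composite Y y Z z) [act \<otimes> one E] ;; wh [act] (composite Y y Z z \<boxtimes> swaps [B]) [] =
    wh [] (composite Y y Z z) [one R \<otimes> mul, \<a> R E E] ;; wh [act] (swaps [Y \<odot> Z] \<boxtimes> B2) [\<a> R E E] ;;
      wh [act, one R \<otimes> mul] (pinv (assN (Y \<odot> Z) B B)) [] ;; wh [] act2 [((Y \<odot> Z) \<otimes> B) \<otimes> B]"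
  (is "?L = ?R")
proof -
  let ?k = "composite Y y Z z" and ?a = "\<a> R E E" and ?S = "swaps [B]" and ?i = "one R \<otimes> mul"
    and ?Y = "(Y \<otimes> B) \<otimes> B" and ?Z = "(Z \<otimes> B) \<otimes> B"
  let ?mm = "(c \<boxtimes> mu) \<boxtimes> mu" and ?mm' = "c \<boxtimes> (mu \<boxtimes> mu)"
  let ?NY = "pinv (assN Y B B)" and ?NZ = "pinv (assN Z B B)" and ?N = "pinv (assN (Y \<odot> Z) B B)"
  have a: "wh [] c [act, ?i, ?a] ;; wh [Y \<odot> Z] act2 [] = wh [Y, Z] act2 [] ;; wh [] c [act, act \<otimes> one E]"
    using wh_interchange[of "[]" c "[]" act2 "[]"] by simp
  have k: "wh [] c (act # vs) ;; wh [] ?k vs = wh [Y] z vs ;; wh [] y ((Z \<otimes> B) # vs) ;; wh [act] (c \<boxtimes> mu) vs" for vs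
    using arg_cong[OF contract_composite, of "\<lambda>P. wh [] P vs"] by (simp add: wh_paste)
  have b: "wh [] (c \<boxtimes> mu) [act \<otimes> one E] ;; (?k \<boxtimes> ?S) =
      wh [Y \<otimes> B] (z \<boxtimes> ?S) [] ;; wh [] (y \<boxtimes> ?S) [?Z] ;; wh [act \<otimes> one E] ?mm []"
  proof -
    have "wh [] (c \<boxtimes> mu) [act \<otimes> one E] ;; (?k \<boxtimes> ?S) = (wh [] c [act] ;; ?k) \<boxtimes> (wh [] mu [one E] ;; ?S)"
      by (simp add: ptens_paste ptens_wh)
    also have "\<dots> = wh [Y \<otimes> B] (z \<boxtimes> ?S) [] ;; wh [] (y \<boxtimes> ?S) [?Z] ;; wh [act \<otimes> one E] ?mm []"
      unfolding contract_composite swaps_mu by (simp add: ptens_paste ptens_wh)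
    finally show ?thesis .
  qed
  note b' = b[THEN wh_cong, of "[act]" "[]", unfolded wh_simps]
  have i1: "wh [] y [Z \<otimes> B, act \<otimes> one E] ;; wh [act, Y \<otimes> B] (z \<boxtimes> ?S) [] =
      wh [Y, act] (z \<boxtimes> ?S) [] ;; wh [] y [act \<otimes> one E, ?Z]"
    using wh_interchange[of "[]" y "[]" "z \<boxtimes> ?S" "[]"] by simp
  note zc = comod_act2[OF Z, THEN wh_cong, of "[Y]" "[]", unfolded wh_simps]
  note yc = comod_act2[OF Y, THEN wh_cong, of "[]" "[?Z]", unfolded wh_simps]
  have i2: "wh [] act2 [?Y, ?Z] ;; wh [act, act \<otimes> one E] ?mm [] =
      wh [act, ?i, ?a] ?mm [] ;; wh [] act2 [((Y \<odot> Z) \<otimes> B) \<otimes> B]"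
    using wh_interchange[of "[]" act2 "[]" ?mm "[]"] by simp
  have n1: "wh [act, ?i, Y \<otimes> (B \<otimes> B)] ?NZ [] ;; wh [act, ?i] ?NY [?Z] ;; wh [act, ?i, ?a] ?mm [] =
      wh [act, ?i] ?mm' [?a] ;; wh [act, ?i] ?N []"
    using arg_cong[OF assN_mu[of Y Z, OF _ _ _ refl refl], of "\<lambda>P. wh [act, ?i] P []"] by (simp add: wh_paste)
  have i3: "wh [Y, act] (swaps [Z] \<boxtimes> B2) [?a] ;; wh [Y, act, ?i] ?NZ [] ;; wh [] y [?i, ?a, ?Z] =
      wh [] y [Z \<otimes> B, ?i, ?a] ;; wh [act, Y \<otimes> B] (swaps [Z] \<boxtimes> B2) [?a] ;; wh [act, Y \<otimes> B, ?i] ?NZ []"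
    using wh_interchange[of "[]" y "[]" "wh [] (swaps [Z] \<boxtimes> B2) [?a] ;; wh [?i] ?NZ []" "[]"]
    by (simp add: wh_paste paste_assoc)
  have i4: "wh [act, Y \<otimes> B, ?i] ?NZ [] ;; wh [act] (swaps [Y] \<boxtimes> B2) [?a, ?Z] =
      wh [act] (swaps [Y] \<boxtimes> B2) [Z \<otimes> (B \<otimes> B), ?a] ;; wh [act, ?i, Y \<otimes> (B \<otimes> B)] ?NZ []"
    using wh_interchange[of "[act]" "swaps [Y] \<boxtimes> B2" "[]" ?NZ "[]"] by simp
  have s0: "wh [Y \<otimes> B] (swaps [Z] \<boxtimes> B2) [] ;; wh [] (swaps [Y] \<boxtimes> B2) [Z \<otimes> (B \<otimes> B)] ;; wh [?i] ?mm' [] =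
      wh [] (c \<boxtimes> mu) [?i] ;; (swaps [Y \<odot> Z] \<boxtimes> B2)"
  proof -
    have "wh [] (c \<boxtimes> mu) [?i] ;; (swaps [Y \<odot> Z] \<boxtimes> B2) =
      (wh [] c [one R] ;; swaps [Y \<odot> Z]) \<boxtimes> (wh [] mu [mul] ;; B2)"
      by (simp add: ptens_paste ptens_wh)
    also have "\<dots> = wh [Y \<otimes> B] (swaps [Z] \<boxtimes> B2) [] ;; wh [] (swaps [Y] \<boxtimes> B2) [Z \<otimes> (B \<otimes> B)] ;; wh [?i] ?mm' []"
      unfolding mu_B2 swaps_contract by (simp add: ptens_paste ptens_wh)
    finally show ?thesis by simp
  qed
  note s1 = s0[THEN wh_cong, of "[act]" "[?a]", unfolded wh_simps]
  \<comment> \<open>expand \<open>Y \<odot> Z\<close>, split both coactions\<close>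
  have "wh [] c [act, ?i, ?a] ;; ?L =
     wh [Y, Z] act2 [] ;; wh [Y] z [act \<otimes> one E] ;; wh [] y [Z \<otimes> B, act \<otimes> one E] ;;
     wh [act, Y \<otimes> B] (z \<boxtimes> ?S) [] ;; wh [act] (y \<boxtimes> ?S) [?Z] ;; wh [act, act \<otimes> one E] ?mm []"
    by (simp only: paste_assoc a[THEN paste_app, unfolded paste_assoc] k[THEN paste_app, unfolded paste_assoc] b')
  \<comment> \<open>the axiom for \<open>Z\<close> whiskered by \<open>Y\<close>, then the axiom for \<open>Y\<close>\<close>
  also have "\<dots> = wh [Y] z [?i, ?a] ;; wh [Y, act] (swaps [Z] \<boxtimes> B2) [?a] ;; wh [Y, act, ?i] ?NZ [] ;;
      wh [] y [?i, ?a, ?Z] ;; wh [act] (swaps [Y] \<boxtimes> B2) [?a, ?Z] ;; wh [act, ?i] ?NY [?Z] ;;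
      wh [act, ?i, ?a] ?mm [] ;; wh [] act2 [((Y \<odot> Z) \<otimes> B) \<otimes> B]"
    by (simp only: paste_assoc i1[THEN paste_app, unfolded paste_assoc] zc[THEN paste_app, unfolded paste_assoc]
        yc[THEN paste_app, unfolded paste_assoc] i2)
  \<comment> \<open>collect the coactions in front, and move \<open>\<mu>\<close> past the associators\<close>
  also have "\<dots> = wh [Y] z [?i, ?a] ;; wh [] y [Z \<otimes> B, ?i, ?a] ;;
      wh [act, Y \<otimes> B] (swaps [Z] \<boxtimes> B2) [?a] ;; wh [act] (swaps [Y] \<boxtimes> B2) [Z \<otimes> (B \<otimes> B), ?a] ;;
      wh [act, ?i] ?mm' [?a] ;; wh [act, ?i] ?N [] ;; wh [] act2 [((Y \<odot> Z) \<otimes> B) \<otimes> B]"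
    by (simp only: paste_assoc i3[THEN paste_app, unfolded paste_assoc] i4[THEN paste_app, unfolded paste_assoc]
        n1[THEN paste_app, unfolded paste_assoc])
  also have "\<dots> = wh [] c [act, ?i, ?a] ;; ?R"
    by (simp only: paste_assoc s1[THEN paste_app, unfolded paste_assoc] k[THEN paste_app, unfolded paste_assoc])
  finally show ?thesis
    by (rule paste_cancel_left[rotated]) simp_all
qed

text \<open>The same argument for the unit, with \<open>mu_B0'\<close> in place of \<open>mu_B2\<close> and compatibility of the right
  unit of the monoidal bicategory with composition.\<close>

lemma composite_act0:
  "wh [Y \<odot> Z] act0 [] = wh [] (composite Y y Z z) [one R \<otimes> n] ;; wh [act] (swaps [Y \<odot> Z] \<boxtimes> B0') [] ;;
      wh [] act0 [(Y \<odot> Z) \<otimes> one I] ;; rgtN (Y \<odot> Z)"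
  (is "?L = ?R")
proof -
  let ?k = "composite Y y Z z" and ?i = "one R \<otimes> n" and ?Z = "Z \<otimes> one I" and ?Y = "Y \<otimes> one I"
  let ?l = "c \<boxtimes> luns [one I]"
  have a: "wh [] c [act, ?i] ;; wh [Y \<odot> Z] act0 [] = wh [Y, Z] act0 [] ;; wh [] c [\<r> R]"
    using wh_interchange[of "[]" c "[]" act0 "[]"] by simp
  note k = contract_composite[THEN wh_cong, of "[]" "[?i]", unfolded wh_simps]
  have s0: "wh [] (c \<boxtimes> mu) [?i] ;; (swaps [Y \<odot> Z] \<boxtimes> B0') =
      wh [Y \<otimes> B] (swaps [Z] \<boxtimes> B0') [] ;; wh [] (swaps [Y] \<boxtimes> B0') [?Z] ;; wh [?i] ?l []"
  proof -
    have "wh [] (c \<boxtimes> mu) [?i] ;; (swaps [Y \<odot> Z] \<boxtimes> B0') =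
      (wh [] c [one R] ;; swaps [Y \<odot> Z]) \<boxtimes> (wh [] mu [n] ;; B0')"
      by (simp add: ptens_paste ptens_wh)
    also have "\<dots> = wh [Y \<otimes> B] (swaps [Z] \<boxtimes> B0') [] ;; wh [] (swaps [Y] \<boxtimes> B0') [?Z] ;; wh [?i] ?l []"
      unfolding mu_B0' swaps_contract by (simp add: ptens_paste ptens_wh)
    finally show ?thesis .
  qed
  note s1 = s0[THEN wh_cong, of "[act]" "[]", unfolded wh_simps]
  have i1: "wh [] y [Z \<otimes> B, ?i] ;; wh [act, Y \<otimes> B] (swaps [Z] \<boxtimes> B0') [] =
      wh [Y, act] (swaps [Z] \<boxtimes> B0') [] ;; wh [] y [?i, ?Z]"
    using wh_interchange[of "[]" y "[]" "swaps [Z] \<boxtimes> B0'" "[]"] by simp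
  have i2: "wh [act, ?i] ?l [] ;; wh [] act0 [(Y \<odot> Z) \<otimes> one I] = wh [] act0 [?Y, ?Z] ;; wh [\<r> R] ?l []"
    using wh_interchange[of "[]" act0 "[]" ?l "[]"] by simp
  have r: "wh [\<r> R] ?l [] ;; rgtN (Y \<odot> Z) = wh [] (rgtN Y) [?Z] ;; wh [Y] (rgtN Z) [] ;; wh [] c [\<r> R]"
    using rgtN_comp[of Y Z] by simp
  note yc = comod_act0[OF Y, symmetric, THEN wh_cong, of "[]" "[?Z]", unfolded wh_simps]
  note zc = comod_act0[OF Z, symmetric, THEN wh_cong, of "[Y]" "[]", unfolded wh_simps]
  have "wh [] c [act, ?i] ;; ?R = wh [Y] z [?i] ;; wh [] y [Z \<otimes> B, ?i] ;;
      wh [act, Y \<otimes> B] (swaps [Z] \<boxtimes> B0') [] ;; wh [act] (swaps [Y] \<boxtimes> B0') [?Z] ;; wh [act, ?i] ?l [] ;;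
      wh [] act0 [(Y \<odot> Z) \<otimes> one I] ;; rgtN (Y \<odot> Z)"
    by (simp only: paste_assoc k[THEN paste_app, unfolded paste_assoc] s1[THEN paste_app, unfolded paste_assoc])
  also have "\<dots> = wh [Y] z [?i] ;; wh [Y, act] (swaps [Z] \<boxtimes> B0') [] ;; wh [] y [?i, ?Z] ;;
      wh [act] (swaps [Y] \<boxtimes> B0') [?Z] ;; wh [] act0 [?Y, ?Z] ;; wh [] (rgtN Y) [?Z] ;; wh [Y] (rgtN Z) [] ;; wh [] c [\<r> R]"
    by (simp only: paste_assoc i1[THEN paste_app, unfolded paste_assoc] i2[THEN paste_app, unfolded paste_assoc] r)
  also have "\<dots> = wh [] c [act, ?i] ;; ?L"
    by (simp only: paste_assoc yc[THEN paste_app, unfolded paste_assoc] zc[THEN paste_app, unfolded paste_assoc] a)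
  finally show ?thesis
    by (rule paste_cancel_left[rotated, symmetric]) simp_all
qed

lemma comod_composite: "comod (Y \<odot> Z) (composite Y y Z z)"
  unfolding comod_def using composite_act2 composite_act0 by simp

end

section \<open>The unit comodule\<close>

lemma unit_coaction_simps [simp]:
  "valid unit_coaction" "psrc unit_coaction = [one R, act]" "ptrg unit_coaction = [act, one R \<otimes> B]"
  unfolding unit_coaction_def by simp_all

text \<open>The part \<open>1 \<cong> 1 \<otimes> 1 \<Rightarrow> 1 \<otimes> B\<close> of the coaction of the identity arrow.\<close>

abbreviation "insert_unit \<equiv> oneP R E ;; (pident [one R] \<boxtimes> eta)"

text \<open>Both sides insert \<open>(1 \<otimes> \<eta>) \<otimes> \<eta>\<close> in front of \<open>act2\<close>. On the left the two units come from the two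
  coactions. On the right there is one coaction, whose unit is doubled by \<open>eta_B2\<close> and moved
  past the associator by naturality of the latter. In all cases the identity arrows travel along
  paths by \<open>swaps\<close>.\<close>

lemma unit_act2:
  "wh [one R] act2 [] ;; wh [] unit_coaction [act \<otimes> one E] ;; wh [act] (unit_coaction \<boxtimes> swaps [B]) [] =
    wh [] unit_coaction [one R \<otimes> mul, \<a> R E E] ;; wh [act] (swaps [one R] \<boxtimes> B2) [\<a> R E E] ;;
      wh [act, one R \<otimes> mul] (pinv (assN (one R) B B)) [] ;; wh [] act2 [(one R \<otimes> B) \<otimes> B]"
  (is "?L = ?R")
proof -
  let ?k = unit_coaction and ?a = "\<a> R E E" and ?i = "one R \<otimes> mul" and ?j = "act \<otimes> one E"
  let ?o = insert_unit and ?B = "(one R \<otimes> B) \<otimes> B"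
  let ?o3 = "oneP (R \<cdot> E) E ;; (?o \<boxtimes> eta)"
  let ?e = "oneP E E ;; (eta \<boxtimes> eta)"
  let ?o3' = "oneP R (E \<cdot> E) ;; (pident [one R] \<boxtimes> ?e)"
  have one [simp]: "swaps [one R] = pident [one R, one R]" "swaps [one E] = pident [one E, one E]"
    by (simp_all add: swaps_one)
  have k: "wh us ?k vs = wh us (pinv (swaps [act])) vs ;; wh (us @ [act]) ?o vs" for us vs
    unfolding unit_coaction_def by (simp add: wh_paste)
  have eta_B: "wh [] eta [one E] ;; swaps [B] = wh [one E] eta []"
    using swaps_natural[OF _ refl refl, of eta] by simp
  have e1: "wh [] ?o [?j] ;; (?k \<boxtimes> swaps [B]) = pinv (swaps [?j]) ;; wh [?j] ?o3 []"
  proof -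
    have "wh [] (pident [one R] \<boxtimes> eta) [?j] = pident [one R, act] \<boxtimes> wh [] eta [one E]"
      using ptens_wh[of "[]" "pident [one R]" "[act]" "[]" eta "[one E]"] by (simp add: wh_pident)
    then have "wh [] (pident [one R] \<boxtimes> eta) [?j] ;; (?k \<boxtimes> swaps [B]) = ?k \<boxtimes> wh [one E] eta []"
      by (simp add: ptens_paste[symmetric] eta_B)
    also have "\<dots> = (pinv (swaps [act]) ;; wh [act] ?o []) \<boxtimes> (pinv (swaps [one E]) ;; wh [one E] eta [])"
      unfolding unit_coaction_def by (simp add: pinv_pident)
    also have "\<dots> = (pinv (swaps [act]) \<boxtimes> pinv (swaps [one E])) ;; wh [?j] (?o \<boxtimes> eta) []"
      by (subst ptens_paste) (simp_all add: ptens_wh pinv_pident del: one)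
    finally have "wh [] ?o [?j] ;; (?k \<boxtimes> swaps [B]) =
      (wh [] (oneP R E) [?j] ;; (pinv (swaps [act]) \<boxtimes> pinv (swaps [one E]))) ;; wh [?j] (?o \<boxtimes> eta) []"
      by (simp only: wh_paste paste_assoc)
    also have "\<dots> = pinv (swaps [?j]) ;; wh [?j] ?o3 []"
      using pinv_swaps_tens[OF _ _ refl refl refl refl, of act "one E"] by (simp add: wh_paste paste_assoc del: one)
    finally show ?thesis .
  qed
  have e1': "wh [act] ?o [?j] ;; wh [act] (?k \<boxtimes> swaps [B]) [] = wh [act] (pinv (swaps [?j])) [] ;; wh [act, ?j] ?o3 []"
    using arg_cong[OF e1, of "\<lambda>P. wh [act] P []"] by (simp only: wh_simps)
  have q: "wh [] (pinv (swaps [act])) [?j] ;; wh [act] (pinv (swaps [?j])) [] = pinv (swaps [act, ?j])"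
    using pinv_swaps_Cons[of act "[?j]"] by simp
  have nat: "wh [one R] act2 [] ;; pinv (swaps [act, ?j]) = pinv (swaps [act, ?i, ?a]) ;; wh [] act2 [one ((R \<cdot> E) \<cdot> E)]"
    using pinv_swaps_natural[OF _ refl refl, of act2] by simp
  have inter: "wh [] act2 [one ((R \<cdot> E) \<cdot> E)] ;; wh [act, ?j] ?o3 [] = wh [act, ?i, ?a] ?o3 [] ;; wh [] act2 [?B]"
    using wh_interchange[of "[]" act2 "[]" ?o3 "[]"] by simp
  have "?L = wh [one R] act2 [] ;; wh [] (pinv (swaps [act])) [?j] ;; wh [act] ?o [?j] ;; wh [act] (?k \<boxtimes> swaps [B]) []"
    unfolding k[of "[]" "[?j]"] by (simp only: paste_assoc append_Nil)
  also have "\<dots> = wh [one R] act2 [] ;; wh [] (pinv (swaps [act])) [?j] ;; wh [act] (pinv (swaps [?j])) [] ;; wh [act, ?j] ?o3 []"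
    by (simp only: e1')
  also have "\<dots> = pinv (swaps [act, ?i, ?a]) ;; wh [act, ?i, ?a] ?o3 [] ;; wh [] act2 [?B]"
    by (simp only: q[THEN paste_app, unfolded paste_assoc] nat[THEN paste_app, unfolded paste_assoc] inter)
  finally have L: "?L = \<dots>" .
  have e2: "wh [] ?o [?i] ;; (swaps [one R] \<boxtimes> B2) = pinv (swaps [?i]) ;; wh [?i] ?o3' []"
  proof -
    have "wh [] (pident [one R] \<boxtimes> eta) [?i] = pident [one R, one R] \<boxtimes> wh [] eta [mul]"
      using ptens_wh[of "[]" "pident [one R]" "[one R]" "[]" eta "[mul]"] by (simp add: wh_pident)
    then have "wh [] (pident [one R] \<boxtimes> eta) [?i] ;; (swaps [one R] \<boxtimes> B2) = swaps [one R] \<boxtimes> (pinv (swaps [mul]) ;; wh [mul] ?e [])"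
      by (simp add: ptens_paste[symmetric] eta_B2)
    also have "\<dots> = (pinv (swaps [one R]) ;; wh [one R] (pident [one R]) []) \<boxtimes> (pinv (swaps [mul]) ;; wh [mul] ?e [])"
      by (simp add: pinv_pident wh_pident)
    also have "\<dots> = (pinv (swaps [one R]) \<boxtimes> pinv (swaps [mul])) ;; wh [?i] (pident [one R] \<boxtimes> ?e) []"
      by (subst ptens_paste) (simp_all add: ptens_wh del: one)
    finally have "wh [] ?o [?i] ;; (swaps [one R] \<boxtimes> B2) =
      (wh [] (oneP R E) [?i] ;; (pinv (swaps [one R]) \<boxtimes> pinv (swaps [mul]))) ;; wh [?i] (pident [one R] \<boxtimes> ?e) []"
      by (simp only: wh_paste paste_assoc)
    also have "\<dots> = pinv (swaps [?i]) ;; wh [?i] ?o3' []"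
      using pinv_swaps_tens[OF _ _ refl refl refl refl, of "one R" mul] by (simp add: wh_paste paste_assoc del: one)
    finally show ?thesis .
  qed
  have e2': "wh [act] ?o [?i, ?a] ;; wh [act] (swaps [one R] \<boxtimes> B2) [?a] = wh [act] (pinv (swaps [?i])) [?a] ;; wh [act, ?i] ?o3' [?a]"
    using arg_cong[OF e2, of "\<lambda>P. wh [act] P [?a]"] by (simp only: wh_simps)
  have e3: "wh [] ?o3' [?a] ;; pinv (assN (one R) B B) = pinv (swaps [?a]) ;; wh [?a] ?o3 []"
  proof -
    have o3: "?o3 = (oneP (R \<cdot> E) E ;; (oneP R E \<boxtimes> pident [one E])) ;; ((pident [one R] \<boxtimes> eta) \<boxtimes> eta)"
      by (simp add: paste_assoc ptens_paste[symmetric])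
    have o3': "?o3' = (oneP R (E \<cdot> E) ;; (pident [one R] \<boxtimes> oneP E E)) ;; (pident [one R] \<boxtimes> (eta \<boxtimes> eta))"
      by (simp add: paste_assoc ptens_paste[symmetric])
    have n: "wh [?a] ((pident [one R] \<boxtimes> eta) \<boxtimes> eta) [] ;; assN (one R) B B =
        assN (one R) (one E) (one E) ;; wh [] (pident [one R] \<boxtimes> (eta \<boxtimes> eta)) [?a]"
      using assN_natural[of "pident [one R]" eta eta "one R" "one E" "one E" "one R" B B] by simp
    have "wh [?a] ?o3 [] ;; assN (one R) B B = swaps [?a] ;; wh [] ?o3' [?a]"
      unfolding o3 o3'
      by (simp only: wh_paste paste_assoc n paste_app[OF assN_one[OF obs(1) obs(2) obs(2)], unfolded wh_paste paste_assoc])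
    then have "pinv (swaps [?a]) ;; (wh [?a] ?o3 [] ;; assN (one R) B B) ;; pinv (assN (one R) B B) =
      pinv (swaps [?a]) ;; (swaps [?a] ;; wh [] ?o3' [?a]) ;; pinv (assN (one R) B B)" by simp
    then show ?thesis by (simp add: paste_assoc)
  qed
  have e3': "wh [act, ?i] ?o3' [?a] ;; wh [act, ?i] (pinv (assN (one R) B B)) [] = wh [act, ?i] (pinv (swaps [?a])) [] ;; wh [act, ?i, ?a] ?o3 []"
    using arg_cong[OF e3, of "\<lambda>P. wh [act, ?i] P []"] by (simp only: wh_simps)
  have q': "wh [] (pinv (swaps [act])) [?i, ?a] ;; wh [act] (pinv (swaps [?i])) [?a] ;; wh [act, ?i] (pinv (swaps [?a])) [] = pinv (swaps [act, ?i, ?a])"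
    using pinv_swaps_Cons[of act "[?i, ?a]"] pinv_swaps_Cons[of ?i "[?a]"] by (simp add: wh_paste)
  have "?R = wh [] (pinv (swaps [act])) [?i, ?a] ;; wh [act] (pinv (swaps [?i])) [?a] ;; wh [act, ?i] (pinv (swaps [?a])) [] ;;
      wh [act, ?i, ?a] ?o3 [] ;; wh [] act2 [?B]"
    unfolding k[of "[]" "[?i, ?a]"]
    by (simp only: paste_assoc append_Nil e2'[THEN paste_app, unfolded paste_assoc] e3'[THEN paste_app, unfolded paste_assoc])
  also have "\<dots> = ?L"
    unfolding L by (simp only: q'[THEN paste_app, unfolded paste_assoc])
  finally show ?thesis by simp
qed

text \<open>By \<open>eta_B0\<close> the unit of the monad disappears, and what remains is transport of an identity arrow
  past \<open>act0\<close>.\<close>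

lemma unit_act0:
  "wh [one R] act0 [] = wh [] unit_coaction [one R \<otimes> n] ;; wh [act] (swaps [one R] \<boxtimes> B0') [] ;;
      wh [] act0 [one R \<otimes> one I] ;; rgtN (one R)"
  (is "?L = ?R")
proof -
  let ?k = unit_coaction and ?i = "one R \<otimes> n" and ?o = insert_unit
  have one [simp]: "swaps [one R] = pident [one R, one R]"
    by (simp_all add: swaps_one)
  have k: "wh [] ?k [?i] = wh [] (pinv (swaps [act])) [?i] ;; wh [act] ?o [?i]"
    unfolding unit_coaction_def by (simp add: wh_paste)
  have n: "wh [] eta [n] ;; B0' = pinv (swaps [n])"
    unfolding B0'_def using paste_app[OF eta_B0] by (simp add: paste_assoc pinv_swaps)
  have e: "wh [] ?o [?i] ;; (swaps [one R] \<boxtimes> B0') = pinv (swaps [?i]) ;; wh [?i] (oneP R I) []"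
  proof -
    have "wh [] (pident [one R] \<boxtimes> eta) [?i] = pident [one R, one R] \<boxtimes> wh [] eta [n]"
      using ptens_wh[of "[]" "pident [one R]" "[one R]" "[]" eta "[n]"] by (simp add: wh_pident)
    then have "wh [] (pident [one R] \<boxtimes> eta) [?i] ;; (swaps [one R] \<boxtimes> B0') = pinv (swaps [one R]) \<boxtimes> pinv (swaps [n])"
      by (simp add: ptens_paste[symmetric] n pinv_pident)
    then have "wh [] ?o [?i] ;; (swaps [one R] \<boxtimes> B0') = wh [] (oneP R E) [?i] ;; (pinv (swaps [one R]) \<boxtimes> pinv (swaps [n]))"
      by (simp only: wh_paste paste_assoc)
    then show ?thesis
      using pinv_swaps_tens[OF _ _ refl refl refl refl, of "one R" n] by (simp del: one)
  qed
  have e': "wh [act] ?o [?i] ;; wh [act] (swaps [one R] \<boxtimes> B0') [] = wh [act] (pinv (swaps [?i])) [] ;; wh [act, ?i] (oneP R I) []"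
    using arg_cong[OF e, of "\<lambda>P. wh [act] P []"] by (simp only: wh_simps)
  have q: "wh [] (pinv (swaps [act])) [?i] ;; wh [act] (pinv (swaps [?i])) [] = pinv (swaps [act, ?i])"
    using pinv_swaps_Cons[of act "[?i]"] by simp
  have inter: "wh [act, ?i] (oneP R I) [] ;; wh [] act0 [one R \<otimes> one I] = wh [] act0 [one (R \<cdot> I)] ;; wh [\<r> R] (oneP R I) []"
    using wh_interchange[of "[]" act0 "[]" "oneP R I" "[]"] by simp
  have r: "wh [\<r> R] (oneP R I) [] ;; rgtN (one R) = swaps [\<r> R]"
    by (rule rgtN_one) simp
  have nat: "wh [] act0 [one (R \<cdot> I)] ;; swaps [\<r> R] = swaps [act, ?i] ;; wh [one R] act0 []"
    using swaps_natural[OF _ refl refl, of act0] by simp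
  have "?R = pinv (swaps [act, ?i]) ;; swaps [act, ?i] ;; wh [one R] act0 []"
    unfolding k by (simp only: paste_assoc e'[THEN paste_app, unfolded paste_assoc] q[THEN paste_app, unfolded paste_assoc]
        inter[THEN paste_app, unfolded paste_assoc] r nat)
  also have "\<dots> = ?L" by simp
  finally show ?thesis by simp
qed

lemma comod_unit: "comod (one R) unit_coaction"
  unfolding comod_def using unit_act2 unit_act0 by simp

section \<open>Morphisms of comodules\<close>

definition comod_mor :: "'a \<Rightarrow> ('a, 'c) pcell \<Rightarrow> 'a \<Rightarrow> ('a, 'c) pcell \<Rightarrow> ('a, 'c) pcell \<Rightarrow> bool" where
  "comod_mor Y y Y' y' g \<longleftrightarrow> valid g \<and> psrc g = [Y] \<and> ptrg g = [Y'] \<and>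
    wh [] g [act] ;; y' = y ;; wh [act] (g \<boxtimes> pident [B]) []"

lemma comod_mor_act: "comod_mor Y y Y' y' g ==> wh [] g [act] ;; y' = y ;; wh [act] (g \<boxtimes> pident [B]) []"
  unfolding comod_mor_def by blast

lemma comodD:
  assumes "comod Y y"
  shows "Y \<in> Ar M" "src M Y = R" "trg M Y = R" "valid y" "psrc y = [Y, act]" "ptrg y = [act, Y \<otimes> B]"
  using assms unfolding comod_def by auto

lemma contract_composite_ext:
  assumes "comod Y y" "comod Z z"
  shows "wh us (contract Y Z) (act # vs) ;; wh us (composite Y y Z z) vs =
     wh (us @ [Y]) z vs ;; wh us y ((Z \<otimes> B) # vs) ;; wh (us @ [act]) (contract Y Z \<boxtimes> mu) vs"
  using arg_cong[OF contract_composite[OF assms], of "\<lambda>P. wh us P vs"] by (simp add: wh_paste)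

text \<open>The premise on \<open>k\<close> says that \<open>k\<close> is the horizontal composite of \<open>g\<close> and \<open>h\<close>.\<close>

lemma comod_mor_composite:
  assumes c: "comod Y y" "comod Z z" "comod Y' y'" "comod Z' z'"
    and g: "comod_mor Y y Y' y' g" and h: "comod_mor Z z Z' z' h"
    and k: "valid k" "psrc k = [Y \<odot> Z]" "ptrg k = [Y' \<odot> Z']"
      "contract Y Z ;; k = wh [] g [Z] ;; wh [Y'] h [] ;; contract Y' Z'"
  shows "comod_mor (Y \<odot> Z) (composite Y y Z z) (Y' \<odot> Z') (composite Y' y' Z' z') k"
proof -
  note [simp] = comodD[OF c(1)] comodD[OF c(2)] comodD[OF c(3)] comodD[OF c(4)] k(1-3)
    composite_simps[OF c(1,2)] composite_simps[OF c(3,4)]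
  have [simp]: "valid g" "psrc g = [Y]" "ptrg g = [Y']" "valid h" "psrc h = [Z]" "ptrg h = [Z']"
    using g h unfolding comod_mor_def by auto
  let ?b = "pident [B]"
  let ?K = "composite Y y Z z" and ?K' = "composite Y' y' Z' z'"
  note k4 = k(4)[THEN wh_cong, of "[]" "[act]", unfolded wh_simps]
  note hm = comod_mor_act[OF h, THEN wh_cong, of "[Y']" "[]", unfolded wh_simps]
  note gm = comod_mor_act[OF g, THEN wh_cong, of "[]" "[Z \<otimes> B]", unfolded wh_simps]
  have i1: "wh [] g [Z, act] ;; wh [Y'] z [] = wh [Y] z [] ;; wh [] g [act, Z \<otimes> B]"
    using wh_interchange[of "[]" g "[]" z "[]"] by simp
  have i2: "wh [Y', act] (h \<boxtimes> ?b) [] ;; wh [] y' [Z' \<otimes> B] = wh [] y' [Z \<otimes> B] ;; wh [act, Y' \<otimes> B] (h \<boxtimes> ?b) []"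
    using wh_interchange[of "[]" y' "[]" "h \<boxtimes> ?b" "[]"] by simp
  have t: "wh [] (g \<boxtimes> ?b) [Z \<otimes> B] ;; wh [Y' \<otimes> B] (h \<boxtimes> ?b) [] ;; (contract Y' Z' \<boxtimes> mu) = (contract Y Z \<boxtimes> mu) ;; (k \<boxtimes> ?b)"
  proof -
    have "wh [] (g \<boxtimes> ?b) [Z \<otimes> B] = wh [] g [Z] \<boxtimes> pident [B, B]"
      using ptens_wh[of "[]" g "[Z]" "[]" ?b "[B]"] by (simp add: wh_pident)
    moreover have "wh [Y' \<otimes> B] (h \<boxtimes> ?b) [] = wh [Y'] h [] \<boxtimes> pident [B, B]"
      using ptens_wh[of "[Y']" h "[]" "[B]" ?b "[]"] by (simp add: wh_pident)
    moreover have "(wh [] g [Z] \<boxtimes> pident [B, B]) ;; (wh [Y'] h [] \<boxtimes> pident [B, B]) ;; (contract Y' Z' \<boxtimes> mu) =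
      (wh [] g [Z] ;; wh [Y'] h [] ;; contract Y' Z') \<boxtimes> mu"
      by (simp add: ptens_paste[symmetric])
    moreover have "(contract Y Z \<boxtimes> mu) ;; (k \<boxtimes> ?b) = (contract Y Z ;; k) \<boxtimes> mu"
      by (simp add: ptens_paste[symmetric])
    ultimately show ?thesis using k(4) by simp
  qed
  note t' = t[THEN wh_cong, of "[act]" "[]", unfolded wh_simps]
  have "wh [] (contract Y Z) [act] ;; wh [] k [act] ;; ?K' =
      wh [] g [Z, act] ;; wh [Y'] h [act] ;; wh [Y'] z' [] ;; wh [] y' [Z' \<otimes> B] ;; wh [act] (contract Y' Z' \<boxtimes> mu) []"
    by (simp only: paste_assoc k4[THEN paste_app, unfolded paste_assoc] contract_composite[OF c(3,4)])
  also have "\<dots> = wh [Y] z [] ;; wh [] y [Z \<otimes> B] ;; wh [act] (contract Y Z \<boxtimes> mu) [] ;; wh [act] (k \<boxtimes> ?b) []"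
    by (simp only: paste_assoc hm[THEN paste_app, unfolded paste_assoc] i1[THEN paste_app, unfolded paste_assoc]
        i2[THEN paste_app, unfolded paste_assoc] gm[THEN paste_app, unfolded paste_assoc] t')
  also have "\<dots> = wh [] (contract Y Z) [act] ;; ?K ;; wh [act] (k \<boxtimes> ?b) []"
    by (simp only: paste_assoc contract_composite[OF c(1,2), THEN paste_app, unfolded paste_assoc])
  finally have "wh [] k [act] ;; ?K' = ?K ;; wh [act] (k \<boxtimes> ?b) []"
    by (rule paste_cancel_left[rotated]) simp_all
  then show ?thesis unfolding comod_mor_def by simp
qed

text \<open>The premise on \<open>k\<close> says that \<open>k\<close> is the associator: it becomes an identity when source and target
  are expanded to \<open>[Y, Z, W]\<close>. The two threefold coactions differ only in the order in which three
  copies of \<open>B\<close> are multiplied.\<close>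

lemma comod_mor_assoc:
  assumes c: "comod Y y" "comod Z z" "comod W w"
    and k: "valid k" "psrc k = [(Y \<odot> Z) \<odot> W]" "ptrg k = [Y \<odot> (Z \<odot> W)]"
      "wh [] (contract Y Z) [W] ;; contract (Y \<odot> Z) W ;; k = wh [Y] (contract Z W) [] ;; contract Y (Z \<odot> W)"
  shows "comod_mor ((Y \<odot> Z) \<odot> W) (composite (Y \<odot> Z) (composite Y y Z z) W w)
    (Y \<odot> (Z \<odot> W)) (composite Y y (Z \<odot> W) (composite Z z W w)) k"
proof -
  note c' = comod_composite[OF c(1,2)] comod_composite[OF c(2,3)]
  note [simp] = comodD[OF c(1)] comodD[OF c(2)] comodD[OF c(3)] k(1-3)
    composite_simps[OF c(1,2)] composite_simps[OF c(2,3)] composite_simps[OF c(1) c'(2)] composite_simps[OF c'(1) c(3)]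
  let ?P = "composite Y y Z z" and ?Q = "composite Z z W w"
  let ?K = "composite (Y \<odot> Z) ?P W w" and ?K' = "composite Y y (Z \<odot> W) ?Q"
  let ?C = "wh [] (contract Y Z) [W] ;; contract (Y \<odot> Z) W" and ?C' = "wh [Y] (contract Z W) [] ;; contract Y (Z \<odot> W)"
  let ?m = "wh [] mu [B] ;; mu"
  have i1: "wh [] (contract Y Z) [W, act] ;; wh [Y \<odot> Z] w [] = wh [Y, Z] w [] ;; wh [] (contract Y Z) [act, W \<otimes> B]"
    using wh_interchange[of "[]" "contract Y Z" "[]" w "[]"] by simp
  have t1: "wh [] (contract Y Z \<boxtimes> mu) [W \<otimes> B] ;; (contract (Y \<odot> Z) W \<boxtimes> mu) = ?C \<boxtimes> ?m"
    by (simp add: ptens_paste ptens_wh)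
  note t1' = t1[THEN wh_cong, of "[act]" "[]", unfolded wh_simps]
  have K: "wh [] ?C [act] ;; ?K = wh [Y, Z] w [] ;; wh [Y] z [W \<otimes> B] ;; wh [] y [Z \<otimes> B, W \<otimes> B] ;; wh [act] (?C \<boxtimes> ?m) []"
  proof -
    have "wh [] ?C [act] ;; ?K = wh [] (contract Y Z) [W, act] ;; wh [Y \<odot> Z] w [] ;; wh [] ?P [W \<otimes> B] ;;
        wh [act] (contract (Y \<odot> Z) W \<boxtimes> mu) []"
      unfolding wh_paste paste_assoc contract_composite[OF c'(1) c(3)] by simp
    also have "\<dots> = wh [Y, Z] w [] ;; wh [Y] z [W \<otimes> B] ;; wh [] y [Z \<otimes> B, W \<otimes> B] ;; wh [act] (?C \<boxtimes> ?m) []"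
      by (simp only: paste_assoc i1[THEN paste_app, unfolded paste_assoc] append_Nil
          contract_composite_ext[OF c(1,2), THEN paste_app, unfolded paste_assoc] t1')
    finally show ?thesis .
  qed
  have i2: "wh [Y, act] (contract Z W \<boxtimes> mu) [] ;; wh [] y [(Z \<odot> W) \<otimes> B] = wh [] y [Z \<otimes> B, W \<otimes> B] ;; wh [act, Y \<otimes> B] (contract Z W \<boxtimes> mu) []"
    using wh_interchange[of "[]" y "[]" "contract Z W \<boxtimes> mu" "[]"] by simp
  have t2: "wh [Y \<otimes> B] (contract Z W \<boxtimes> mu) [] ;; (contract Y (Z \<odot> W) \<boxtimes> mu) = ?C' \<boxtimes> ?m"
    by (simp add: ptens_paste ptens_wh mu_assoc)
  note t2' = t2[THEN wh_cong, of "[act]" "[]", unfolded wh_simps]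
  have K': "wh [] ?C' [act] ;; ?K' = wh [Y, Z] w [] ;; wh [Y] z [W \<otimes> B] ;; wh [] y [Z \<otimes> B, W \<otimes> B] ;; wh [act] (?C' \<boxtimes> ?m) []"
  proof -
    have "wh [] ?C' [act] ;; ?K' = wh [Y] (contract Z W) [act] ;; wh [Y] ?Q [] ;; wh [] y [(Z \<odot> W) \<otimes> B] ;;
        wh [act] (contract Y (Z \<odot> W) \<boxtimes> mu) []"
      unfolding wh_paste paste_assoc contract_composite[OF c(1) c'(2)] by simp
    also have "\<dots> = wh [Y, Z] w [] ;; wh [Y] z [W \<otimes> B] ;; wh [] y [Z \<otimes> B, W \<otimes> B] ;; wh [act] (?C' \<boxtimes> ?m) []"
      by (simp only: paste_assoc contract_composite_ext[OF c(2,3), THEN paste_app, unfolded paste_assoc] append_Cons append_Nil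
          i2[THEN paste_app, unfolded paste_assoc] t2')
    finally show ?thesis .
  qed
  have k4: "?C ;; k = ?C'" using k(4) by (simp only: paste_assoc)
  have t: "wh [act] (?C \<boxtimes> ?m) [] ;; wh [act] (k \<boxtimes> pident [B]) [] = wh [act] (?C' \<boxtimes> ?m) []"
    unfolding k4[symmetric] by (simp add: ptens_paste wh_paste[symmetric]) (simp add: ptens_paste[symmetric] paste_assoc)
  have "wh [] ?C [act] ;; wh [] k [act] ;; ?K' = wh [] ?C' [act] ;; ?K'"
    unfolding k4[symmetric] by (simp only: wh_paste paste_assoc)
  also have "\<dots> = wh [] ?C [act] ;; ?K ;; wh [act] (k \<boxtimes> pident [B]) []"
    unfolding K' t[symmetric] using paste_app[OF K, of "wh [act] (k \<boxtimes> pident [B]) []"] by (simp only: paste_assoc)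
  finally have e: "wh [] ?C [act] ;; wh [] k [act] ;; ?K' = \<dots>" .
  have "pinvertible (wh [] ?C [act])"
    by simp
  from paste_cancel_left[OF this e] have "wh [] k [act] ;; ?K' = ?K ;; wh [act] (k \<boxtimes> pident [B]) []"
    by simp
  then show ?thesis unfolding comod_mor_def by simp
qed

text \<open>The unit \<open>\<eta>\<close> of the coaction of \<open>1\<close> cancels against \<open>\<mu>\<close> by the unit law of the monad.\<close>

lemma comod_mor_left_unit:
  assumes c: "comod Y y" and k: "valid k" "psrc k = [one R \<odot> Y]" "ptrg k = [Y]" "contract (one R) Y ;; k = luns [Y]"
  shows "comod_mor (one R \<odot> Y) (composite (one R) unit_coaction Y y) Y y k"
proof -
  note [simp] = comodD[OF c] k(1-3) composite_simps[OF comod_unit c]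
  let ?K = "composite (one R) unit_coaction Y y" and ?o = insert_unit
  have t: "wh [] ?o [Y \<otimes> B] ;; (contract (one R) Y \<boxtimes> mu) ;; (k \<boxtimes> pident [B]) = luns [Y \<otimes> B]"
  proof -
    have "(contract (one R) Y \<boxtimes> mu) ;; (k \<boxtimes> pident [B]) = luns [Y] \<boxtimes> mu"
      unfolding k(4)[symmetric] by (simp add: ptens_paste[symmetric])
    moreover have "wh [] (pident [one R] \<boxtimes> eta) [Y \<otimes> B] = pident [one R, Y] \<boxtimes> wh [] eta [B]"
      using ptens_wh[of "[]" "pident [one R]" "[Y]" "[]" eta "[B]"] by (simp add: wh_pident)
    moreover have "(pident [one R, Y] \<boxtimes> wh [] eta [B]) ;; (luns [Y] \<boxtimes> mu) = luns [Y] \<boxtimes> luns [B]"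
      by (simp add: ptens_paste[symmetric] mu_eta_left)
    ultimately show ?thesis
      using luns_tens[of Y B R E] by (simp add: wh_paste paste_assoc)
  qed
  have t': "wh [act] ?o [Y \<otimes> B] ;; wh [act] (contract (one R) Y \<boxtimes> mu) [] ;; wh [act] (k \<boxtimes> pident [B]) [] =
      wh [] (runs [act]) [Y \<otimes> B]"
    using arg_cong[OF t, of "\<lambda>P. wh [act] P []"] luns_runs_middle[of act "[Y \<otimes> B]"]
    by (simp only: wh_simps) simp
  have p: "wh [] (pinv (swaps [act])) [Y \<otimes> B] ;; wh [] (runs [act]) [Y \<otimes> B] = wh [] (luns [act]) [Y \<otimes> B]"
    by (simp add: pinv_swaps wh_paste[symmetric] paste_assoc)
  have nat: "wh [one R] y [] ;; wh [] (luns [act]) [Y \<otimes> B] = wh [] (luns [Y]) [act] ;; y"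
    using luns_natural[OF _ refl, of y] luns_Cons[of act "[Y \<otimes> B]"] luns_Cons[of Y "[act]"] by simp
  note kk = k(4)[THEN wh_cong, of "[]" "[act]", unfolded wh_simps]
  have u: "wh [] unit_coaction [Y \<otimes> B] = wh [] (pinv (swaps [act])) [Y \<otimes> B] ;; wh [act] ?o [Y \<otimes> B]"
    unfolding unit_coaction_def by (simp add: wh_paste)
  have "wh [] (contract (one R) Y) [act] ;; ?K ;; wh [act] (k \<boxtimes> pident [B]) [] =
    wh [one R] y [] ;; wh [] (pinv (swaps [act])) [Y \<otimes> B] ;; wh [act] ?o [Y \<otimes> B] ;;
      wh [act] (contract (one R) Y \<boxtimes> mu) [] ;; wh [act] (k \<boxtimes> pident [B]) []"
    using paste_app[OF contract_composite[OF comod_unit c], unfolded paste_assoc u] .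
  also have "\<dots> = wh [] (contract (one R) Y) [act] ;; wh [] k [act] ;; y"
    by (simp only: t' p nat kk[THEN paste_app, unfolded paste_assoc])
  finally have "?K ;; wh [act] (k \<boxtimes> pident [B]) [] = wh [] k [act] ;; y"
    by (rule paste_cancel_left[rotated]) simp_all
  then show ?thesis unfolding comod_mor_def by simp
qed

lemma comod_mor_right_unit:
  assumes c: "comod Y y" and k: "valid k" "psrc k = [Y \<odot> one R]" "ptrg k = [Y]" "contract Y (one R) ;; k = runs [Y]"
  shows "comod_mor (Y \<odot> one R) (composite Y y (one R) unit_coaction) Y y k"
proof -
  note [simp] = comodD[OF c] k(1-3) composite_simps[OF c comod_unit]
  let ?K = "composite Y y (one R) unit_coaction" and ?o = insert_unit
  have t: "wh [Y \<otimes> B] ?o [] ;; (contract Y (one R) \<boxtimes> mu) ;; (k \<boxtimes> pident [B]) = runs [Y \<otimes> B]"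
  proof -
    have "(contract Y (one R) \<boxtimes> mu) ;; (k \<boxtimes> pident [B]) = runs [Y] \<boxtimes> mu"
      unfolding k(4)[symmetric] by (simp add: ptens_paste[symmetric])
    moreover have "wh [Y \<otimes> B] (pident [one R] \<boxtimes> eta) [] = pident [Y, one R] \<boxtimes> wh [B] eta []"
      using ptens_wh[of "[Y]" "pident [one R]" "[]" "[B]" eta "[]"] by (simp add: wh_pident)
    moreover have "(pident [Y, one R] \<boxtimes> wh [B] eta []) ;; (runs [Y] \<boxtimes> mu) = runs [Y] \<boxtimes> runs [B]"
      by (simp add: ptens_paste[symmetric] mu_eta_right)
    ultimately show ?thesis
      using runs_tens[of Y B R E] by (simp add: wh_paste paste_assoc)
  qed
  have t': "wh [act, Y \<otimes> B] ?o [] ;; wh [act] (contract Y (one R) \<boxtimes> mu) [] ;; wh [act] (k \<boxtimes> pident [B]) [] =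
      runs [act, Y \<otimes> B]"
    using arg_cong[OF t, of "\<lambda>P. wh [act] P []"] runs_Cons[of act "[Y \<otimes> B]"]
    by (simp only: wh_simps) simp
  have i: "wh [Y, act] ?o [] ;; wh [] y [one R \<otimes> B] = wh [] y [one (R \<cdot> E)] ;; wh [act, Y \<otimes> B] ?o []"
    using wh_interchange[of "[]" y "[]" ?o "[]"] by simp
  have nat: "wh [] y [one (R \<cdot> E)] ;; runs [act, Y \<otimes> B] = wh [Y] (runs [act]) [] ;; y"
    using runs_natural[OF _ refl, of y] runs_Cons[of Y "[act]"] by simp
  have p: "wh [Y] (pinv (swaps [act])) [] ;; wh [Y] (runs [act]) [] = wh [] (runs [Y]) [act]"
    using luns_runs_middle[of Y "[act]"] by (simp add: pinv_swaps wh_paste[symmetric] paste_assoc)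
  note kk = k(4)[THEN wh_cong, of "[]" "[act]", unfolded wh_simps]
  have u: "wh [Y] unit_coaction [] = wh [Y] (pinv (swaps [act])) [] ;; wh [Y, act] ?o []"
    unfolding unit_coaction_def by (simp add: wh_paste)
  have "wh [] (contract Y (one R)) [act] ;; ?K ;; wh [act] (k \<boxtimes> pident [B]) [] =
    wh [Y] (pinv (swaps [act])) [] ;; wh [Y, act] ?o [] ;; wh [] y [one R \<otimes> B] ;;
      wh [act] (contract Y (one R) \<boxtimes> mu) [] ;; wh [act] (k \<boxtimes> pident [B]) []"
    using paste_app[OF contract_composite[OF c comod_unit], unfolded paste_assoc u] .
  also have "\<dots> = wh [] (contract Y (one R)) [act] ;; wh [] k [act] ;; y"
    by (simp only: i[THEN paste_app, unfolded paste_assoc] t' nat p[THEN paste_app, unfolded paste_assoc] kk[THEN paste_app, unfolded paste_assoc])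
  finally have "?K ;; wh [act] (k \<boxtimes> pident [B]) [] = wh [] k [act] ;; y"
    by (rule paste_cancel_left[rotated]) simp_all
  then show ?thesis unfolding comod_mor_def by simp
qed

lemma comod_mor_pident:
  assumes "comod Y y" shows "comod_mor Y y Y y (pident [Y])"
proof -
  note [simp] = comodD[OF assms]
  show ?thesis unfolding comod_mor_def by (simp add: wh_pident ptens_pident)
qed

lemma comod_mor_paste:
  assumes c: "comod Y y" "comod Y' y'" "comod Y'' y''" and g: "comod_mor Y y Y' y' g" and h: "comod_mor Y' y' Y'' y'' h"
  shows "comod_mor Y y Y'' y'' (g ;; h)"
proof -
  note [simp] = comodD[OF c(1)] comodD[OF c(2)] comodD[OF c(3)]
  have [simp]: "valid g" "psrc g = [Y]" "ptrg g = [Y']" "valid h" "psrc h = [Y']" "ptrg h = [Y'']"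
    using g h unfolding comod_mor_def by auto
  have "wh [] (g ;; h) [act] ;; y'' = y ;; wh [act] (g \<boxtimes> pident [B]) [] ;; wh [act] (h \<boxtimes> pident [B]) []"
    by (simp only: wh_paste paste_assoc comod_mor_act[OF h] paste_app[OF comod_mor_act[OF g], unfolded paste_assoc])
  also have "wh [act] (g \<boxtimes> pident [B]) [] ;; wh [act] (h \<boxtimes> pident [B]) [] = wh [act] ((g ;; h) \<boxtimes> pident [B]) []"
    by (simp add: wh_paste[symmetric] ptens_paste[symmetric])
  finally show ?thesis unfolding comod_mor_def by simp
qed

lemma comod_mor_pinv:
  assumes c: "comod Y y" "comod Y' y'" and g: "comod_mor Y y Y' y' g" "pinvertible g"
  shows "comod_mor Y' y' Y y (pinv g)"
proof -
  note [simp] = comodD[OF c(1)] comodD[OF c(2)] g(2)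
  have [simp]: "valid g" "psrc g = [Y]" "ptrg g = [Y']"
    using g unfolding comod_mor_def by auto
  have i: "wh [act] (pinv g \<boxtimes> pident [B]) [] = pinv (wh [act] (g \<boxtimes> pident [B]) [])"
    using ptens_pinv[of g "pident [B]"] by (simp add: pinv_pident wh_pinv)
  have "wh [] (pinv g) [act] ;; (y ;; wh [act] (g \<boxtimes> pident [B]) []) ;; wh [act] (pinv g \<boxtimes> pident [B]) [] =
    wh [] (pinv g) [act] ;; (wh [] g [act] ;; y') ;; wh [act] (pinv g \<boxtimes> pident [B]) []"
    unfolding comod_mor_act[OF g(1)] ..
  then have "wh [] (pinv g) [act] ;; y = y' ;; wh [act] (pinv g \<boxtimes> pident [B]) []"
    unfolding i by (simp add: wh_pinv paste_assoc)
  then show ?thesis unfolding comod_mor_def by simp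
qed

end

context monoidal_bicategory begin

section \<open>Sources and targets of the constraint cells\<close>

text \<open>The constraints \<open>act2\<close> and \<open>act0\<close> of the action are long pastings. For them to be valid
  pasting cells, each of their constituents has to have the source and target that its place in
  the pasting requires; the rules below let the simplifier check this.\<close>

lemma whisk_typing [simp]:
  assumes "valid P" "composable (us @ psrc P @ vs)"
  shows "valid (us \<lhd> P \<rhd> vs)" "psrc (us \<lhd> P \<rhd> vs) = us @ psrc P @ vs" "ptrg (us \<lhd> P \<rhd> vs) = us @ ptrg P @ vs"
  using assms by (simp_all add: whisk_wh del: composable_append)

lemma expand_typing [simp]:
  "psrc (expand ps) = [pth ps]" "ptrg (expand ps) = ps"
  "ps \<noteq> [] ==> composable ps ==> pinvertible (expand ps)"
  "ps \<noteq> [] ==> composable ps ==> valid (expand ps)"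
  unfolding pinvertible_def valid_def by (simp_all add: expand_def)

lemma map_tens_composable [simp]:
  assumes "X \<in> Ob M" "composable ps"
  shows "composable (map (\<lambda>f. one X \<otimes> f) ps)" "composable (map (\<lambda>f. f \<otimes> one X) ps)"
  using assms by (induction ps) (auto simp: hd_map)

lemma ltens_join_Cons:
  "ps \<noteq> [] ==> ltens_join X (f # ps) = (blun M (one X) \<otimes>\<^sub>c cid (f \<odot> pth ps)) \<bullet>
    tens_comp M (one X) f (one X) (pth ps) \<bullet> (cid (one X \<otimes> f) \<star> ltens_join X ps)"
  by (cases ps) auto

lemma rtens_join_Cons:
  "ps \<noteq> [] ==> rtens_join (f # ps) X = (cid (f \<odot> pth ps) \<otimes>\<^sub>c blun M (one X)) \<bullet>
    tens_comp M f (one X) (pth ps) (one X) \<bullet> (cid (f \<otimes> one X) \<star> rtens_join ps X)"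
  by (cases ps) auto

lemma ltens_join_cell [simp]:
  assumes [simp]: "X \<in> Ob M" and "ps \<noteq> []" "composable ps"
  shows "invertible (ltens_join X ps)" (is ?A1) "ltens_join X ps \<in> Ce M" (is ?A2)
    "cdom M (ltens_join X ps) = pth (map (\<lambda>f. one X \<otimes> f) ps)" (is ?A3) "ccod M (ltens_join X ps) = one X \<otimes> pth ps" (is ?A4)
proof -
  have "?A1 \<and> ?A3 \<and> ?A4"
    using assms(2,3)
  proof (induction ps)
    case (Cons f ps)
    then show ?case
      by (cases "ps = []") (auto simp: ltens_join_Cons pth_Cons hd_map invertible_in)
  qed simp
  then show ?A1 ?A2 ?A3 ?A4
    by (auto simp: invertible_in)
qed

lemma rtens_join_cell [simp]:
  assumes [simp]: "X \<in> Ob M" and "ps \<noteq> []" "composable ps"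
  shows "invertible (rtens_join ps X)" (is ?A1) "rtens_join ps X \<in> Ce M" (is ?A2)
    "cdom M (rtens_join ps X) = pth (map (\<lambda>f. f \<otimes> one X) ps)" (is ?A3) "ccod M (rtens_join ps X) = pth ps \<otimes> one X" (is ?A4)
proof -
  have "?A1 \<and> ?A3 \<and> ?A4"
    using assms(2,3)
  proof (induction ps)
    case (Cons f ps)
    then show ?case
      by (cases "ps = []") (auto simp: rtens_join_Cons pth_Cons hd_map invertible_in)
  qed simp
  then show ?A1 ?A2 ?A3 ?A4
    by (auto simp: invertible_in)
qed

lemma ltens_rtens_sel [simp]:
  "psrc (ltens X P) = map (\<lambda>f. one X \<otimes> f) (psrc P)" "ptrg (ltens X P) = map (\<lambda>f. one X \<otimes> f) (ptrg P)"
  "psrc (rtens P X) = map (\<lambda>f. f \<otimes> one X) (psrc P)" "ptrg (rtens P X) = map (\<lambda>f. f \<otimes> one X) (ptrg P)"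
  by (cases P; simp)+

lemma valid_ltens_rtens [simp]:
  assumes "valid P" "X \<in> Ob M"
  shows "valid (ltens X P)" "valid (rtens P X)"
proof -
  obtain ps \<theta> qs where P: "P = (ps, \<theta>, qs)" by (cases P)
  show "valid (ltens X P)" "valid (rtens P X)"
    using validD(1-7)[OF assms(1)] assms(2) unfolding P by (auto intro!: validI)
qed

lemma swap_typing [simp]:
  assumes "f \<in> Ar M"
  shows "valid (swap f)" "pinvertible (swap f)" "psrc (swap f) = [f, one (src M f)]" "ptrg (swap f) = [one (trg M f), f]"
  using assms by (simp_all add: swap_swaps)

lemma interchange_typing [simp]:
  assumes "f \<in> Ar M" "g \<in> Ar M"
  shows "valid (interchange f g)"
    "psrc (interchange f g) = [f \<otimes> one (trg M g), one (src M f) \<otimes> g]"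
    "ptrg (interchange f g) = [one (trg M f) \<otimes> g, f \<otimes> one (src M g)]"
  using assms by (simp_all add: interchange_def sqtens_ptens)

lemma split_one_typing [simp]:
  assumes "X \<in> Ob M" "Y \<in> Ob M" "f \<in> Ar M"
  shows "pinvertible (split_one_left X Y f)" "valid (split_one_left X Y f)"
    "psrc (split_one_left X Y f) = [one (X \<cdot> Y) \<otimes> f]" "ptrg (split_one_left X Y f) = [(one X \<otimes> one Y) \<otimes> f]"
    "valid (split_one_right f X Y)"
    "psrc (split_one_right f X Y) = [f \<otimes> one (X \<cdot> Y)]" "ptrg (split_one_right f X Y) = [f \<otimes> (one X \<otimes> one Y)]"
  using assms by (simp_all add: split_one_left_ptens split_one_right_ptens)

lemma run_lun_typing [simp]:
  assumes "f \<in> Ar M"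
  shows "pinvertible (run f)" "valid (run f)" "psrc (run f) = [f, one (src M f)]" "ptrg (run f) = [f]"
    "pinvertible (lun f)" "valid (lun f)" "psrc (lun f) = [one (trg M f), f]" "ptrg (lun f) = [f]"
  using assms by (simp_all add: run_runs lun_luns)

lemma ass_rev_arrow [simp]:
  assumes "X \<in> Ob M" "Y \<in> Ob M" "Z \<in> Ob M"
  shows "\<a>\<^sup>* X Y Z \<in> Ar M" "src M (\<a>\<^sup>* X Y Z) = X \<cdot> (Y \<cdot> Z)" "trg M (\<a>\<^sup>* X Y Z) = (X \<cdot> Y) \<cdot> Z"
  using ass_equivalence[OF assms] unfolding adjoint_equivalence_def by auto

lemma lft_arrow [simp]:
  assumes "X \<in> Ob M" shows "\<l> X \<in> Ar M" "src M (\<l> X) = I \<cdot> X" "trg M (\<l> X) = X"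
  using lft_equivalence[OF assms] unfolding adjoint_equivalence_def by auto

lemma assEta_typing [simp]:
  assumes [simp]: "X \<in> Ob M" "Y \<in> Ob M" "Z \<in> Ob M"
  shows "pinvertible (assEta X Y Z)" "psrc (assEta X Y Z) = [one ((X \<cdot> Y) \<cdot> Z)]"
    "ptrg (assEta X Y Z) = [\<a>\<^sup>* X Y Z, \<a> X Y Z]"
  using ass_equivalence[OF assms] unfolding adjoint_equivalence_def pinvertible_def valid_def icell_iff
  by (auto simp: assEta_def invertible_in)

lemma assEps_typing [simp]:
  assumes [simp]: "X \<in> Ob M" "Y \<in> Ob M" "Z \<in> Ob M"
  shows "pinvertible (assEps X Y Z)" "psrc (assEps X Y Z) = [\<a> X Y Z, \<a>\<^sup>* X Y Z]"
    "ptrg (assEps X Y Z) = [one (X \<cdot> (Y \<cdot> Z))]"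
  using ass_equivalence[OF assms] unfolding adjoint_equivalence_def pinvertible_def valid_def icell_iff
  by (auto simp: assEps_def invertible_in)

lemma lftN_typing [simp]:
  assumes [simp]: "f \<in> Ar M"
  shows "valid (lftN f)" "psrc (lftN f) = [\<l> (trg M f), one I \<otimes> f]" "ptrg (lftN f) = [f, \<l> (src M f)]"
  using lft_nat_icell[of f "src M f" "trg M f"] unfolding valid_def icell_iff
  by (auto simp: lftN_def invertible_in)

lemma pentP_typing [simp]:
  assumes [simp]: "W \<in> Ob M" "X \<in> Ob M" "Y \<in> Ob M" "Z \<in> Ob M"
  shows "valid (pentP W X Y Z)" "psrc (pentP W X Y Z) = [one W \<otimes> \<a> X Y Z, \<a> W (X \<cdot> Y) Z, \<a> W X Y \<otimes> one Z]"
    "ptrg (pentP W X Y Z) = [\<a> W X (Y \<cdot> Z), \<a> (W \<cdot> X) Y Z]"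
  using pent_icell[OF assms] unfolding valid_def icell_iff by (auto simp: pentP_def invertible_in)

lemma lftP_typing [simp]:
  assumes [simp]: "X \<in> Ob M" "Y \<in> Ob M"
  shows "valid (lftP X Y)" "psrc (lftP X Y) = [\<l> (X \<cdot> Y), \<a> I X Y]" "ptrg (lftP X Y) = [\<l> X \<otimes> one Y]"
  using lft_tens_icell[OF assms] unfolding valid_def icell_iff by (auto simp: lftP_def invertible_in)

lemma insert_after_typing [simp]:
  assumes "f \<in> Ar M" "valid P" "psrc P = [one (src M f)]"
  shows "valid (insert_after f P)" "psrc (insert_after f P) = [f]" "ptrg (insert_after f P) = f # ptrg P"
  using assms validD(9)[OF assms(2)] unfolding insert_after_def by (simp_all add: valid_pvcomp)

lemma cancel_before_typing [simp]:
  assumes "f \<in> Ar M" "valid P" "ptrg P = [one (trg M f)]"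
  shows "valid (cancel_before P f)" "psrc (cancel_before P f) = psrc P @ [f]" "ptrg (cancel_before P f) = [f]"
  using assms validD(8)[OF assms(2)] unfolding cancel_before_def by (simp_all add: valid_pvcomp)

lemma assN'_typing [simp]:
  assumes [simp]: "f \<in> Ar M" "g \<in> Ar M" "h \<in> Ar M"
  shows "valid (assN' f g h)"
    "psrc (assN' f g h) = [\<a>\<^sup>* (trg M f) (trg M g) (trg M h), f \<otimes> (g \<otimes> h)]"
    "ptrg (assN' f g h) = [(f \<otimes> g) \<otimes> h, \<a>\<^sup>* (src M f) (src M g) (src M h)]"
  unfolding assN'_def Let_def by (simp_all add: valid_pvcomp)

lemma pentP'_typing [simp]:
  assumes [simp]: "W \<in> Ob M" "X \<in> Ob M" "Y \<in> Ob M" "Z \<in> Ob M"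
  shows "valid (pentP' W X Y Z)" "psrc (pentP' W X Y Z) = [one W \<otimes> \<a> X Y Z, \<a> W (X \<cdot> Y) Z]"
    "ptrg (pentP' W X Y Z) = [\<a> W X (Y \<cdot> Z), \<a> (W \<cdot> X) Y Z, \<a>\<^sup>* W X Y \<otimes> one Z]"
  unfolding pentP'_def by (simp_all add: valid_pvcomp)

end

locale biduality_opmonoidal_monad = monoidal_bicategory M + biduality_data M R R' n e \<sigma>l \<sigma>r
  for M :: "('o, 'a, 'c) tensor_bicat" and R R' n e \<sigma>l \<sigma>r +
  fixes B :: 'a and B2 B0 \<mu> \<eta> :: 'c
  assumes biduality: biduality
    and opmonoidal_monad: "opmonoidal_monad enveloping B B2 B0 \<mu> \<eta>"
begin

lemma biduality_simps [simp]:
  "R \<in> Ob M" "R' \<in> Ob M" "n \<in> Ar M" "src M n = I" "trg M n = R' \<cdot> R" "e \<in> Ar M" "src M e = R \<cdot> R'" "trg M e = I"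
  using biduality unfolding biduality_def by auto

lemma act_mul [simp]:
  "act \<in> Ar M" "src M act = R \<cdot> E" "trg M act = R" "mul \<in> Ar M" "src M mul = E \<cdot> E" "trg M mul = E"
proof -
  show a: "act \<in> Ar M" "src M act = R \<cdot> E" "trg M act = R" unfolding act_def by simp_all
  show "mul \<in> Ar M" "src M mul = E \<cdot> E" "trg M mul = E" unfolding mul_def by (simp_all add: a)
qed

lemma expand_act_mul [simp]:
  "pinvertible expand_act" "valid expand_act" "psrc expand_act = [act]" "ptrg expand_act = [\<l> R, e \<otimes> one R, \<a>\<^sup>* R R' R]"
  "pinvertible expand_mul" "valid expand_mul" "psrc expand_mul = [mul]" "ptrg expand_mul = [one R' \<otimes> act, \<a> R' R E]"
  unfolding expand_act_def expand_mul_def by (simp_all add: act_def mul_def del: pth.simps)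

lemma sigrP_typing [simp]:
  "valid sigrP" "psrc sigrP = [\<l> R, e \<otimes> one R, \<a>\<^sup>* R R' R, one R \<otimes> n]" "ptrg sigrP = [\<r> R]"
  using biduality unfolding biduality_def icell_iff valid_def by (auto simp: sigrP_def invertible_in)

lemma act0_typing [simp]: "valid act0" "psrc act0 = [act, one R \<otimes> n]" "ptrg act0 = [\<r> R]"
  unfolding act0_def by (simp_all add: valid_pvcomp)

lemma act2_typing [simp]: "valid act2" "psrc act2 = [act, one R \<otimes> mul, \<a> R E E]" "ptrg act2 = [act, act \<otimes> one E]"
  unfolding act2_def by (simp_all add: valid_pvcomp)

end

section \<open>Lifting a monoidal structure\<close>

text \<open>A family of objects over the objects of a monoidal category \<open>D\<close>, with a choice of those arrows of
  \<open>D\<close> that lift. If the choice is closed under composition, inverses and tensor products and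
  contains the constraints, the monoidal structure lifts. Naturality and coherence are
  inherited, as an arrow of the lifted category is determined by its image and its ends.\<close>

locale monoidal_lifting = monoidal_category D S
  for D :: "('y, 'g) cat" and S :: "('y, 'g) monoidal_structure" +
  fixes ob :: "'x set" and U :: "'x \<Rightarrow> 'y" and lifts :: "'x \<Rightarrow> 'x \<Rightarrow> 'g \<Rightarrow> bool"
    and ten :: "'x \<Rightarrow> 'x \<Rightarrow> 'x" and unt :: 'x
  assumes U_in: "x \<in> ob ==> U x \<in> Obj D"
    and lifts_hom: "x \<in> ob ==> y \<in> ob ==> lifts x y g ==> in_hom D g (U x) (U y)"
    and lifts_Id: "x \<in> ob ==> lifts x x (Id D (U x))"
    and lifts_Cmp: "x \<in> ob ==> y \<in> ob ==> z \<in> ob ==> lifts x y g ==> lifts y z h ==> lifts x z (Cmp D h g)"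
    and lifts_inverse: "x \<in> ob ==> y \<in> ob ==> lifts x y g ==> in_hom D h (U y) (U x) ==>
      Cmp D h g = Id D (U x) ==> Cmp D g h = Id D (U y) ==> lifts y x h"
    and ten_in: "x \<in> ob ==> y \<in> ob ==> ten x y \<in> ob"
    and U_ten: "x \<in> ob ==> y \<in> ob ==> U (ten x y) = TO S (U x) (U y)"
    and unt_in: "unt \<in> ob"
    and U_unt: "U unt = TU S"
    and lifts_ten: "x \<in> ob ==> x' \<in> ob ==> y \<in> ob ==> y' \<in> ob ==> lifts x x' g ==> lifts y y' h ==>
      lifts (ten x y) (ten x' y') (TA S g h)"
    and lifts_TAss: "x \<in> ob ==> y \<in> ob ==> z \<in> ob ==>
      lifts (ten (ten x y) z) (ten x (ten y z)) (TAss S (U x) (U y) (U z))"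
    and lifts_TLun: "x \<in> ob ==> lifts (ten unt x) x (TLun S (U x))"
    and lifts_TRun: "x \<in> ob ==> lifts (ten x unt) x (TRun S (U x))"
begin

definition lift_cat :: "('x, 'x \<times> 'g \<times> 'x) cat" where
  "lift_cat = \<lparr> Obj = ob, Arr = {(x, g, y). x \<in> ob \<and> y \<in> ob \<and> lifts x y g},
     Dom = (\<lambda>(x, g, y). x), Cod = (\<lambda>(x, g, y). y), Id = (\<lambda>x. (x, Id D (U x), x)),
     Cmp = (\<lambda>(_, h, z) (x, g, _). (x, Cmp D h g, z)) \<rparr>"

definition lift_structure :: "('x, 'x \<times> 'g \<times> 'x) monoidal_structure" where
  "lift_structure = \<lparr> TO = ten, TA = (\<lambda>(x, g, x') (y, h, y'). (ten x y, TA S g h, ten x' y')), TU = unt,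
     TAss = (\<lambda>x y z. (ten (ten x y) z, TAss S (U x) (U y) (U z), ten x (ten y z))),
     TLun = (\<lambda>x. (ten unt x, TLun S (U x), x)), TRun = (\<lambda>x. (ten x unt, TRun S (U x), x)) \<rparr>"

lemma lift_simps [simp]:
  "Obj lift_cat = ob" "(x, g, y) \<in> Arr lift_cat \<longleftrightarrow> x \<in> ob \<and> y \<in> ob \<and> lifts x y g"
  "Dom lift_cat (x, g, y) = x" "Cod lift_cat (x, g, y) = y" "Id lift_cat x = (x, Id D (U x), x)"
  "Cmp lift_cat (y, h, z) (x, g, y') = (x, Cmp D h g, z)"
  "TO lift_structure = ten" "TU lift_structure = unt"
  "TA lift_structure (x, g, x') (y, h, z) = (ten x y, TA S g h, ten x' z)"
  "TAss lift_structure x y z = (ten (ten x y) z, TAss S (U x) (U y) (U z), ten x (ten y z))"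
  "TLun lift_structure x = (ten unt x, TLun S (U x), x)" "TRun lift_structure x = (ten x unt, TRun S (U x), x)"
  by (simp_all add: lift_cat_def lift_structure_def)

lemma in_hom_lift: "in_hom lift_cat f x y \<longleftrightarrow> x \<in> ob \<and> y \<in> ob \<and> (\<exists>g. f = (x, g, y) \<and> lifts x y g)"
  unfolding in_hom_def by (cases f) (auto simp: lift_cat_def)

lemma in_hom_lift_base:
  "in_hom lift_cat f x y \<longleftrightarrow>
    x \<in> ob \<and> y \<in> ob \<and> (\<exists>g. f = (x, g, y) \<and> lifts x y g \<and> in_hom D g (U x) (U y))"
  using in_hom_lift lifts_hom by blast

lemma iso_in_lift:
  assumes "x \<in> ob" "y \<in> ob" "lifts x y g" "iso_in D g (U x) (U y)"
  shows "iso_in lift_cat (x, g, y) x y"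
proof -
  obtain h where h: "in_hom D h (U y) (U x)" "Cmp D h g = Id D (U x)" "Cmp D g h = Id D (U y)"
    using assms(4) unfolding iso_in_def by auto
  then have "lifts y x h" using assms(1-3) lifts_inverse by blast
  then have "in_hom lift_cat (y, h, x) y x" using assms by (simp add: in_hom_lift)
  then show ?thesis unfolding iso_in_def using assms h by (auto simp: in_hom_lift)
qed

lemmas lift_closed = U_in lifts_Id lifts_Cmp ten_in U_ten unt_in U_unt lifts_ten lifts_TAss lifts_TLun lifts_TRun

lemma iso_Id: "X \<in> Obj D ==> iso_in D (Id D X) X X"
  unfolding iso_in_def using Id_hom Cmp_Id_left by blast

lemma lift_monoidal: "monoidal_category lift_cat lift_structure"
proof (unfold_locales, goal_cases)
  case (1 f)
  then show ?case by (cases f) simp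
next
  case (2 f)
  then show ?case by (cases f) simp
next
  case 11
  then show ?case by (simp add: U_ten TA_Id U_in)
next
  case 13
  then show ?case by (auto intro!: iso_in_lift simp: lift_closed TAss_iso)
next
  case 15
  then show ?case by (auto intro!: iso_in_lift simp: lift_closed TLun_iso)
next
  case 17
  then show ?case by (auto intro!: iso_in_lift simp: lift_closed TRun_iso)
next
  case 19
  then show ?case by (simp add: U_ten U_in T_pentagon)
next
  case 20
  then show ?case by (simp add: U_unt U_in T_triangle)
next
  case 3
  then show ?case by (simp add: in_hom_lift lifts_Id)
next
  case 10
  then show ?case by (auto simp: in_hom_lift ten_in lifts_ten)
next
  case 4
  then show ?case by (auto simp: in_hom_lift lifts_Cmp)
next
  case 12
  then show ?case by (auto simp: in_hom_lift_base intro: TA_Cmp)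
next
  case 14
  then show ?case by (auto simp: in_hom_lift_base intro: TAss_natural)
qed (auto simp: in_hom_lift_base unt_in ten_in U_unt
    intro: Cmp_Id_right Cmp_Id_left Cmp_assoc TLun_natural TRun_natural)

theorem lift_strong_monoidal:
  "strong_monoidal_functor lift_cat lift_structure D S U (\<lambda>(x, g, y). g)
    (\<lambda>x y. Id D (TO S (U x) (U y))) (Id D (TU S))"
proof -
  interpret L: monoidal_category lift_cat lift_structure by (rule lift_monoidal)
  have [simp]: "TA S (Id D X) (Id D Y) = Id D (TO S X Y)" if "X \<in> Obj D" "Y \<in> Obj D" for X Y
    using that TA_Id by blast
  have [simp]: "Cmp D (Id D (TO S X (TO S Y Z))) (TAss S X Y Z) = TAss S X Y Z"
    "Cmp D (TAss S X Y Z) (Id D (TO S (TO S X Y) Z)) = TAss S X Y Z"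
    if "X \<in> Obj D" "Y \<in> Obj D" "Z \<in> Obj D" for X Y Z
    using TAss_iso[OF that] Cmp_Id_left Cmp_Id_right unfolding iso_in_def by blast+
  have [simp]: "Cmp D (TLun S X) (Id D (TO S (TU S) X)) = TLun S X"
    "Cmp D (TRun S X) (Id D (TO S X (TU S))) = TRun S X" if "X \<in> Obj D" for X
    using TLun_iso[OF that] TRun_iso[OF that] Cmp_Id_right unfolding iso_in_def by blast+
  show ?thesis
  proof (unfold_locales, goal_cases)
    case 6
    then show ?case
      by (auto simp: in_hom_lift Cmp_Id_left[OF TA_hom[OF lifts_hom lifts_hom]]
          Cmp_Id_right[OF TA_hom[OF lifts_hom lifts_hom]])
  qed (auto simp: in_hom_lift_base lift_closed TU_in TO_in iso_Id Cmp_Id_left[OF Id_hom])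
qed

end

context bicategory begin

lemma homcat_sel [simp]:
  "f \<in> Obj (homcat X Y) \<longleftrightarrow> f \<in> Ar M \<and> src M f = X \<and> trg M f = Y"
  "Id (homcat X Y) = cid" "Cmp (homcat X Y) = (\<bullet>)" "Dom (homcat X Y) = cdom M" "Cod (homcat X Y) = ccod M"
  "\<theta> \<in> Arr (homcat X Y) \<longleftrightarrow> \<theta> \<in> Ce M \<and> src M (cdom M \<theta>) = X \<and> trg M (cdom M \<theta>) = Y"
  by (auto simp: homcat_def)

lemma comp_monoidal_sel [simp]:
  "TO (comp_monoidal X) = (\<odot>)" "TA (comp_monoidal X) = (\<star>)" "TU (comp_monoidal X) = one X"
  "TAss (comp_monoidal X) = bass M" "TLun (comp_monoidal X) = blun M" "TRun (comp_monoidal X) = brun M"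
  by (simp_all add: comp_monoidal_def)

lemma in_hom_homcat [simp]:
  "in_hom (homcat X Y) \<theta> f g \<longleftrightarrow> \<theta> \<in> Ce M \<and> cdom M \<theta> = f \<and> ccod M \<theta> = g \<and> src M f = X \<and> trg M f = Y"
  unfolding in_hom_def by auto

lemma iso_in_homcat:
  "invertible \<theta> ==> cdom M \<theta> = f ==> ccod M \<theta> = g ==> src M f = X ==> trg M f = Y ==>
    iso_in (homcat X Y) \<theta> f g"
  unfolding iso_in_def by (auto simp: invertible_in intro!: exI[of _ "cinv \<theta>"])

lemma homcat_monoidal:
  assumes [simp]: "X \<in> Ob M"
  shows "monoidal_category (homcat X X) (comp_monoidal X)"
proof (unfold_locales, goal_cases)
  case 13 then show ?case by (auto intro!: iso_in_homcat)
next
  case 14 then show ?case using bass_nat by auto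
next
  case 15 then show ?case by (auto intro!: iso_in_homcat)
next
  case (16 f Y Z) then show ?case using blun_natural[of f Y Z] by auto
next
  case 17 then show ?case by (auto intro!: iso_in_homcat)
next
  case (18 f Y Z) then show ?case using brun_natural[of f Y Z] by auto
next
  case 19 then show ?case by (auto intro!: bicat_pentagon)
next
  case 20 then show ?case by (auto intro!: bicat_triangle)
qed (auto simp: vassoc hcomp_interchange)

end

section \<open>Comodules of an opmonoidal monad on the enveloping monoidale\<close>

context biduality_opmonoidal_monad begin

lemma enveloping_simps [simp]:
  "mobj enveloping = E" "mmul enveloping = mul" "muni enveloping = n"
  by (simp_all add: enveloping_def)

lemma B_simps [simp]:
  "B \<in> Ar M" "src M B = E" "trg M B = E"
  "B2 \<in> Ce M" "cdom M B2 = B \<odot> mul" "ccod M B2 = mul \<odot> (B \<otimes> B)"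
  "B0 \<in> Ce M" "cdom M B0 = B \<odot> n" "ccod M B0 = n"
  "\<mu> \<in> Ce M" "cdom M \<mu> = B \<odot> B" "ccod M \<mu> = B"
  "\<eta> \<in> Ce M" "cdom M \<eta> = one E" "ccod M \<eta> = B"
  using opmonoidal_monad unfolding opmonoidal_monad_def opmonoidal_arrow_def opmonoidal_cell_def Let_def
  by auto

abbreviation "B2P \<equiv> op2P enveloping enveloping B B2"
abbreviation "B0P \<equiv> op0P enveloping enveloping B B0"
abbreviation "muP \<equiv> ([B, B], \<mu>, [B])"

lemma BP_simps [simp]:
  "valid B2P" "psrc B2P = [B, mul]" "ptrg B2P = [mul, B \<otimes> B]" "pcell_cell B2P = B2"
  "valid B0P" "psrc B0P = [B, n]" "ptrg B0P = [n]" "pcell_cell B0P = B0" "valid muP"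
  unfolding valid_def by (simp_all add: op2P_def op0P_def)

text \<open>The laws of an opmonoidal monad are given for \<open>\<mu> : B \<odot> B \<Rightarrow> B\<close>; by contraction they become laws for
  a pasting cell \<open>[B, B] \<Rightarrow> [B]\<close>.\<close>

lemma muP_single: "muP = contract B B ;; single \<mu>"
  by (rule pcell_eqI) simp_all

lemma monad_eqs:
  "B2 \<bullet> (\<mu> \<star> cid mul) = (cid mul \<star> (\<mu> \<otimes>\<^sub>c \<mu>)) \<bullet> square_op2 enveloping B B2"
  "B0 \<bullet> (\<mu> \<star> cid n) = square_op0 enveloping B B0"
  "B2 \<bullet> (\<eta> \<star> cid mul) = (cid mul \<star> (\<eta> \<otimes>\<^sub>c \<eta>)) \<bullet> id_op2 enveloping"
  "B0 \<bullet> (\<eta> \<star> cid n) = blun M n"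
  "\<mu> \<bullet> (\<mu> \<star> cid B) = \<mu> \<bullet> (cid B \<star> \<mu>) \<bullet> bass M B B B"
  "\<mu> \<bullet> (\<eta> \<star> cid B) = blun M B"
  "\<mu> \<bullet> (cid B \<star> \<eta>) = brun M B"
  using opmonoidal_monad unfolding opmonoidal_monad_def opmonoidal_cell_def id_op0_def by auto

lemma square_op2_eq: "square_op2 enveloping B B2 = pcell_cell
    (wh [] (pinv (contract B B)) [mul] ;; wh [B] B2P [] ;; wh [] B2P [B \<otimes> B] ;; wh [mul] (contract B B \<boxtimes> contract B B) [])"
  unfolding square_op2_def ptens_contract[OF B_simps(1) B_simps(1) B_simps(1) B_simps(1), simplified, symmetric]
  by (simp add: expand_contract whisk_wh pvcomp_paste paste_assoc)

lemma square_op0_eq: "square_op0 enveloping B B0 = pcell_cell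
    (wh [] (pinv (contract B B)) [n] ;; wh [B] B0P [] ;; B0P)"
  unfolding square_op0_def by (simp add: expand_contract whisk_wh pvcomp_paste paste_assoc)

lemma id_op2_eq: "id_op2 enveloping = pcell_cell (pinv (swaps [mul]) ;; wh [mul] (oneP E E) [])"
  unfolding id_op2_def by (simp add: run_runs lun_luns pinv_swaps whisk_wh pvcomp_paste)

sublocale comodule_calculus M R E act mul n B act2 act0 B2P B0P muP "single \<eta>"
proof unfold_locales
  let ?c = "contract B B"
  have c: "wh [] ?c us ;; wh [] (pinv ?c) us = pident (B # B # us)" if "composable (B # us)" for us
    using that by (simp add: wh_paste[symmetric] wh_pident)
  have "wh [] (single \<mu>) [mul] ;; B2P = (wh [] (pinv ?c) [mul] ;; wh [B] B2P [] ;; wh [] B2P [B \<otimes> B] ;;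
      wh [mul] (?c \<boxtimes> ?c) []) ;; wh [mul] (single \<mu> \<boxtimes> single \<mu>) []" (is "?L = ?X ;; ?Y")
  proof (rule pcell_eqI)
    have "pcell_cell (?X ;; ?Y) = pcell_cell ?Y \<bullet> pcell_cell ?X"
      by (rule paste_sel) simp_all
    then show "pcell_cell ?L = pcell_cell (?X ;; ?Y)"
      using monad_eqs(1) unfolding square_op2_eq[symmetric]
      by (simp add: pcell_cell_wh_left pcell_cell_wh_right single_ptens)
  qed (simp_all)
  then show "wh [] muP [mul] ;; B2P = wh [B] B2P [] ;; wh [] B2P [B \<otimes> B] ;; wh [mul] (muP \<boxtimes> muP) []"
    unfolding muP_single using c[of "[mul]"]
    by (simp add: wh_paste ptens_paste paste_assoc) (simp add: paste_assoc[symmetric])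
  have "wh [] (single \<mu>) [n] ;; B0P = wh [] (pinv ?c) [n] ;; wh [B] B0P [] ;; B0P" (is "?L = ?X")
  proof (rule pcell_eqI)
    show "pcell_cell ?L = pcell_cell ?X"
      using monad_eqs(2) unfolding square_op0_eq by (simp add: pcell_cell_wh_right)
  qed (simp_all)
  then show "wh [] muP [n] ;; B0P = wh [B] B0P [] ;; B0P"
    unfolding muP_single using c[of "[n]"]
    by (simp add: wh_paste paste_assoc) (simp add: paste_assoc[symmetric])
  show "wh [] (single \<eta>) [mul] ;; B2P = pinv (swaps [mul]) ;; wh [mul] (oneP E E ;; (single \<eta> \<boxtimes> single \<eta>)) []" (is "?L = ?R")
  proof (rule pcell_eqI)
    have "?R = (pinv (swaps [mul]) ;; wh [mul] (oneP E E) []) ;; wh [mul] (single (\<eta> \<otimes>\<^sub>c \<eta>)) []" (is "_ = ?X ;; ?Y")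
      by (simp add: wh_paste paste_assoc single_ptens)
    moreover have "pcell_cell (?X ;; ?Y) = pcell_cell ?Y \<bullet> pcell_cell ?X"
      by (rule paste_sel) simp_all
    ultimately show "pcell_cell ?L = pcell_cell ?R"
      using monad_eqs(3) unfolding id_op2_eq[symmetric]
      by (simp add: pcell_cell_wh_left pcell_cell_wh_right)
  qed (simp_all)
  show "wh [] (single \<eta>) [n] ;; B0P = luns [n]"
    by (rule pcell_eqI) (simp_all add: pcell_cell_wh_right monad_eqs, simp add: luns_def)
  have m: "pcell_cell (wh [] muP [B]) = (\<mu> \<star> cid B) \<bullet> cinv (bass M B B B)"
    by (simp add: wh_eq lwhisk_def rwhisk_def) (simp add: phcomp_def)
  show "wh [] muP [B] ;; muP = wh [B] muP [] ;; muP" (is "?L = ?R")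
  proof (rule pcell_eqI)
    have "\<mu> \<bullet> (\<mu> \<star> cid B) \<bullet> cinv (bass M B B B) = (\<mu> \<bullet> (\<mu> \<star> cid B)) \<bullet> cinv (bass M B B B)"
      by (simp add: vassoc)
    also have "\<dots> = \<mu> \<bullet> (cid B \<star> \<mu>)"
      unfolding monad_eqs(5) by (simp add: vassoc)
    finally show "pcell_cell ?L = pcell_cell ?R"
      by (simp add: m pcell_cell_wh_left)
  qed (simp_all)
  show "wh [] (single \<eta>) [B] ;; muP = luns [B]"
    by (rule pcell_eqI) (simp_all add: pcell_cell_wh_right monad_eqs, simp add: luns_def)
  show "wh [B] (single \<eta>) [] ;; muP = runs [B]"
    by (rule pcell_eqI) (simp_all add: pcell_cell_wh_left monad_eqs, simp add: runs_def)
qed simp_all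

lemma comodP_sel [simp]: "psrc (comodP b Y y) = [Y, act]" "ptrg (comodP b Y y) = [act, Y \<otimes> b]" "pcell_cell (comodP b Y y) = y"
  by (simp_all add: comodP_def)

lemma comodule_iff: "comodule B B2 B0 Y y \<longleftrightarrow> comod Y (comodP B Y y)"
proof (cases "Y \<in> Ar M \<and> src M Y = R \<and> trg M Y = R \<and> y \<in> Ce M \<and> cdom M y = Y \<odot> act \<and> ccod M y = act \<odot> (Y \<otimes> B)")
  case True
  then have [simp]: "Y \<in> Ar M" "src M Y = R" "trg M Y = R" "valid (comodP B Y y)"
    by (simp_all add: valid_def)
  show ?thesis
    unfolding comodule_def comod_def B0'_def using True
    by (simp add: whisk_wh pvcomp_paste paste_assoc sqtens_ptens swap_swaps run_runs)
next
  case False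
  then show ?thesis unfolding comodule_def comod_def valid_def by auto
qed

lemma comodP_eq: "psrc P = [Y, act] ==> ptrg P = [act, Y \<otimes> B] ==> comodP B Y (pcell_cell P) = P"
  by (rule pcell_eqI) simp_all

lemma comodule_morphism_iff:
  assumes "comod Y (comodP B Y y)" "comod Y' (comodP B Y' y')"
  shows "comodule_morphism B Y y Y' y' \<gamma> \<longleftrightarrow>
    \<gamma> \<in> Ce M \<and> comod_mor Y (comodP B Y y) Y' (comodP B Y' y') (single \<gamma>)"
proof (cases "\<gamma> \<in> Ce M \<and> cdom M \<gamma> = Y \<and> ccod M \<gamma> = Y'")
  case True
  note [simp] = comodD(1-4)[OF assms(1)] comodD(1-4)[OF assms(2)]
  have [simp]: "\<gamma> \<in> Ce M" "cdom M \<gamma> = Y" "ccod M \<gamma> = Y'" using True by auto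
  let ?L = "wh [] (single \<gamma>) [act] ;; comodP B Y' y'" and ?R = "comodP B Y y ;; wh [act] (single \<gamma> \<boxtimes> pident [B]) []"
  have "pcell_cell ?L = y' \<bullet> (\<gamma> \<star> cid act)"
    by (simp add: pcell_cell_wh_right)
  moreover have "pcell_cell ?R = (cid act \<star> (\<gamma> \<otimes>\<^sub>c cid B)) \<bullet> y"
    by (simp add: pcell_cell_wh_left single_cid[symmetric] single_ptens)
  moreover have "psrc ?L = psrc ?R" "ptrg ?L = ptrg ?R" by simp_all
  ultimately have "?L = ?R \<longleftrightarrow> y' \<bullet> (\<gamma> \<star> cid act) = (cid act \<star> (\<gamma> \<otimes>\<^sub>c cid B)) \<bullet> y"
    using pcell_eqI[of ?L ?R] by metis
  then show ?thesis
    unfolding comodule_morphism_def comod_mor_def by simp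
next
  case False
  then show ?thesis unfolding comodule_morphism_def comod_mor_def by auto
qed

text \<open>Comodules are pairs \<open>(Y, y)\<close> with a cell \<open>y\<close>, so that the coaction is extracted from the pasting
  cell of \<open>composite\<close>, whose paths carry no further information.\<close>

definition comod_tensor :: "'a \<times> 'c \<Rightarrow> 'a \<times> 'c \<Rightarrow> 'a \<times> 'c" where
  "comod_tensor Yy Zz = (case (Yy, Zz) of ((Y, y), (Z, z)) \<Rightarrow>
     (Y \<odot> Z, pcell_cell (composite Y (comodP B Y y) Z (comodP B Z z))))"

definition unit_comodule :: "'a \<times> 'c" where "unit_comodule = (one R, pcell_cell unit_coaction)"

definition comods :: "('a \<times> 'c) set" where "comods = {(Y, y). comodule B B2 B0 Y y}"

lemma comods_iff: "(Y, y) \<in> comods \<longleftrightarrow> comod Y (comodP B Y y)"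
  by (simp add: comods_def comodule_iff)

lemma comodP_composite:
  assumes "comod Y y" "comod Z z"
  shows "comodP B (Y \<odot> Z) (pcell_cell (composite Y y Z z)) = composite Y y Z z"
  by (rule comodP_eq) (simp_all add: composite_simps[OF assms])

lemma comodP_unit: "comodP B (one R) (pcell_cell unit_coaction) = unit_coaction"
  by (rule comodP_eq) simp_all

definition coaction :: "'a \<times> 'c \<Rightarrow> ('a, 'c) pcell" where
  "coaction x = comodP B (fst x) (snd x)"

lemma morphism_iff:
  assumes "x \<in> comods" "y \<in> comods"
  shows "(case x of (Y, y) \<Rightarrow> \<lambda>(Y', y'). comodule_morphism B Y y Y' y') y g \<longleftrightarrow>
    g \<in> Ce M \<and> comod_mor (fst x) (coaction x) (fst y) (coaction y) (single g)"
  using assms by (cases x; cases y) (simp add: comods_iff coaction_def comodule_morphism_iff)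

lemma comodsD:
  assumes "x \<in> comods"
  shows "comod (fst x) (coaction x)" "fst x \<in> Ar M" "src M (fst x) = R" "trg M (fst x) = R"
  using assms by (cases x; auto simp: comods_iff coaction_def dest: comodD)+

lemma comod_tensor_simps:
  assumes "x \<in> comods" "y \<in> comods"
  shows "comod_tensor x y \<in> comods" (is ?A1) "fst (comod_tensor x y) = fst x \<odot> fst y" (is ?A2)
    "coaction (comod_tensor x y) = composite (fst x) (coaction x) (fst y) (coaction y)" (is ?A3)
proof -
  have "comod_tensor x y = (fst x \<odot> fst y, pcell_cell (composite (fst x) (coaction x) (fst y) (coaction y)))"
    by (cases x; cases y) (simp add: comod_tensor_def coaction_def)
  then show ?A1 ?A2 ?A3
    using comodP_composite[OF comodsD(1)[OF assms(1)] comodsD(1)[OF assms(2)]]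
      comod_composite[OF comodsD(1)[OF assms(1)] comodsD(1)[OF assms(2)]]
    by (simp_all add: comods_iff coaction_def[of "(_, _)"])
qed

lemma unit_comodule_simps:
  "unit_comodule \<in> comods" "fst unit_comodule = one R" "coaction unit_comodule = unit_coaction"
  using comod_unit by (simp_all add: unit_comodule_def comods_iff coaction_def comodP_unit)

sublocale lift: monoidal_lifting "homcat R R" "comp_monoidal R" comods fst
  "\<lambda>(Y, y) (Y', y'). comodule_morphism B Y y Y' y'" comod_tensor unit_comodule
proof -
  interpret monoidal_category "homcat R R" "comp_monoidal R" by (rule homcat_monoidal) simp
  show "monoidal_lifting (homcat R R) (comp_monoidal R) comods fst
    (\<lambda>(Y, y) (Y', y'). comodule_morphism B Y y Y' y') comod_tensor unit_comodule"
  proof (unfold_locales, goal_cases)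
    case (1 x) then show ?case by (simp add: comodsD)
  next
    case (2 x y g)
    then show ?case using morphism_iff[OF 2(1,2)] unfolding comod_mor_def by (simp add: comodsD)
  next
    case (3 x)
    then show ?case using morphism_iff[OF 3 3] by (simp add: comodsD single_cid comod_mor_pident)
  next
    case (4 x y z g h)
    have g: "g \<in> Ce M" "comod_mor (fst x) (coaction x) (fst y) (coaction y) (single g)"
      and h: "h \<in> Ce M" "comod_mor (fst y) (coaction y) (fst z) (coaction z) (single h)"
      using 4(4,5) morphism_iff[OF 4(1,2)] morphism_iff[OF 4(2,3)] by blast+
    have e: "cdom M h = ccod M g" using g(2) h(2) unfolding comod_mor_def by simp
    show ?case
      using comod_mor_paste[OF comodsD(1)[OF 4(1)] comodsD(1)[OF 4(2)] comodsD(1)[OF 4(3)] g(2) h(2)]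
      unfolding morphism_iff[OF 4(1,3)] by (simp add: single_paste g h e)
  next
    case (5 x y g h)
    have g: "g \<in> Ce M" "comod_mor (fst x) (coaction x) (fst y) (coaction y) (single g)"
      using 5(3) morphism_iff[OF 5(1,2)] by blast+
    have e: "cdom M g = fst x" "ccod M g = fst y" using g(2) unfolding comod_mor_def by simp_all
    have "inverse_cells g h" unfolding inverse_cells_def using 5(4-6) g e by simp
    then have i: "invertible g" "cinv g = h" using inverse_cells_invertible cinv_eq by blast+
    show ?case
      using comod_mor_pinv[OF comodsD(1)[OF 5(1)] comodsD(1)[OF 5(2)] g(2)] pinv_single[OF i(1)] 5(4) i(2)
      unfolding morphism_iff[OF 5(2,1)] by simp
  next
    case (6 x y) then show ?case by (rule comod_tensor_simps)
  next
    case (7 x y) then show ?case by (simp add: comod_tensor_simps)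
  next
    case 8 then show ?case by (rule unit_comodule_simps)
  next
    case 9 then show ?case by (simp add: unit_comodule_simps)
  next
    case (10 x x' y y' g h)
    have g: "g \<in> Ce M" "comod_mor (fst x) (coaction x) (fst x') (coaction x') (single g)"
      and h: "h \<in> Ce M" "comod_mor (fst y) (coaction y) (fst y') (coaction y') (single h)"
      using 10(5,6) morphism_iff[OF 10(1,2)] morphism_iff[OF 10(3,4)] by blast+
    have [simp]: "cdom M g = fst x" "ccod M g = fst x'" "cdom M h = fst y" "ccod M h = fst y'"
      using g h unfolding comod_mor_def by simp_all
    note [simp] = comodsD(2-4)[OF 10(1)] comodsD(2-4)[OF 10(2)] comodsD(2-4)[OF 10(3)] comodsD(2-4)[OF 10(4)] g(1) h(1)
    have "comod_mor (fst (comod_tensor x y)) (coaction (comod_tensor x y))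
        (fst (comod_tensor x' y')) (coaction (comod_tensor x' y')) (single (g \<star> h))"
      unfolding comod_tensor_simps(2,3)[OF 10(1,3)] comod_tensor_simps(2,3)[OF 10(2,4)]
      by (rule comod_mor_composite[OF comodsD(1)[OF 10(1)] comodsD(1)[OF 10(3)] comodsD(1)[OF 10(2)]
            comodsD(1)[OF 10(4)] g(2) h(2)]) (simp_all add: composite_single)
    then show ?case
      unfolding morphism_iff[OF comod_tensor_simps(1)[OF 10(1,3)] comod_tensor_simps(1)[OF 10(2,4)]] by simp
  next
    case (11 x y z)
    note [simp] = comodsD(2-4)[OF 11(1)] comodsD(2-4)[OF 11(2)] comodsD(2-4)[OF 11(3)]
    note t = comod_tensor_simps(1)[OF 11(1,2)] comod_tensor_simps(1)[OF 11(2,3)]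
    have "comod_mor (fst (comod_tensor (comod_tensor x y) z)) (coaction (comod_tensor (comod_tensor x y) z))
        (fst (comod_tensor x (comod_tensor y z))) (coaction (comod_tensor x (comod_tensor y z)))
        (single (bass M (fst x) (fst y) (fst z)))"
      unfolding comod_tensor_simps(2,3)[OF t(1) 11(3)] comod_tensor_simps(2,3)[OF 11(1) t(2)]
        comod_tensor_simps(2,3)[OF 11(1,2)] comod_tensor_simps(2,3)[OF 11(2,3)]
      by (rule comod_mor_assoc[OF comodsD(1)[OF 11(1)] comodsD(1)[OF 11(2)] comodsD(1)[OF 11(3)]])
        (simp_all add: assoc_single)
    then show ?case
      unfolding morphism_iff[OF comod_tensor_simps(1)[OF t(1) 11(3)] comod_tensor_simps(1)[OF 11(1) t(2)]]
      by simp
  next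
    case (12 x)
    note [simp] = comodsD(2-4)[OF 12]
    have "comod_mor (one R \<odot> fst x) (composite (one R) unit_coaction (fst x) (coaction x))
        (fst x) (coaction x) (single (blun M (fst x)))"
      by (rule comod_mor_left_unit[OF comodsD(1)[OF 12]]) (simp_all add: unit_single(1)[of "fst x", simplified])
    then show ?case
      unfolding morphism_iff[OF comod_tensor_simps(1)[OF unit_comodule_simps(1) 12] 12]
      by (simp add: comod_tensor_simps unit_comodule_simps 12)
  next
    case (13 x)
    note [simp] = comodsD(2-4)[OF 13]
    have "comod_mor (fst x \<odot> one R) (composite (fst x) (coaction x) (one R) unit_coaction)
        (fst x) (coaction x) (single (brun M (fst x)))"
      by (rule comod_mor_right_unit[OF comodsD(1)[OF 13]]) (simp_all add: unit_single(2)[of "fst x", simplified])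
    then show ?case
      unfolding morphism_iff[OF comod_tensor_simps(1)[OF 13 unit_comodule_simps(1)] 13]
      by (simp add: comod_tensor_simps unit_comodule_simps 13)
  qed
qed

lemma rComod_lift_cat: "rComod B B2 B0 = lift.lift_cat"
  unfolding rComod_def lift.lift_cat_def by (auto simp: comods_def fun_eq_iff)

lemma rComod_strong_monoidal:
  "\<exists>T \<phi> \<phi>\<^sub>0. strong_monoidal_functor (rComod B B2 B0) T (homcat R R) (comp_monoidal R)
    forget_ob forget_ar \<phi> \<phi>\<^sub>0"
proof -
  have "forget_ob = fst" "forget_ar = (\<lambda>(x, g, y). g)"
    by (auto simp: forget_ob_def forget_ar_def fun_eq_iff)
  then show ?thesis
    using lift.lift_strong_monoidal unfolding rComod_lift_cat by metis
qed

end

theorem corollary7p19: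
  fixes M :: "('o, 'a, 'c) tensor_bicat"
  assumes "monoidal_bicategory M"
    and "biduality_data.biduality M R R' n e \<sigma>l \<sigma>r"
    and "tensor_data.opmonoidal_monad M (biduality_data.enveloping M R R' n e \<sigma>l \<sigma>r) B B2 B0 \<mu> \<eta>"
  shows "\<exists>T \<phi> \<phi>\<^sub>0.
    strong_monoidal_functor
      (biduality_data.rComod M R R' n e \<sigma>l \<sigma>r B B2 B0) T
      (bicat_data.homcat M R R) (bicat_data.comp_monoidal M R)
      biduality_data.forget_ob biduality_data.forget_ar \<phi> \<phi>\<^sub>0"
proof -
  interpret biduality_opmonoidal_monad M R R' n e \<sigma>l \<sigma>r B B2 B0 \<mu> \<eta>
    using assms by (intro biduality_opmonoidal_monad.intro biduality_opmonoidal_monad_axioms.intro)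
  show ?thesis by (rule rComod_strong_monoidal)
qed

end
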